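(* For each of the rules $12$, $123$ and $124$ on the square grid, the problem \textsc{Stability} is in $\mathbf{NC}$.
   Context: Square grid: cells are the elements of $\mathbb{Z}^2$; the neighbors $N(u)$ of $u$ are the four cells at Manhattan distance $1$. A configuration assigns to every cell a state in $\{0,1\}$ (1 = active, 0 = inactive). A freezing totalistic cellular automaton is given by $\mathcal{I}\subseteq\{1,2,3,4\}$ and acts synchronously by $F(c)_u=1$ if $c_u=1$ or $\sum_{v\in N(u)}c_v\in\mathcal{I}$, and $F(c)_u=0$ otherwise; rule $12$ means $\mathcal{I}=\{1,2\}$, rule $123$ means $\mathcal{I}=\{1,2,3\}$, rule $124$ means $\mathcal{I}=\{1,2,4\}$. A finite configuration of dimension $n\times n$ is $x:\{0,\dots,n-1\}^2\to\{0,1\}$, and $c(x)$ is the periodic configuration obtained by repeating $x$ in all directions. A cell $u$ with $c_u=0$ is stable for $c$ if $F^t(c)_u=0$ for all $t\ge0$. \textsc{Stability}: given $x$ and $u\in\{0,\dots,n-1\}^2$ with $x_u=0$, decide whether $u$ is stable for $c(x)$. $\mathbf{NC}$ is the class of decision problems solvable on a PRAM in time $(\log n)^{O(1)}$ with $n^{O(1)}$ processors. *)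

theory Defs
  imports Complex_Main "HOL-Library.Landau_Symbols"
begin

section \<open>Freezing totalistic cellular automata on the square grid\<close>

type_synonym cell = "int \<times> int"
type_synonym config = "cell \<Rightarrow> bool"

definition neighbors :: "cell \<Rightarrow> cell set" where
  "neighbors u = {v. \<bar>fst v - fst u\<bar> + \<bar>snd v - snd u\<bar> = 1}"

lemma neighbors_eq:
  "neighbors (a, b) = {(a - 1, b), (a + 1, b), (a, b - 1), (a, b + 1)}"
  unfolding neighbors_def by (auto simp: abs_if split: if_splits)

lemma card_neighbors: "card (neighbors u) = 4"
  by (cases u) (simp add: neighbors_eq)

definition ftca :: "nat set \<Rightarrow> config \<Rightarrow> config" where
  "ftca I c u \<longleftrightarrow> c u \<or> (\<Sum>v\<in>neighbors u. of_bool (c v)) \<in> I"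

definition stable :: "nat set \<Rightarrow> config \<Rightarrow> cell \<Rightarrow> bool" where
  "stable I c u \<longleftrightarrow> \<not> c u \<and> (\<forall>t. \<not> (ftca I ^^ t) c u)"

text \<open>A finite configuration of dimension \<open>n \<times> n\<close> is a function \<open>x\<close> on pairs of naturals of
  which only the values on \<open>{0..<n} \<times> {0..<n}\<close> are ever used.\<close>

definition periodic :: "nat \<Rightarrow> (nat \<times> nat \<Rightarrow> bool) \<Rightarrow> config" where
  "periodic n x = (\<lambda>(i, j). x (nat (i mod int n), nat (j mod int n)))"

text \<open>An instance \<open>(x, u)\<close> is written as \<open>2 n\<^sup>2\<close> bits: the states of the cells, row by row,
  followed by an equally long table in which exactly the entry of \<open>u\<close> is set.\<close>

definition encode :: "nat \<Rightarrow> (nat \<times> nat \<Rightarrow> bool) \<Rightarrow> nat \<times> nat \<Rightarrow> bool list" where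
  "encode n x u =
     map (\<lambda>k. x (k div n, k mod n)) [0..<n * n] @
     map (\<lambda>k. (k div n, k mod n) = u) [0..<n * n]"

lemma length_encode: "length (encode n x u) = 2 * n\<^sup>2"
  by (simp add: encode_def power2_eq_square)

lemma encode_inject:
  assumes eq: "encode n x (a, b) = encode m y (a', b')" and "a < n" "b < n"
  shows "m = n" "a' = a" "b' = b" "\<And>i j. i < n \<Longrightarrow> j < n \<Longrightarrow> y (i, j) = x (i, j)"
proof -
  have "n\<^sup>2 = m\<^sup>2"
    using arg_cong[OF eq, of length] by (simp add: length_encode)
  then show m: "m = n" by simp
  have less: "i * n + j < n * n" if "i < n" "j < n" for i j
  proof -
    have "i * n + j < Suc i * n" using that by simp
    also have "\<dots> \<le> n * n" using that by (intro mult_le_mono1) simp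
    finally show ?thesis .
  qed
  have 1: "x (k div n, k mod n) = y (k div n, k mod n)"
    and 2: "(k div n, k mod n) = (a, b) \<longleftrightarrow> (k div n, k mod n) = (a', b')"
    if "k < n * n" for k
    using eq that unfolding m encode_def by auto
  show "y (i, j) = x (i, j)" if "i < n" "j < n" for i j
    using 1[OF less[OF that]] that by simp
  show "a' = a" "b' = b"
    using 2[OF less[OF assms(2,3)]] assms(2,3) by simp_all
qed

definition stability :: "nat set \<Rightarrow> bool list set" where
  "stability I =
     {encode n x (a, b) | n x a b.
        a < n \<and> b < n \<and> \<not> x (a, b) \<and> stable I (periodic n x) (int a, int b)}"

section \<open>Parallel random access machines\<close>

text \<open>Synchronous processors run the same program, each with its own program counter and local
  registers, on a common memory of natural numbers. Within a step all reads precede all writes,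
  and if several processors write to the same cell the one with the least number succeeds
  (priority CRCW); \<open>NC\<close> does not depend on the convention for concurrent access. There is no
  unit-cost multiplication, so that after \<open>t\<close> steps all words have \<open>O(t + log n)\<close> bits.\<close>

datatype instr =
    Const nat nat       \<comment> \<open>\<open>R\<^sub>r := k\<close>\<close>
  | Add nat nat nat     \<comment> \<open>\<open>R\<^sub>r := R\<^sub>s + R\<^sub>q\<close>\<close>
  | Sub nat nat nat     \<comment> \<open>\<open>R\<^sub>r := R\<^sub>s - R\<^sub>q\<close>, truncated at \<open>0\<close>\<close>
  | Half nat nat        \<comment> \<open>\<open>R\<^sub>r := R\<^sub>s div 2\<close>\<close>
  | Load nat nat        \<comment> \<open>\<open>R\<^sub>r := M[R\<^sub>s]\<close>\<close>
  | Store nat nat       \<comment> \<open>\<open>M[R\<^sub>r] := R\<^sub>s\<close>\<close>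
  | JumpZero nat nat    \<comment> \<open>if \<open>R\<^sub>r = 0\<close> continue at position \<open>l\<close>\<close>

type_synonym program = "instr list"
type_synonym memory = "nat \<Rightarrow> nat"
type_synonym processor = "nat \<times> (nat \<Rightarrow> nat)"  \<comment> \<open>program counter and registers\<close>
type_synonym pram = "(nat \<Rightarrow> processor) \<times> memory"

fun exec :: "instr \<Rightarrow> memory \<Rightarrow> processor \<Rightarrow> processor" where
  "exec (Const r k) M (pc, R) = (pc + 1, R(r := k))"
| "exec (Add r s q) M (pc, R) = (pc + 1, R(r := R s + R q))"
| "exec (Sub r s q) M (pc, R) = (pc + 1, R(r := R s - R q))"
| "exec (Half r s) M (pc, R) = (pc + 1, R(r := R s div 2))"
| "exec (Load r s) M (pc, R) = (pc + 1, R(r := M (R s)))"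
| "exec (Store r s) M (pc, R) = (pc + 1, R)"
| "exec (JumpZero r l) M (pc, R) = (if R r = 0 then l else pc + 1, R)"

fun write_request :: "instr \<Rightarrow> (nat \<Rightarrow> nat) \<Rightarrow> (nat \<times> nat) option" where
  "write_request (Store r s) R = Some (R r, R s)"
| "write_request _ R = None"

text \<open>A processor whose program counter points outside the program has halted.\<close>

definition proc_halted :: "program \<Rightarrow> processor \<Rightarrow> bool" where
  "proc_halted prog q \<longleftrightarrow> length prog \<le> fst q"

definition proc_step :: "program \<Rightarrow> memory \<Rightarrow> processor \<Rightarrow> processor" where
  "proc_step prog M q = (if proc_halted prog q then q else exec (prog ! fst q) M q)"

definition proc_write :: "program \<Rightarrow> processor \<Rightarrow> (nat \<times> nat) option" where
  "proc_write prog q =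
     (if proc_halted prog q then None else write_request (prog ! fst q) (snd q))"

definition mem_step :: "program \<Rightarrow> nat \<Rightarrow> (nat \<Rightarrow> processor) \<Rightarrow> memory \<Rightarrow> memory" where
  "mem_step prog p Q M = (\<lambda>a.
     let W = {i. i < p \<and> (\<exists>v. proc_write prog (Q i) = Some (a, v))}
     in if W = {} then M a else snd (the (proc_write prog (Q (Min W)))))"

definition pram_step :: "program \<Rightarrow> nat \<Rightarrow> pram \<Rightarrow> pram" where
  "pram_step prog p = (\<lambda>(Q, M).
     (\<lambda>i. if i < p then proc_step prog M (Q i) else Q i, mem_step prog p Q M))"

definition pram_halted :: "program \<Rightarrow> nat \<Rightarrow> pram \<Rightarrow> bool" where
  "pram_halted prog p S \<longleftrightarrow> (\<forall>i<p. proc_halted prog (fst S i))"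

text \<open>Initially cell \<open>i\<close> of the memory contains the \<open>i\<close>-th input bit, register \<open>0\<close> of a processor
  its own number, and register \<open>1\<close> the length of the input; everything else is \<open>0\<close>.\<close>

definition pram_init :: "bool list \<Rightarrow> pram" where
  "pram_init w =
     (\<lambda>i. (0, (\<lambda>_. 0)(0 := i, 1 := length w)),
      \<lambda>a. if a < length w then of_bool (w ! a) else 0)"

definition pram_run :: "program \<Rightarrow> nat \<Rightarrow> bool list \<Rightarrow> nat \<Rightarrow> pram" where
  "pram_run prog p w t = (pram_step prog p ^^ t) (pram_init w)"

definition pram_decides ::
  "program \<Rightarrow> (nat \<Rightarrow> nat) \<Rightarrow> (nat \<Rightarrow> nat) \<Rightarrow> bool list set \<Rightarrow> bool" where
  "pram_decides prog P T L \<longleftrightarrow>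
     (\<forall>w. \<exists>t \<le> T (length w).
        pram_halted prog (P (length w)) (pram_run prog (P (length w)) w t) \<and>
        (w \<in> L \<longleftrightarrow> snd (pram_run prog (P (length w)) w t) 0 = 1))"

text \<open>The number of processors is a fixed polynomial in the input length rather than an arbitrary
  polynomially bounded function, which could act as non-uniform advice.\<close>

definition NC :: "bool list set set" where
  "NC = {L. \<exists>prog k j T. pram_decides prog (\<lambda>n. n ^ k + 1) T L \<and>
             (\<lambda>n. real (T n)) \<in> O(\<lambda>n. ln (real n) ^ j)}"

end

theory Submission
  imports Defs "HOL-Library.Discrete_Functions"
begin

text \<open>For these rules the first wave of activity that reaches an inactive cell \<open>v\<close>, at distance
  \<open>d\<close> from the nearest active cell, can be computed in closed form. Away from the axes through \<open>v\<close>
  every cell has only two neighbors farther from \<open>v\<close>, so the wave never stops there. On an axis there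
  are three such neighbors; if \<open>3\<close> is not in the rule, the states along the axis at arrival alternate
  as long as the wave arrives from both sides, so that only a parity matters. Hence the number of
  neighbors of \<open>v\<close> that are active at time \<open>d - 1\<close> has a first-order description. If it does not
  activate \<open>v\<close>, then \<open>v\<close> stays inactive forever, except that under rule \<open>124\<close> with three active
  neighbors the fourth neighbor may still become active when the wave reaches it.

  The criterion is a sentence of first-order logic with addition and multiplication on positions of
  the input word. Such a sentence is evaluated by a PRAM in logarithmic time, with one processor for
  each assignment of its variables and concurrent writes for the quantifiers.\<close>

section \<open>Lockstep execution\<close>

text \<open>Permanence is the hard half: a cell missed by the first wave might become active later.
  This is excluded by deadlocks, sets of inactive cells whose outside neighbors are all active and
  whose counts lie outside the rule. If no neighbor was reached, the deadlock is \<open>v\<close>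
  with its four neighbors, each of which sees exactly three active cells; with four active neighbors
  under rule 123 it is \<open>v\<close> alone; under rule 124 with three active neighbors it can be
  \<open>v\<close> together with the missing neighbor. If that neighbor was merely out of the way of
  the wave, its own distance to the activity is \<open>d\<close> or \<open>d + 1\<close>, and the
  same criterion applies to it, so that one further level suffices. Periodicity bounds
  \<open>d\<close> by \<open>n\<close>, which makes the search for the nearest active cell a bounded
  quantifier. Products serve to address position \<open>i * n + j\<close> and to recover
  \<open>n\<close> from the length \<open>2 * n * n\<close>. Since the machine can neither multiply
  nor divide in one step, the range of the variables is a power of two: splitting a processor number
  into an assignment then takes only shifts and subtractions.\<close>

type_synonym code = "nat \<Rightarrow> program"
type_synonym vstate = "(nat \<Rightarrow> nat \<Rightarrow> nat) \<times> memory"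

text \<open>A piece of code depends on the position at which it is placed, since jumps are absolute.
  All processors enter it at the same time and leave it at the same time \<open>t\<close> steps later.\<close>

definition at_pc :: "nat \<Rightarrow> nat \<Rightarrow> vstate \<Rightarrow> pram \<Rightarrow> bool" where
  "at_pc p l S X \<longleftrightarrow> (\<forall>i<p. fst X i = (l, fst S i)) \<and> snd X = snd S"

text \<open>Quantifying over all surrounding code \<open>pre\<close> and \<open>post\<close> makes
  the statement independent of the final program, so that runs of pieces compose.\<close>

definition runs :: "nat \<Rightarrow> code \<Rightarrow> vstate \<Rightarrow> nat \<Rightarrow> vstate \<Rightarrow> bool" where
  "runs p c S t S' \<longleftrightarrow> (\<forall>pre post X. at_pc p (length pre) S X \<longrightarrow>
     at_pc p (length pre + length (c (length pre))) S'
       ((pram_step (pre @ c (length pre) @ post) p ^^ t) X))"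

definition seq :: "code \<Rightarrow> code \<Rightarrow> code" (infixr ";;" 60) where
  "(c ;; d) l = c l @ d (l + length (c l))"

lemma runs_seq:
  assumes "runs p c S t S'" "runs p d S' t' S''"
  shows "runs p (c ;; d) S (t + t') S''"
  unfolding runs_def
proof (intro allI impI)
  fix pre post :: program and X
  let ?l = "length pre"
  let ?d = "d (?l + length (c ?l))"
  assume X: "at_pc p ?l S X"
  let ?prog = "pre @ c ?l @ ?d @ post"
  have "at_pc p (?l + length (c ?l)) S' ((pram_step ?prog p ^^ t) X)"
    using assms(1) X unfolding runs_def by (metis append.assoc)
  then have "at_pc p (length (pre @ c ?l)) S' ((pram_step ((pre @ c ?l) @ ?d @ post) p ^^ t) X)"
    by simp
  then have "at_pc p (length (pre @ c ?l) + length (d (length (pre @ c ?l)))) S''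
      ((pram_step ((pre @ c ?l) @ d (length (pre @ c ?l)) @ post) p ^^ t')
        ((pram_step ((pre @ c ?l) @ ?d @ post) p ^^ t) X))"
    using assms(2) unfolding runs_def by blast
  then show "at_pc p (?l + length ((c ;; d) ?l)) S''
      ((pram_step (pre @ (c ;; d) ?l @ post) p ^^ (t + t')) X)"
    by (simp add: seq_def add.commute[of t] funpow_add add.assoc)
qed

fun is_jump :: "instr \<Rightarrow> bool" where
  "is_jump (JumpZero r l) = True"
| "is_jump _ = False"

text \<open>The guard \<open>g\<close> marks the processors that execute \<open>ins\<close> in this
  step; in a conditional the others are at a jump and issue no write.\<close>

definition mem_upd :: "nat \<Rightarrow> (nat \<Rightarrow> bool) \<Rightarrow> instr \<Rightarrow> vstate \<Rightarrow> memory" where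
  "mem_upd p g ins S = (\<lambda>a.
     let W = {i. i < p \<and> g i \<and> (\<exists>v. write_request ins (fst S i) = Some (a, v))}
     in if W = {} then snd S a else snd (the (write_request ins (fst S (Min W)))))"

definition vexec :: "nat \<Rightarrow> (nat \<Rightarrow> bool) \<Rightarrow> instr \<Rightarrow> vstate \<Rightarrow> vstate" where
  "vexec p g ins S =
     (\<lambda>i. if g i then snd (exec ins (snd S) (0, fst S i)) else fst S i, mem_upd p g ins S)"

lemma exec_no_jump:
  "\<not> is_jump ins \<Longrightarrow> exec ins M (l, R) = (l + 1, snd (exec ins M (0, R)))"
  by (cases ins) auto

lemma mem_step_eq:
  assumes "\<And>i. i < p \<Longrightarrow> proc_write prog (Q i) = (if g i then write_request ins (fst S i) else None)"
  shows "mem_step prog p Q (snd S) = mem_upd p g ins S"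
proof
  fix a
  let ?W = "{i. i < p \<and> (\<exists>v. proc_write prog (Q i) = Some (a, v))}"
  let ?W' = "{i. i < p \<and> g i \<and> (\<exists>v. write_request ins (fst S i) = Some (a, v))}"
  have W: "?W = ?W'" using assms by (auto split: if_splits)
  have "proc_write prog (Q (Min ?W')) = write_request ins (fst S (Min ?W'))" if "?W' \<noteq> {}"
  proof -
    have "finite ?W'" by simp
    then have "Min ?W' \<in> ?W'" using that by (rule Min_in)
    then show ?thesis using assms[of "Min ?W'"] by auto
  qed
  then show "mem_step prog p Q (snd S) a = mem_upd p g ins S a"
    unfolding mem_step_def mem_upd_def Let_def W by (cases "?W' = {}") (simp_all only: if_True if_False simp_thms)
qed

lemma mem_step_none:
  assumes "\<And>i. i < p \<Longrightarrow> proc_write prog (Q i) = None"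
  shows "mem_step prog p Q M = M"
  using assms by (auto simp: mem_step_def Let_def)

lemma proc_at:
  assumes "l < length prog"
  shows "proc_step prog M (l, R) = exec (prog ! l) M (l, R)"
    and "proc_write prog (l, R) = write_request (prog ! l) R"
  using assms by (auto simp: proc_step_def proc_write_def proc_halted_def)

lemma snd_pram_step: "snd (pram_step prog p X) = mem_step prog p (fst X) (snd X)"
  by (simp add: pram_step_def split: prod.splits)

lemma pram_step_at:
  assumes "\<And>i. i < p \<Longrightarrow> fst X i = (pc i, R i) \<and> pc i < length prog"
  shows "i < p \<Longrightarrow> fst (pram_step prog p X) i = exec (prog ! pc i) (snd X) (pc i, R i)"
    and "i < p \<Longrightarrow> proc_write prog (fst X i) = write_request (prog ! pc i) (R i)"
  using assms by (auto simp: pram_step_def proc_at split: prod.splits)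

lemma pram_step_mem:
  assumes "\<And>i. i < p \<Longrightarrow> fst X i = (pc i, R i) \<and> pc i < length prog"
    and "\<And>i. i < p \<Longrightarrow>
      write_request (prog ! pc i) (R i) = (if g i then write_request ins (fst S i) else None)"
    and "snd X = snd S"
  shows "snd (pram_step prog p X) = mem_upd p g ins S"
  unfolding snd_pram_step assms(3)
  by (rule mem_step_eq) (use assms(1,2) in \<open>auto simp: proc_at\<close>)

lemma pram_step_mem_same:
  assumes "\<And>i. i < p \<Longrightarrow> fst X i = (pc i, R i) \<and> pc i < length prog"
    and "\<And>i. i < p \<Longrightarrow> write_request (prog ! pc i) (R i) = None"
  shows "snd (pram_step prog p X) = snd X"
  unfolding snd_pram_step
  by (rule mem_step_none) (use assms in \<open>auto simp: proc_at\<close>)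

definition op :: "instr \<Rightarrow> code" where
  "op ins = (\<lambda>_. [ins])"

lemma runs_op:
  assumes "\<not> is_jump ins"
  shows "runs p (op ins) S 1 (vexec p (\<lambda>_. True) ins S)"
  unfolding runs_def
proof (intro allI impI)
  fix pre post :: program and X
  assume X: "at_pc p (length pre) S X"
  let ?prog = "pre @ op ins (length pre) @ post"
  have nth: "?prog ! length pre = ins" and len: "length pre < length ?prog"
    by (simp_all add: op_def nth_append)
  have Xi: "fst X i = (length pre, fst S i) \<and> length pre < length ?prog" if "i < p" for i
    using X that len by (auto simp: at_pc_def)
  have M: "snd X = snd S" using X by (simp add: at_pc_def)
  have 1: "fst (pram_step ?prog p X) i = (length pre + 1, fst (vexec p (\<lambda>_. True) ins S) i)" if "i < p" for i
    using pram_step_at(1)[where X=X and prog="?prog" and pc="\<lambda>_. length pre", OF Xi that]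
      exec_no_jump[OF assms, of _ "length pre"]
    by (simp add: nth vexec_def M)
  have 2: "snd (pram_step ?prog p X) = snd (vexec p (\<lambda>_. True) ins S)"
    unfolding vexec_def snd_conv
    by (rule pram_step_mem[where pc="\<lambda>_. length pre" and R="fst S"]) (use Xi nth M in auto)
  show "at_pc p (length pre + length (op ins (length pre))) (vexec p (\<lambda>_. True) ins S)
          ((pram_step ?prog p ^^ 1) X)"
    using 1 2 by (simp add: at_pc_def op_def)
qed

text \<open>The two branches are balanced by jumps to the next position.\<close>

definition cond :: "nat \<Rightarrow> instr \<Rightarrow> code" where
  "cond f ins = (\<lambda>l. [JumpZero f (l + 3), ins, JumpZero 2 (l + 5), JumpZero 2 (l + 4), JumpZero 2 (l + 5)])"

text \<open>\<open>JumpZero 2\<close> is an unconditional jump as long as register \<open>2\<close>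
  is \<open>0\<close>. The second assumption on that register prevents \<open>ins\<close> from
  destroying it.\<close>

lemma runs_cond:
  assumes "\<not> is_jump ins" and Z: "\<And>i. i < p \<Longrightarrow> fst S i 2 = 0"
    and Z': "\<And>i. i < p \<Longrightarrow> snd (exec ins (snd S) (0, fst S i)) 2 = 0"
  shows "runs p (cond f ins) S 3 (vexec p (\<lambda>i. fst S i f \<noteq> 0) ins S)"
  unfolding runs_def
proof (intro allI impI)
  fix pre post :: program and X
  assume X: "at_pc p (length pre) S X"
  let ?l = "length pre" and ?g = "\<lambda>i. fst S i f \<noteq> 0"
  let ?prog = "pre @ cond f ins ?l @ post"
  let ?S' = "vexec p ?g ins S"
  have nth: "?prog ! ?l = JumpZero f (?l + 3)" "?prog ! (?l + 1) = ins"
    "?prog ! (?l + 2) = JumpZero 2 (?l + 5)" "?prog ! (?l + 3) = JumpZero 2 (?l + 4)"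
    "?prog ! (?l + 4) = JumpZero 2 (?l + 5)"
    by (simp_all add: cond_def nth_append)
  have len: "?l + 4 < length ?prog"
    by (simp add: cond_def)
  let ?X1 = "pram_step ?prog p X"
  let ?X2 = "pram_step ?prog p ?X1"
  let ?X3 = "pram_step ?prog p ?X2"
  \<comment> \<open>The two paths are \<open>l\<close>, \<open>l + 1\<close>, \<open>l + 2\<close>
    and \<open>l\<close>, \<open>l + 3\<close>, \<open>l + 4\<close>; both arrive at
    \<open>l + 5\<close> after three steps, and only the middle step of the first can change
    registers or memory.\<close>
  let ?pc1 = "\<lambda>i. if ?g i then ?l + 1 else ?l + 3"
  let ?pc2 = "\<lambda>i. if ?g i then ?l + 2 else ?l + 4"
  have Xi: "fst X i = (?l, fst S i) \<and> ?l < length ?prog" if "i < p" for i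
    using X that len by (auto simp: at_pc_def)
  have M: "snd X = snd S" using X by (simp add: at_pc_def)
  have X1: "fst ?X1 i = (?pc1 i, fst S i) \<and> ?pc1 i < length ?prog" if "i < p" for i
    using pram_step_at(1)[where X=X and prog="?prog" and pc="\<lambda>_. ?l", OF Xi that] len
    unfolding nth by auto
  have M1: "snd ?X1 = snd S"
    using pram_step_mem_same[where X=X and prog="?prog" and pc="\<lambda>_. ?l", OF Xi] by (simp add: nth M)
  have X2: "fst ?X2 i = (?pc2 i, fst ?S' i) \<and> ?pc2 i < length ?prog" if "i < p" for i
    using pram_step_at(1)[where X="?X1" and prog="?prog" and pc="?pc1", OF X1 that] len nth
      exec_no_jump[OF assms(1), of _ "?l + 1"] Z[OF that]
    unfolding M1 by (auto simp: vexec_def)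
  have M2: "snd ?X2 = snd ?S'"
    unfolding vexec_def snd_conv
    by (rule pram_step_mem[where pc="?pc1" and R="fst S", OF X1]) (use nth M1 in auto)
  have Z2: "fst ?S' i 2 = 0" if "i < p" for i
    using Z Z' that by (auto simp: vexec_def)
  have X3: "fst ?X3 i = (?l + 5, fst ?S' i)" if "i < p" for i
    using pram_step_at(1)[where X="?X2" and prog="?prog" and pc="?pc2", OF X2 that] nth Z2[OF that]
    by (cases "?g i") auto
  have M3: "snd ?X3 = snd ?S'"
    unfolding M2[symmetric]
    by (rule pram_step_mem_same[where pc="?pc2" and R="fst ?S'", OF X2]) (use nth in auto)
  show "at_pc p (?l + length (cond f ins ?l)) ?S' ((pram_step ?prog p ^^ 3) X)"
    using X3 M3 by (simp add: at_pc_def cond_def numeral_3_eq_3)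
qed

definition loop :: "nat \<Rightarrow> code \<Rightarrow> code" where
  "loop r c = (\<lambda>l. JumpZero r (l + 2 + length (c (l + 1))) # c (l + 1) @ [JumpZero 2 l])"

lemma jump_step:
  assumes X: "at_pc p l S X" and l: "l < length prog" "prog ! l = JumpZero r l'"
    and u: "\<And>i. i < p \<Longrightarrow> (fst S i r = 0) = b"
  shows "at_pc p (if b then l' else l + 1) S (pram_step prog p X)"
proof -
  have Xi: "fst X i = (l, fst S i) \<and> l < length prog" if "i < p" for i
    using X that l by (simp add: at_pc_def)
  have M: "snd X = snd S" using X by (simp add: at_pc_def)
  have "fst (pram_step prog p X) i = (if b then l' else l + 1, fst S i)" if "i < p" for i
    using pram_step_at(1)[where X=X and prog=prog and pc="\<lambda>_. l", OF Xi that] u[OF that]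
    by (simp add: l M)
  moreover have "snd (pram_step prog p X) = snd S"
    using pram_step_mem_same[where X=X and prog=prog and pc="\<lambda>_. l", OF Xi] by (simp add: l M)
  ultimately show ?thesis by (simp add: at_pc_def)
qed

text \<open>Lockstep survives because the exit test has the same outcome on all processors: register
  \<open>r\<close> vanishes exactly after \<open>n\<close> rounds. A round costs two jumps besides
  its body, and the last test one more step.\<close>

lemma runs_loop:
  assumes step: "\<And>k S. k < n \<Longrightarrow> I k S \<Longrightarrow> \<exists>S'. runs p c S t S' \<and> I (Suc k) S'"
    and test: "\<And>k S i. k \<le> n \<Longrightarrow> I k S \<Longrightarrow> i < p \<Longrightarrow> fst S i 2 = 0 \<and> (fst S i r = 0 \<longleftrightarrow> k = n)"
    and "I 0 S"
  shows "\<exists>S'. runs p (loop r c) S (n * (t + 2) + 1) S' \<and> I n S'"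
proof -
  \<comment> \<open>The induction is on the number \<open>j\<close> of rounds that remain, since one
    round is peeled off at the front.\<close>
  have "\<exists>S'. runs p (loop r c) S (j * (t + 2) + 1) S' \<and> I n S'" if "j \<le> n" "I (n - j) S" for j S
    using that
  proof (induction j arbitrary: S)
    case 0
    have "runs p (loop r c) S 1 S"
      unfolding runs_def
    proof (intro allI impI)
      fix pre post :: program and X
      assume X: "at_pc p (length pre) S X"
      show "at_pc p (length pre + length (loop r c (length pre))) S
             ((pram_step (pre @ loop r c (length pre) @ post) p ^^ 1) X)"
        using jump_step[OF X, of "pre @ loop r c (length pre) @ post" r "length pre + length (loop r c (length pre))" True] test[OF _ 0(2)]
        by (simp add: loop_def nth_append)
    qed
    then show ?case using 0 by (metis add_0 diff_zero mult_0)
  next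
    case (Suc j)
    from Suc.prems have k: "n - Suc j < n" "Suc (n - Suc j) = n - j" by auto
    from step[OF k(1) Suc.prems(2)] k(2) obtain S1 where S1: "runs p c S t S1" "I (n - j) S1"
      by auto
    from Suc.IH[OF _ S1(2)] Suc.prems obtain S' where S': "runs p (loop r c) S1 (j * (t + 2) + 1) S'" "I n S'"
      by auto
    have "runs p (loop r c) S (Suc j * (t + 2) + 1) S'"
      unfolding runs_def
    proof (intro allI impI)
      fix pre post :: program and X
      assume X: "at_pc p (length pre) S X"
      let ?l = "length pre"
      let ?prog = "pre @ loop r c ?l @ post"
      let ?f = "pram_step ?prog p"
      have n0: "?prog ! ?l = JumpZero r (?l + 2 + length (c (?l + 1)))" and n0': "?l < length ?prog"
        by (simp_all add: loop_def nth_append)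
      have a1: "at_pc p (?l + 1) S (?f X)"
        using jump_step[OF X n0' n0, of False] test[OF _ Suc.prems(2)] k(1) by simp
      let ?pre = "pre @ [JumpZero r (?l + 2 + length (c (?l + 1)))]"
      have prog: "?prog = ?pre @ c (length ?pre) @ ([JumpZero 2 ?l] @ post)"
        by (simp add: loop_def)
      have "at_pc p (length ?pre) S (?f X)"
        using a1 by simp
      then have "at_pc p (length ?pre + length (c (length ?pre))) S1
          ((pram_step (?pre @ c (length ?pre) @ ([JumpZero 2 ?l] @ post)) p ^^ t) (?f X))"
        using S1(1) unfolding runs_def by blast
      then have a2: "at_pc p (?l + 1 + length (c (?l + 1))) S1 ((?f ^^ t) (?f X))"
        unfolding prog[symmetric] by simp
      have n3: "?l + 1 + length (c (?l + 1)) < length ?prog"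
        "?prog ! (?l + 1 + length (c (?l + 1))) = JumpZero 2 ?l"
        by (simp_all add: loop_def nth_append)
      have a3: "at_pc p ?l S1 (?f ((?f ^^ t) (?f X)))"
        using jump_step[OF a2 n3, of True] test[OF _ S1(2)] by simp
      have "at_pc p (?l + length (loop r c ?l)) S' ((?f ^^ (j * (t + 2) + 1)) (?f ((?f ^^ t) (?f X))))"
        using S'(1) a3 unfolding runs_def by blast
      also have "(?f ^^ (j * (t + 2) + 1)) (?f ((?f ^^ t) (?f X))) =
          (?f ^^ ((j * (t + 2) + 1) + Suc t + 1)) X"
        by (simp only: funpow_add funpow.simps comp_apply One_nat_def funpow_0 id_apply)
      also have "(j * (t + 2) + 1) + Suc t + 1 = Suc j * (t + 2) + 1" by simp
      finally show "at_pc p (?l + length (loop r c ?l)) S' ((?f ^^ (Suc j * (t + 2) + 1)) X)" .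
    qed
    with S'(2) show ?case by blast
  qed
  from this[of n S] assms(3) show ?thesis by simp
qed

definition block :: "instr list \<Rightarrow> code" where
  "block is = (\<lambda>_. is)"

lemma runs_block_fold:
  assumes "\<forall>ins\<in>set is. \<not> is_jump ins"
  shows "runs p (block is) S (length is) (fold (vexec p (\<lambda>_. True)) is S)"
  using assms
proof (induction "is" arbitrary: S)
  case Nil
  then show ?case by (simp add: runs_def block_def)
next
  case (Cons ins "is")
  have "runs p (op ins ;; block is) S (1 + length is) (fold (vexec p (\<lambda>_. True)) is (vexec p (\<lambda>_. True) ins S))"
    using Cons by (intro runs_seq[OF runs_op]) auto
  moreover have "op ins ;; block is = block (ins # is)"
    by (auto simp: seq_def op_def block_def)
  ultimately show ?case by simp
qed

lemma runs_block:
  assumes "\<forall>ins\<in>set is. \<not> is_jump ins" "t = length is" "S' = fold (vexec p (\<lambda>_. True)) is S"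
  shows "runs p (block is) S t S'"
  using runs_block_fold[OF assms(1)] assms(2,3) by simp

lemma vexec_simps [simp]:
  "vexec p g (Const r k) (R, M) = (\<lambda>i. if g i then (R i)(r := k) else R i, M)"
  "vexec p g (Add r s q) (R, M) = (\<lambda>i. if g i then (R i)(r := R i s + R i q) else R i, M)"
  "vexec p g (Sub r s q) (R, M) = (\<lambda>i. if g i then (R i)(r := R i s - R i q) else R i, M)"
  "vexec p g (Half r s) (R, M) = (\<lambda>i. if g i then (R i)(r := R i s div 2) else R i, M)"
  "vexec p g (Load r s) (R, M) = (\<lambda>i. if g i then (R i)(r := M (R i s)) else R i, M)"
  by (auto simp: vexec_def mem_upd_def fun_eq_iff)

lemma vexec_Store:
  "vexec p g (Store r s) (R, M) =
     (R, \<lambda>a. let W = {i. i < p \<and> g i \<and> R i r = a} in if W = {} then M a else R (Min W) s)"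
proof -
  have "{i. i < p \<and> g i \<and> (\<exists>v. write_request (Store r s) (R i) = Some (a, v))} = {i. i < p \<and> g i \<and> R i r = a}" for a
    by auto
  then show ?thesis
    by (auto simp: vexec_def mem_upd_def fun_eq_iff Let_def)
qed

text \<open>If all writers agree on the value, the priority rule does not influence the result. Such
  writes compute a disjunction over many processors in constant time.\<close>

lemma vexec_Store_uniform:
  assumes "\<And>i. i < p \<Longrightarrow> g i \<Longrightarrow> R i s = v"
  shows "vexec p g (Store r s) (R, M) = (R, \<lambda>a. if \<exists>i<p. g i \<and> R i r = a then v else M a)"
proof -
  have "(let W = {i. i < p \<and> g i \<and> R i r = a} in if W = {} then M a else R (Min W) s) =
      (if \<exists>i<p. g i \<and> R i r = a then v else M a)" for a
  proof (cases "{i. i < p \<and> g i \<and> R i r = a} = {}")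
    case False
    have "finite {i. i < p \<and> g i \<and> R i r = a}" by simp
    from Min_in[OF this False] assms False show ?thesis by (auto simp: Let_def)
  qed auto
  then show ?thesis by (simp add: vexec_Store)
qed

text \<open>Register \<open>2\<close> is always \<open>0\<close>, and register \<open>3\<close> holds the number \<open>L\<close> of iterations. The
  registers \<open>4\<close> to \<open>9\<close> are scratch.\<close>

definition repeat :: "code \<Rightarrow> code" where
  "repeat c = block [Add 6 3 2] ;; loop 6 (c ;; block [Const 9 1, Sub 6 6 9])"

text \<open>Register \<open>6\<close> is the counter and register \<open>9\<close> holds the
  decrement \<open>1\<close>; hence \<open>J\<close> must be insensitive to both, and the body must
  preserve register \<open>6\<close>.\<close>

lemma runs_repeat:
  assumes step: "\<And>k R M. k < L \<Longrightarrow> J k (R, M) \<Longrightarrow>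
      \<exists>R' M'. runs p c (R, M) t (R', M') \<and> J (Suc k) (R', M') \<and> (\<forall>i<p. R' i 6 = R i 6)"
    and upd: "\<And>k R M f. J k (R, M) \<Longrightarrow> J k (\<lambda>i. (R i)(6 := f i), M)"
      "\<And>k R M f. J k (R, M) \<Longrightarrow> J k (\<lambda>i. (R i)(9 := f i), M)"
    and static: "\<And>k R M i. J k (R, M) \<Longrightarrow> i < p \<Longrightarrow> R i 2 = 0 \<and> R i 3 = L"
    and J0: "J 0 (R, M)"
  shows "\<exists>R' M'. runs p (repeat c) (R, M) (L * (t + 4) + 2) (R', M') \<and> J L (R', M')"
proof -
  let ?I = "\<lambda>k S. J k S \<and> (\<forall>i<p. fst S i 6 = L - k)"
  let ?R = "\<lambda>i. (R i)(6 := R i 3 + R i 2)"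
  have "\<exists>S'. runs p (loop 6 (c ;; block [Const 9 1, Sub 6 6 9])) (?R, M) (L * ((t + 2) + 2) + 1) S' \<and> ?I L S'"
  proof (rule runs_loop[where I="?I"])
    fix k S assume k: "k < L" and I: "?I k S"
    obtain R1 M1 where S: "S = (R1, M1)" by (cases S)
    from step[OF k, of R1 M1] I S obtain R2 M2 where 2: "runs p c (R1, M1) t (R2, M2)" "J (Suc k) (R2, M2)"
      "\<forall>i<p. R2 i 6 = R1 i 6" by blast
    let ?R3 = "\<lambda>i. (R2 i)(9 := 1, 6 := R2 i 6 - 1)"
    have "runs p (block [Const 9 1, Sub 6 6 9]) (R2, M2) 2 (?R3, M2)"
      by (rule runs_block) simp_all
    from runs_seq[OF 2(1) this] have "runs p (c ;; block [Const 9 1, Sub 6 6 9]) S (t + 2) (?R3, M2)"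
      by (simp add: S)
    moreover have "J (Suc k) (?R3, M2)"
      by (rule upd(1)[OF upd(2)[OF 2(2)]])
    ultimately show "\<exists>S'. runs p (c ;; block [Const 9 1, Sub 6 6 9]) S (t + 2) S' \<and> ?I (Suc k) S'"
      using 2(3) I S by (intro exI[of _ "(?R3, M2)"]) simp
  next
    fix k S i assume "k \<le> L" "?I k S" "i < p"
    then show "fst S i 2 = 0 \<and> (fst S i 6 = 0 \<longleftrightarrow> k = L)"
      using static[of k "fst S" "snd S" i] by auto
  next
    show "?I 0 (?R, M)" using upd(1)[OF J0, of "\<lambda>i. R i 3 + R i 2"] static[OF J0] by simp
  qed
  then obtain S' where S': "runs p (loop 6 (c ;; block [Const 9 1, Sub 6 6 9])) (?R, M) (L * ((t + 2) + 2) + 1) S'" "?I L S'"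
    by blast
  have time: "1 + (L * ((t + 2) + 2) + 1) = L * (t + 4) + 2"
    by (simp add: algebra_simps)
  have "runs p (block [Add 6 3 2]) (R, M) 1 (?R, M)"
    by (rule runs_block) simp_all
  from runs_seq[OF this S'(1), unfolded time] S'(2) show ?thesis
    unfolding repeat_def by (intro exI[of _ "fst S'"] exI[of _ "snd S'"]) simp
qed

section \<open>Shifts and multiplication\<close>

definition same_regs :: "nat \<Rightarrow> nat set \<Rightarrow> (nat \<Rightarrow> nat \<Rightarrow> nat) \<Rightarrow> (nat \<Rightarrow> nat \<Rightarrow> nat) \<Rightarrow> bool" where
  "same_regs p A R R' \<longleftrightarrow> (\<forall>i<p. \<forall>r. r \<notin> A \<longrightarrow> R' i r = R i r)"

lemma same_regs_refl: "same_regs p A R R"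
  by (simp add: same_regs_def)

lemma same_regs_trans:
  "same_regs p A R R' \<Longrightarrow> same_regs p A' R' R'' \<Longrightarrow> A \<subseteq> B \<Longrightarrow> A' \<subseteq> B \<Longrightarrow> same_regs p B R R''"
  unfolding same_regs_def by (metis subsetD)

abbreviation scratch :: "nat set" where "scratch \<equiv> {4..9}"

lemma runs_repeat_unary:
  assumes r: "r \<notin> scratch" "r \<noteq> 2" "r \<noteq> 3" and static: "\<And>i. i < p \<Longrightarrow> R i 2 = 0 \<and> R i 3 = L"
    and ins: "\<not> is_jump ins" "\<And>R M. vexec p (\<lambda>_. True) ins (R, M) = (\<lambda>i. (R i)(r := f (R i r)), M)"
  shows "\<exists>R'. runs p (repeat (op ins)) (R, M) (L * 5 + 2) (R', M) \<and>
    same_regs p (insert r scratch) R R' \<and> (\<forall>i<p. R' i r = (f ^^ L) (R i r))"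
proof -
  let ?J = "\<lambda>k S. snd S = M \<and> same_regs p (insert r scratch) R (fst S) \<and> (\<forall>i<p. fst S i r = (f ^^ k) (R i r))"
  have "\<exists>R' M'. runs p (repeat (op ins)) (R, M) (L * (1 + 4) + 2) (R', M') \<and> ?J L (R', M')"
  proof (rule runs_repeat[where J="?J" and L=L])
    fix k R1 M1 assume J: "?J k (R1, M1)"
    let ?R2 = "\<lambda>i. (R1 i)(r := f (R1 i r))"
    have "runs p (op ins) (R1, M1) 1 (?R2, M1)"
      using runs_op[OF ins(1), of p "(R1, M1)"] ins(2) by simp
    moreover have "?J (Suc k) (?R2, M1)" using J by (auto simp: same_regs_def)
    moreover have "\<forall>i<p. ?R2 i 6 = R1 i 6" using r by auto
    ultimately show "\<exists>R' M'. runs p (op ins) (R1, M1) 1 (R', M') \<and> ?J (Suc k) (R', M') \<and> (\<forall>i<p. R' i 6 = R1 i 6)"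
      by blast
  next
    fix k R1 M1 i assume "?J k (R1, M1)" "i < p"
    then show "R1 i 2 = 0 \<and> R1 i 3 = L" using static r by (auto simp: same_regs_def)
  qed (use r in \<open>auto simp: same_regs_def\<close>)
  then show ?thesis by auto
qed

text \<open>Doubling as often as register \<open>3\<close> says. With \<open>range_bits w\<close> in
  that register, this multiplies by \<open>dom_size w\<close>, the base in which processor numbers
  are read.\<close>

definition shift_left :: "nat \<Rightarrow> code" where
  "shift_left r = repeat (op (Add r r r))"

definition shift_right :: "nat \<Rightarrow> code" where
  "shift_right r = repeat (op (Half r r))"

lemma runs_shift_left:
  assumes "r \<notin> scratch" "r \<noteq> 2" "r \<noteq> 3" "\<And>i. i < p \<Longrightarrow> R i 2 = 0 \<and> R i 3 = L"
  shows "\<exists>R'. runs p (shift_left r) (R, M) (L * 5 + 2) (R', M) \<and>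
    same_regs p (insert r scratch) R R' \<and> (\<forall>i<p. R' i r = R i r * 2 ^ L)"
proof -
  have "((\<lambda>x. x + x) ^^ k) x = x * 2 ^ k" for x k :: nat
    by (induction k) auto
  then show ?thesis
    using runs_repeat_unary[where p=p and R=R and r=r and L=L and ins="Add r r r" and f="\<lambda>x. x + x", OF assms] by (simp add: shift_left_def)
qed

lemma runs_shift_right:
  assumes "r \<notin> scratch" "r \<noteq> 2" "r \<noteq> 3" "\<And>i. i < p \<Longrightarrow> R i 2 = 0 \<and> R i 3 = L"
  shows "\<exists>R'. runs p (shift_right r) (R, M) (L * 5 + 2) (R', M) \<and>
    same_regs p (insert r scratch) R R' \<and> (\<forall>i<p. R' i r = R i r div 2 ^ L)"
proof -
  have "((\<lambda>x. x div 2) ^^ k) x = x div 2 ^ k" for x k :: nat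
    by (induction k) (auto simp: div_mult2_eq[symmetric] mult.commute)
  then show ?thesis
    using runs_repeat_unary[where p=p and R=R and r=r and L=L and ins="Half r r" and f="\<lambda>x. x div 2", OF assms] by (simp add: shift_right_def)
qed

text \<open>Binary long multiplication: register \<open>4\<close> holds the multiplicand, doubled in
  each round, register \<open>5\<close> the remaining bits of the multiplier, and register
  \<open>8\<close> its lowest bit, which decides whether register \<open>4\<close> is added to the
  result.\<close>

definition mult :: "nat \<Rightarrow> nat \<Rightarrow> nat \<Rightarrow> code" where
  "mult s a b = block [Const s 0, Add 4 a 2, Add 5 b 2] ;;
     repeat (block [Half 7 5, Add 8 7 7, Sub 8 5 8, Add 5 7 2] ;; cond 8 (Add s s 4) ;; block [Add 4 4 4])"

text \<open>After \<open>k\<close> rounds the result is \<open>a\<close> times the \<open>k\<close>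
  lowest bits of \<open>b\<close>. The bound \<open>2 ^ L\<close> on the second factor ensures that
  \<open>L\<close> rounds use up all of its bits.\<close>

lemma runs_mult:
  assumes r: "a \<ge> 10" "b \<ge> 10" "s \<ge> 10" "s \<noteq> a" "s \<noteq> b"
    and static: "\<And>i. i < p \<Longrightarrow> R i 2 = 0 \<and> R i 3 = L \<and> R i b < 2 ^ L"
  shows "\<exists>R'. runs p (mult s a b) (R, M) (L * 12 + 5) (R', M) \<and>
    same_regs p (insert s scratch) R R' \<and> (\<forall>i<p. R' i s = R i a * R i b)"
proof -
  let ?J = "\<lambda>k S. snd S = M \<and> same_regs p (insert s scratch) R (fst S) \<and>
    (\<forall>i<p. fst S i 4 = R i a * 2 ^ k \<and> fst S i 5 = R i b div 2 ^ k \<and> fst S i s = R i a * (R i b mod 2 ^ k))"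
  let ?b1 = "[Half 7 5, Add 8 7 7, Sub 8 5 8, Add 5 7 2]"
  let ?c = "block ?b1 ;; cond 8 (Add s s 4) ;; block [Add 4 4 4]"
  let ?b0 = "[Const s 0, Add 4 a 2, Add 5 b 2]"
  let ?R0 = "fst (fold (vexec p (\<lambda>_. True)) ?b0 (R, M))"
  have 0: "runs p (block ?b0) (R, M) 3 (?R0, M)"
    by (rule runs_block) simp_all
  have "\<exists>R' M'. runs p (repeat ?c) (?R0, M) (L * (8 + 4) + 2) (R', M') \<and> ?J L (R', M')"
  proof (rule runs_repeat[where J="?J" and L=L])
    fix k R1 M1 assume J: "?J k (R1, M1)"
    define R2 where "R2 = (\<lambda>i. (R1 i)(7 := R1 i 5 div 2, 8 := R1 i 5 - (R1 i 5 div 2 + R1 i 5 div 2),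
      5 := R1 i 5 div 2 + R1 i 2))"
    have Z1: "R1 i 2 = 0" if "i < p" for i
      using J that r static[of i] by (auto simp: same_regs_def)
    have 1: "runs p (block ?b1) (R1, M1) 4 (R2, M1)"
      by (rule runs_block) (simp_all add: R2_def fun_eq_iff)
    have R2: "R2 i = (R1 i)(7 := R1 i 5 div 2, 8 := R1 i 5 mod 2, 5 := R1 i 5 div 2)" if "i < p" for i
    proof -
      have "R1 i 5 - (R1 i 5 div 2 + R1 i 5 div 2) = R1 i 5 mod 2"
        by presburger
      then show ?thesis using Z1[OF that] by (simp add: R2_def)
    qed
    define R3 where "R3 = (\<lambda>i. if R2 i 8 \<noteq> 0 then (R2 i)(s := R2 i s + R2 i 4) else R2 i)"
    have 2: "runs p (cond 8 (Add s s 4)) (R2, M1) 3 (R3, M1)"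
      using runs_cond[of "Add s s 4" p "(R2, M1)" 8] Z1 R2 r by (simp add: R3_def)
    let ?R4 = "\<lambda>i. (R3 i)(4 := R3 i 4 + R3 i 4)"
    have 3: "runs p (block [Add 4 4 4]) (R3, M1) 1 (?R4, M1)"
      by (rule runs_block) simp_all
    have "runs p ?c (R1, M1) 8 (?R4, M1)"
      using runs_seq[OF 1 runs_seq[OF 2 3]] by simp
    moreover have "same_regs p (insert s scratch) R ?R4"
      using J r R2 by (auto simp: same_regs_def R3_def)
    moreover have "?R4 i 4 = R i a * 2 ^ Suc k \<and> ?R4 i 5 = R i b div 2 ^ Suc k \<and>
        ?R4 i s = R i a * (R i b mod 2 ^ Suc k) \<and> ?R4 i 6 = R1 i 6" if "i < p" for i
    proof -
      have "R i b mod 2 ^ Suc k = 2 ^ k * (R i b div 2 ^ k mod 2) + R i b mod 2 ^ k"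
        using mod_mult2_eq[of "R i b" "2 ^ k" 2] by (simp add: mult.commute)
      moreover have "R i b div 2 ^ k mod 2 = 0 \<or> R i b div 2 ^ k mod 2 = 1" by auto
      moreover have "R1 i 4 = R i a * 2 ^ k" "R1 i 5 = R i b div 2 ^ k" "R1 i s = R i a * (R i b mod 2 ^ k)"
        using J that by auto
      moreover have "R i b div 2 ^ Suc k = R i b div 2 ^ k div 2"
        by (simp add: div_mult2_eq[symmetric] mult.commute)
      ultimately show ?thesis unfolding R3_def R2[OF that] using r by (auto simp: algebra_simps)
    qed
    ultimately show "\<exists>R' M'. runs p ?c (R1, M1) 8 (R', M') \<and> ?J (Suc k) (R', M') \<and> (\<forall>i<p. R' i 6 = R1 i 6)"
      using J r by (intro exI[of _ "?R4"] exI[of _ M1]) auto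
  next
    fix k R1 M1 i assume "?J k (R1, M1)" "i < p"
    then show "R1 i 2 = 0 \<and> R1 i 3 = L" using static r by (auto simp: same_regs_def)
  next
    show "?J 0 (?R0, M)" using r static by (auto simp: same_regs_def)
  qed (use r in \<open>auto simp: same_regs_def\<close>)
  then obtain R' where R': "runs p (repeat ?c) (?R0, M) (L * 12 + 2) (R', M)" "?J L (R', M)"
    by auto
  from runs_seq[OF 0 R'(1)] R'(2) static show ?thesis
    unfolding mult_def by (intro exI[of _ R']) (auto simp: add.commute)
qed

section \<open>First-order sentences about words\<close>

text \<open>Variables are de Bruijn indices and range over \<open>{..<2 ^ floor_log N}\<close> for words of length
  \<open>N\<close>, so that \<open>m\<close> variables need at most \<open>N ^ m + 1\<close> processors, for \<open>N = 0\<close> too.\<close>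

datatype trm = V nat | Len | Num nat | Plus trm trm | Times nat nat

datatype fm = Le trm trm | Bit trm | Neg fm | And fm fm | Ex fm

definition bit_at :: "bool list \<Rightarrow> nat \<Rightarrow> bool" where
  "bit_at w k \<longleftrightarrow> k < length w \<and> w ! k"

abbreviation range_bits :: "bool list \<Rightarrow> nat" where
  "range_bits w \<equiv> floor_log (length w)"

text \<open>This exceeds half the length of the word. For words of length \<open>2 * n * n\<close>
  with positive \<open>n\<close> it is therefore larger than \<open>n * n\<close>, so that
  \<open>n\<close>, all coordinates and all relevant distances are in range.\<close>

definition dom_size :: "bool list \<Rightarrow> nat" where
  "dom_size w = 2 ^ range_bits w"

fun tval :: "bool list \<Rightarrow> (nat \<Rightarrow> nat) \<Rightarrow> trm \<Rightarrow> nat" where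
  "tval w e (V v) = e v"
| "tval w e Len = length w"
| "tval w e (Num c) = c"
| "tval w e (Plus t u) = tval w e t + tval w e u"
| "tval w e (Times u v) = e u * e v"

fun fval :: "bool list \<Rightarrow> (nat \<Rightarrow> nat) \<Rightarrow> fm \<Rightarrow> bool" where
  "fval w e (Le t u) \<longleftrightarrow> tval w e t \<le> tval w e u"
| "fval w e (Bit t) \<longleftrightarrow> bit_at w (tval w e t)"
| "fval w e (Neg f) \<longleftrightarrow> \<not> fval w e f"
| "fval w e (And f g) \<longleftrightarrow> fval w e f \<and> fval w e g"
| "fval w e (Ex f) \<longleftrightarrow> (\<exists>x<dom_size w. fval w (case_nat x e) f)"

fun tclosed :: "nat \<Rightarrow> trm \<Rightarrow> bool" where
  "tclosed k (V v) \<longleftrightarrow> v < k"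
| "tclosed k (Plus t u) \<longleftrightarrow> tclosed k t \<and> tclosed k u"
| "tclosed k (Times u v) \<longleftrightarrow> u < k \<and> v < k"
| "tclosed k _ \<longleftrightarrow> True"

fun fclosed :: "nat \<Rightarrow> fm \<Rightarrow> bool" where
  "fclosed k (Le t u) \<longleftrightarrow> tclosed k t \<and> tclosed k u"
| "fclosed k (Bit t) \<longleftrightarrow> tclosed k t"
| "fclosed k (Neg f) \<longleftrightarrow> fclosed k f"
| "fclosed k (And f g) \<longleftrightarrow> fclosed k f \<and> fclosed k g"
| "fclosed k (Ex f) \<longleftrightarrow> fclosed (Suc k) f"

fun depth :: "fm \<Rightarrow> nat" where
  "depth (Neg f) = depth f"
| "depth (And f g) = max (depth f) (depth g)"
| "depth (Ex f) = Suc (depth f)"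
| "depth _ = 0"

section \<open>Processors as assignments\<close>

definition digit :: "nat \<Rightarrow> nat \<Rightarrow> nat \<Rightarrow> nat" where
  "digit B j i = i div B ^ j mod B"

text \<open>A name for the class of all processors that differ from \<open>i\<close> at most in
  digit \<open>j\<close>. Shifted past the input, it is the address at which such a class evaluates
  a quantifier over the variable stored in that digit.\<close>

definition zero_digit :: "nat \<Rightarrow> nat \<Rightarrow> nat \<Rightarrow> nat" where
  "zero_digit B j i = i - digit B j i * B ^ j"

lemma split_digit:
  "i = i div B ^ Suc j * B ^ Suc j + digit B j i * B ^ j + i mod B ^ j"
proof -
  have "i = i div B ^ j * B ^ j + i mod B ^ j"
    by (rule div_mult_mod_eq[symmetric])
  also have "i div B ^ j = i div B ^ j div B * B + digit B j i"
    unfolding digit_def by (rule div_mult_mod_eq[symmetric])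
  also have "i div B ^ j div B = i div B ^ Suc j"
    by (simp only: power_Suc2 div_mult2_eq)
  finally show ?thesis by (simp add: algebra_simps)
qed

lemma zero_digit_eq: "zero_digit B j i = i div B ^ Suc j * B ^ Suc j + i mod B ^ j"
  unfolding zero_digit_def using split_digit[of i B j] by linarith

lemma digit_combine:
  fixes B x lo hi j :: nat
  defines "i \<equiv> hi * B ^ Suc j + x * B ^ j + lo"
  assumes "B > 0" "x < B" "lo < B ^ j"
  shows "digit B j i = x" "zero_digit B j i = hi * B ^ Suc j + lo" "i mod B ^ j = lo" "i div B ^ Suc j = hi"
proof -
  have i: "i = (hi * B + x) * B ^ j + lo" by (simp add: i_def algebra_simps)
  have d: "i div B ^ j = hi * B + x" and m: "i mod B ^ j = lo"
    unfolding i using assms by (simp_all add: mult.commute)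
  show x: "digit B j i = x" using assms d by (simp add: digit_def)
  show "i mod B ^ j = lo" by fact
  show hi: "i div B ^ Suc j = hi"
    using assms(2,3) by (simp only: power_Suc2 div_mult2_eq d) simp
  show "zero_digit B j i = hi * B ^ Suc j + lo"
    unfolding zero_digit_eq by (simp only: hi m)
qed

lemma digit_cong:
  assumes "i mod B ^ k = i' mod B ^ k" "j < k"
  shows "digit B j i = digit B j i'"
proof -
  have *: "digit B j i = i mod B ^ Suc j div B ^ j" for i
  proof (cases "B = 0")
    case False
    then show ?thesis using mod_mult2_eq[of i "B ^ j" B] by (simp add: digit_def mult.commute)
  qed (use assms in \<open>cases j; simp add: digit_def\<close>)
  have "B ^ Suc j dvd B ^ k" using assms(2) by (intro le_imp_power_dvd) auto
  then have "i mod B ^ Suc j = i' mod B ^ Suc j"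
    using assms(1) by (metis mod_mod_cancel)
  then show ?thesis by (simp add: *)
qed

text \<open>Supplies the processor that carries a given witness of an existential
  quantifier.\<close>

lemma set_digit:
  assumes i: "i < B ^ m" and j: "j < m" and x: "x < B"
  shows "\<exists>i'<B ^ m. digit B j i' = x \<and> zero_digit B j i' = zero_digit B j i \<and>
    (\<forall>k<j. digit B k i' = digit B k i)"
proof -
  let ?hi = "i div B ^ Suc j" and ?lo = "i mod B ^ j"
  let ?i = "?hi * B ^ Suc j + x * B ^ j + ?lo"
  have B: "B > 0" using x by simp
  have lo: "?lo < B ^ j" using B by simp
  note c = digit_combine[OF B x lo, of ?hi]
  have Bm: "B ^ m = B ^ (m - Suc j) * B ^ Suc j"
    by (metis j Suc_leI le_add_diff_inverse2 power_add)
  have "?hi < B ^ (m - Suc j)"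
    using i unfolding Bm by (rule less_mult_imp_div_less)
  then have "Suc ?hi * B ^ Suc j \<le> B ^ m"
    unfolding Bm by (intro mult_le_mono1) simp
  moreover have "Suc x * B ^ j \<le> B * B ^ j"
    using x by (intro mult_le_mono1) simp
  ultimately have "?i < B ^ m"
    using lo by simp
  moreover have "digit B k ?i = digit B k i" if "k < j" for k
    by (rule digit_cong[OF _ that]) (use c in simp)
  ultimately show ?thesis
    using c(1,2) by (intro exI[of _ ?i] conjI allI impI) (simp_all only: zero_digit_eq[of B j i])
qed

text \<open>Converse direction for quantifiers: whoever writes to the address read by
  \<open>i\<close> carries the same outer variables. It is also below \<open>B ^ m\<close> itself,
  so that surplus processors cannot interfere with the proper ones.\<close>

lemma zero_digit_eqD:
  assumes "zero_digit B j i = zero_digit B j i'" "i < B ^ m" "j < m" "B > 0"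
  shows "i' < B ^ m" "k < j \<Longrightarrow> digit B k i' = digit B k i" "digit B j i' < B"
proof -
  have z: "zero_digit B j i div B ^ Suc j = i div B ^ Suc j" "zero_digit B j i mod B ^ j = i mod B ^ j" for i
  proof -
    have lo: "i mod B ^ j < B ^ j" using assms(4) by simp
    note c = digit_combine[OF assms(4) assms(4) lo, of "i div B ^ Suc j"]
    show "zero_digit B j i div B ^ Suc j = i div B ^ Suc j" "zero_digit B j i mod B ^ j = i mod B ^ j"
      using c unfolding zero_digit_eq by simp_all
  qed
  show x: "digit B j i' < B" using assms(4) by (simp add: digit_def)
  have hi: "i' div B ^ Suc j = i div B ^ Suc j" and lo: "i' mod B ^ j = i mod B ^ j"
    using z[of i] z[of i'] assms(1) by auto
  show "k < j \<Longrightarrow> digit B k i' = digit B k i"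
    by (rule digit_cong[OF lo])
  \<comment> \<open>Putting digit \<open>j\<close> of \<open>i'\<close> into \<open>i\<close> gives
    a number below \<open>B ^ m\<close>; as it agrees with \<open>i'\<close> in that digit and in
    the rest, it equals \<open>i'\<close>.\<close>
  obtain i'' where i'': "i'' < B ^ m" "digit B j i'' = digit B j i'" "zero_digit B j i'' = zero_digit B j i"
    using set_digit[OF assms(2,3) x] by auto
  have "i' = zero_digit B j i' + digit B j i' * B ^ j" "i'' = zero_digit B j i'' + digit B j i'' * B ^ j"
    using split_digit[of i' B j] split_digit[of i'' B j] unfolding zero_digit_eq by simp_all
  then show "i' < B ^ m" using i'' assms(1) by simp
qed

text \<open>Digits are numbered by binding depth, from the outermost quantifier inwards. Entering a
  quantifier then changes the index of an outer variable but not the digit that stores it.\<close>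

definition env :: "nat \<Rightarrow> nat \<Rightarrow> nat \<Rightarrow> nat \<Rightarrow> nat" where
  "env B k i = (\<lambda>v. if v < k then digit B (k - 1 - v) i else 0)"

lemma env_Suc:
  assumes "\<forall>j<k. digit B j i' = digit B j i"
  shows "env B (Suc k) i' = case_nat (digit B k i') (env B k i)"
  using assms by (auto simp: env_def fun_eq_iff split: nat.splits)

section \<open>Compilation of formulas\<close>

text \<open>Registers from \<open>s\<close> on serve as a stack: the value is left in
  \<open>s\<close>, and a second operand is evaluated into \<open>Suc s\<close>. The registers
  \<open>10 + 2 * j\<close> hold the digits of the processor number.\<close>

fun tcomp :: "nat \<Rightarrow> nat \<Rightarrow> trm \<Rightarrow> code" where
  "tcomp k s (V v) = block [Add s (10 + 2 * (k - 1 - v)) 2]"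
| "tcomp k s Len = block [Add s 1 2]"
| "tcomp k s (Num c) = block [Const s c]"
| "tcomp k s (Plus t u) = tcomp k s t ;; tcomp k (Suc s) u ;; block [Add s s (Suc s)]"
| "tcomp k s (Times u v) = mult s (10 + 2 * (k - 1 - u)) (10 + 2 * (k - 1 - v))"

fun ttime :: "nat \<Rightarrow> trm \<Rightarrow> nat" where
  "ttime L (Plus t u) = ttime L t + (ttime L u + 1)"
| "ttime L (Times u v) = L * 12 + 5"
| "ttime L _ = 1"

text \<open>In the case of \<open>Bit\<close>, the loaded value is meaningless if the address is out of range.\<close>

fun fcomp :: "nat \<Rightarrow> nat \<Rightarrow> fm \<Rightarrow> code" where
  "fcomp k s (Le t u) = tcomp k s t ;; tcomp k (Suc s) u ;;
     block [Sub s s (Suc s), Const 4 1, Sub s 4 s]"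
| "fcomp k s (Bit t) = tcomp k s t ;;
     block [Load 4 s, Const 5 1, Sub s 1 s, Sub s 5 s, Sub s 5 s, Sub 4 5 4, Sub s s 4]"
| "fcomp k s (Neg f) = fcomp k s f ;; block [Const 4 1, Sub s 4 s]"
| "fcomp k s (And f g) = fcomp k s f ;; fcomp k (Suc s) g ;;
     block [Const 4 1, Sub (Suc s) 4 (Suc s), Sub s s (Suc s)]"
| "fcomp k s (Ex f) = fcomp (Suc k) s f ;; block [Const 4 1] ;; op (Store (11 + 2 * k) 2) ;;
     cond s (Store (11 + 2 * k) 4) ;; block [Load s (11 + 2 * k)]"

fun ftime :: "nat \<Rightarrow> fm \<Rightarrow> nat" where
  "ftime L (Le t u) = ttime L t + (ttime L u + 3)"
| "ftime L (Bit t) = ttime L t + 7"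
| "ftime L (Neg f) = ftime L f + 2"
| "ftime L (And f g) = ftime L f + (ftime L g + 3)"
| "ftime L (Ex f) = ftime L f + (1 + (1 + (3 + 1)))"

text \<open>The addresses for quantifiers start at \<open>length w\<close>, so that the input stays
  intact during the evaluation.\<close>

definition layout :: "nat \<Rightarrow> nat \<Rightarrow> bool list \<Rightarrow> vstate \<Rightarrow> bool" where
  "layout p m w S \<longleftrightarrow>
     (\<forall>i<p. fst S i 1 = length w \<and> fst S i 2 = 0 \<and> fst S i 3 = range_bits w \<and>
       (\<forall>j<m. fst S i (10 + 2 * j) = digit (dom_size w) j i \<and>
              fst S i (11 + 2 * j) = length w + zero_digit (dom_size w) j i)) \<and>
     (\<forall>a<length w. snd S a = of_bool (w ! a))"

definition keeps :: "nat \<Rightarrow> nat \<Rightarrow> (nat \<Rightarrow> nat \<Rightarrow> nat) \<Rightarrow> (nat \<Rightarrow> nat \<Rightarrow> nat) \<Rightarrow> bool" where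
  "keeps p s R R' \<longleftrightarrow> (\<forall>i<p. \<forall>r<s. r \<notin> scratch \<longrightarrow> R' i r = R i r)"

lemma keeps_trans: "keeps p s R R' \<Longrightarrow> keeps p s' R' R'' \<Longrightarrow> s \<le> s' \<Longrightarrow> keeps p s R R''"
  unfolding keeps_def by (metis order.strict_trans2)

lemma layout_keeps:
  assumes "layout p m w (R, M)" "keeps p s R R'" "10 + 2 * m \<le> s" "\<forall>a<length w. M' a = M a"
  shows "layout p m w (R', M')"
proof -
  have "R' i r = R i r" if "i < p" "r < 4 \<or> r \<ge> 10 \<and> r < 10 + 2 * m" for i r
    using assms(2,3) that by (auto simp: keeps_def)
  then show ?thesis using assms(1,4) by (auto simp: layout_def)
qed

lemma runs_tcomp:
  assumes "layout p m w (R, M)" "tclosed k t" "k \<le> m" "10 + 2 * m \<le> s"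
  shows "\<exists>R'. runs p (tcomp k s t) (R, M) (ttime (range_bits w) t) (R', M) \<and> keeps p s R R' \<and>
    (\<forall>i<p. R' i s = tval w (env (dom_size w) k i) t)"
  using assms
proof (induction t arbitrary: s R)
  case (V v)
  have "runs p (tcomp k s (V v)) (R, M) 1 (\<lambda>i. (R i)(s := R i (10 + 2 * (k - 1 - v)) + R i 2), M)"
    unfolding tcomp.simps by (rule runs_block) simp_all
  moreover have "k - 1 - v < m" using V by auto
  ultimately show ?case using V.prems
    by (intro exI conjI) (auto simp: keeps_def env_def layout_def)
next
  case Len
  have "runs p (tcomp k s Len) (R, M) 1 (\<lambda>i. (R i)(s := R i 1 + R i 2), M)"
    unfolding tcomp.simps by (rule runs_block) simp_all
  then show ?case using Len.prems
    by (intro exI conjI) (auto simp: keeps_def layout_def)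
next
  case (Num c)
  have "runs p (tcomp k s (Num c)) (R, M) 1 (\<lambda>i. (R i)(s := c), M)"
    unfolding tcomp.simps by (rule runs_block) simp_all
  then show ?case using Num.prems
    by (intro exI conjI) (auto simp: keeps_def layout_def)
next
  case (Plus t u)
  from Plus.IH(1)[OF Plus.prems(1) _ Plus.prems(3,4)] Plus.prems(2) obtain R1 where
    1: "runs p (tcomp k s t) (R, M) (ttime (range_bits w) t) (R1, M)" "keeps p s R R1"
      "\<forall>i<p. R1 i s = tval w (env (dom_size w) k i) t" by auto
  have layout1: "layout p m w (R1, M)" using layout_keeps[OF Plus.prems(1) 1(2) Plus.prems(4)] by simp
  from Plus.IH(2)[OF layout1 _ Plus.prems(3), of "Suc s"] Plus.prems obtain R2 where
    2: "runs p (tcomp k (Suc s) u) (R1, M) (ttime (range_bits w) u) (R2, M)" "keeps p (Suc s) R1 R2"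
      "\<forall>i<p. R2 i (Suc s) = tval w (env (dom_size w) k i) u" by auto
  define R3 where "R3 = (\<lambda>i. (R2 i)(s := R2 i s + R2 i (Suc s)))"
  have 3: "runs p (block [Add s s (Suc s)]) (R2, M) 1 (R3, M)"
    by (rule runs_block) (simp_all add: R3_def)
  have "R2 i s = R1 i s" if "i < p" for i
    using 2(2) that Plus.prems by (auto simp: keeps_def)
  then have "\<forall>i<p. R3 i s = tval w (env (dom_size w) k i) (Plus t u)"
    using 1(3) 2(3) by (auto simp: R3_def)
  moreover have "keeps p s R R3"
    using keeps_trans[OF 1(2) 2(2)] by (auto simp: keeps_def R3_def)
  ultimately show ?case
    using runs_seq[OF 1(1) runs_seq[OF 2(1) 3]] by (intro exI[of _ R3]) auto
next
  case (Times u v)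
  let ?a = "10 + 2 * (k - 1 - u)" and ?b = "10 + 2 * (k - 1 - v)"
  have uv: "k - 1 - u < m" "k - 1 - v < m" "u < k" "v < k" using Times.prems by auto
  \<comment> \<open>A digit is then below \<open>dom_size w\<close>, that is, below two to the power
    \<open>range_bits w\<close>, as \<open>runs_mult\<close> requires. This is why
    \<open>Times\<close> takes variables and not arbitrary terms.\<close>
  have d: "dom_size w > 0" by (simp add: dom_size_def)
  obtain R' where "runs p (mult s ?a ?b) (R, M) (range_bits w * 12 + 5) (R', M)"
    "same_regs p (insert s scratch) R R'" "\<forall>i<p. R' i s = R i ?a * R i ?b"
    using runs_mult[of ?a ?b s p R "range_bits w" M] Times.prems uv d
    by (auto simp: layout_def digit_def dom_size_def)
  then show ?case using Times.prems uv
    by (intro exI[of _ R'] conjI) (auto simp: keeps_def same_regs_def env_def layout_def)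
qed

text \<open>The processors below \<open>dom_size w ^ m\<close> contain every assignment of
  \<open>m\<close> variables. Those beyond may form an incomplete block that lacks witnesses, so
  nothing is claimed about their results.\<close>

lemma runs_fcomp:
  assumes "layout p m w (R, M)" "fclosed k f" "k + depth f \<le> m" "10 + 2 * m \<le> s" "dom_size w ^ m \<le> p"
  shows "\<exists>R' M'. runs p (fcomp k s f) (R, M) (ftime (range_bits w) f) (R', M') \<and> keeps p s R R' \<and>
    layout p m w (R', M') \<and> (\<forall>i<dom_size w ^ m. R' i s = of_bool (fval w (env (dom_size w) k i) f))"
  using assms
proof (induction f arbitrary: s k R M)
  case (Le t u)
  have k: "k \<le> m" using Le.prems by simp
  from runs_tcomp[OF Le.prems(1) _ k Le.prems(4), of t] Le.prems(2) obtain R1 where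
    1: "runs p (tcomp k s t) (R, M) (ttime (range_bits w) t) (R1, M)" "keeps p s R R1"
      "\<forall>i<p. R1 i s = tval w (env (dom_size w) k i) t" by auto
  have layout1: "layout p m w (R1, M)" using layout_keeps[OF Le.prems(1) 1(2) Le.prems(4)] by simp
  from runs_tcomp[OF layout1 _ k, of u "Suc s"] Le.prems obtain R2 where
    2: "runs p (tcomp k (Suc s) u) (R1, M) (ttime (range_bits w) u) (R2, M)" "keeps p (Suc s) R1 R2"
      "\<forall>i<p. R2 i (Suc s) = tval w (env (dom_size w) k i) u" by auto
  define R3 where "R3 = (\<lambda>i. (R2 i)(4 := 1, s := 1 - (R2 i s - R2 i (Suc s))))"
  have 3: "runs p (block [Sub s s (Suc s), Const 4 1, Sub s 4 s]) (R2, M) 3 (R3, M)"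
    by (rule runs_block) (use Le.prems in \<open>auto simp: fun_eq_iff R3_def\<close>)
  have s: "R2 i s = R1 i s" if "i < p" for i
    using 2(2) that Le.prems by (auto simp: keeps_def)
  have K: "keeps p s R R3"
    using keeps_trans[OF 1(2) 2(2)] by (auto simp: keeps_def R3_def)
  have "\<forall>i<p. R3 i s = of_bool (fval w (env (dom_size w) k i) (Le t u))"
    using 1(3) 2(3) s by (auto simp: R3_def)
  then show ?case
    using runs_seq[OF 1(1) runs_seq[OF 2(1) 3]] K layout_keeps[OF Le.prems(1) K Le.prems(4), of M] Le.prems(5)
    by (intro exI[of _ R3] exI[of _ M]) auto
next
  case (Bit t)
  have k: "k \<le> m" using Bit.prems by simp
  from runs_tcomp[OF Bit.prems(1) _ k Bit.prems(4), of t] Bit.prems(2) obtain R1 where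
    1: "runs p (tcomp k s t) (R, M) (ttime (range_bits w) t) (R1, M)" "keeps p s R R1"
      "\<forall>i<p. R1 i s = tval w (env (dom_size w) k i) t" by auto
  have layout1: "layout p m w (R1, M)" using layout_keeps[OF Bit.prems(1) 1(2) Bit.prems(4)] by simp
  let ?is = "[Load 4 s, Const 5 1, Sub s 1 s, Sub s 5 s, Sub s 5 s, Sub 4 5 4, Sub s s 4]"
  \<comment> \<open>Subtraction is truncated: \<open>1 - (1 - (R1 i 1 - R1 i s))\<close> is
    \<open>1\<close> if the address is inside the word and \<open>0\<close> otherwise. In the latter
    case the result is \<open>0\<close> whatever was loaded.\<close>
  define R3 where "R3 = (\<lambda>i. (R1 i)(5 := 1, 4 := 1 - M (R1 i s),
    s := 1 - (1 - (R1 i 1 - R1 i s)) - (1 - M (R1 i s))))"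
  have 3: "runs p (block ?is) (R1, M) 7 (R3, M)"
    by (rule runs_block) (use Bit.prems in \<open>auto simp: fun_eq_iff R3_def\<close>)
  have K: "keeps p s R R3"
    using 1(2) by (auto simp: keeps_def R3_def)
  have "R3 i s = of_bool (bit_at w (R1 i s))" if "i < p" for i
    unfolding R3_def using layout1 that by (cases "R1 i s < length w") (auto simp: layout_def bit_at_def)
  then show ?case
    using runs_seq[OF 1(1) 3] 1(3) K layout_keeps[OF Bit.prems(1) K Bit.prems(4), of M] Bit.prems(5)
    by (intro exI[of _ R3] exI[of _ M]) auto
next
  case (Neg f)
  from Neg.IH[OF Neg.prems(1) _ _ Neg.prems(4,5), of k] Neg.prems(2,3) obtain R1 M1 where
    1: "runs p (fcomp k s f) (R, M) (ftime (range_bits w) f) (R1, M1)" "keeps p s R R1" "layout p m w (R1, M1)"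
      "\<forall>i<dom_size w ^ m. R1 i s = of_bool (fval w (env (dom_size w) k i) f)" by auto
  define R3 where "R3 = (\<lambda>i. (R1 i)(4 := 1, s := 1 - R1 i s))"
  have 3: "runs p (block [Const 4 1, Sub s 4 s]) (R1, M1) 2 (R3, M1)"
    by (rule runs_block) (use Neg.prems in \<open>auto simp: fun_eq_iff R3_def\<close>)
  have K: "keeps p s R1 R3"
    by (auto simp: keeps_def R3_def)
  have "\<forall>i<dom_size w ^ m. R3 i s = of_bool (fval w (env (dom_size w) k i) (Neg f))"
    using 1(4) by (auto simp: R3_def)
  then show ?case
    using runs_seq[OF 1(1) 3] keeps_trans[OF 1(2) K] layout_keeps[OF 1(3) K Neg.prems(4), of M1]
    by (intro exI[of _ R3] exI[of _ M1]) auto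
next
  case (And f g)
  have d: "k + depth f \<le> m" "k + depth g \<le> m"
    using And.prems(3) by (simp_all add: max_def split: if_splits)
  from And.IH(1)[OF And.prems(1) _ d(1) And.prems(4,5)] And.prems(2) obtain R1 M1 where
    1: "runs p (fcomp k s f) (R, M) (ftime (range_bits w) f) (R1, M1)" "keeps p s R R1" "layout p m w (R1, M1)"
      "\<forall>i<dom_size w ^ m. R1 i s = of_bool (fval w (env (dom_size w) k i) f)" by auto
  from And.IH(2)[OF 1(3) _ d(2), of "Suc s"] And.prems obtain R2 M2 where
    2: "runs p (fcomp k (Suc s) g) (R1, M1) (ftime (range_bits w) g) (R2, M2)" "keeps p (Suc s) R1 R2" "layout p m w (R2, M2)"
      "\<forall>i<dom_size w ^ m. R2 i (Suc s) = of_bool (fval w (env (dom_size w) k i) g)" by auto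
  define R3 where "R3 = (\<lambda>i. (R2 i)(4 := 1, Suc s := 1 - R2 i (Suc s), s := R2 i s - (1 - R2 i (Suc s))))"
  have 3: "runs p (block [Const 4 1, Sub (Suc s) 4 (Suc s), Sub s s (Suc s)]) (R2, M2) 3 (R3, M2)"
    by (rule runs_block) (use And.prems in \<open>auto simp: fun_eq_iff R3_def\<close>)
  have s: "R2 i s = R1 i s" if "i < p" for i
    using 2(2) that And.prems by (auto simp: keeps_def)
  have K: "keeps p s R2 R3"
    by (auto simp: keeps_def R3_def)
  have "keeps p s R R2" using keeps_trans[OF 1(2) 2(2)] by simp
  note K' = keeps_trans[OF this K]
  have "\<forall>i<dom_size w ^ m. R3 i s = of_bool (fval w (env (dom_size w) k i) (And f g))"
    using 1(4) 2(4) s And.prems(5) by (auto simp: R3_def)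
  then show ?case
    using runs_seq[OF 1(1) runs_seq[OF 2(1) 3]] K' layout_keeps[OF 2(3) K And.prems(4), of M2]
    by (intro exI[of _ R3] exI[of _ M2]) auto
next
  case (Ex f)
  let ?B = "dom_size w"
  let ?z = "11 + 2 * k"
  have B: "?B > 0" by (simp add: dom_size_def)
  have k: "k < m" using Ex.prems by simp
  from Ex.IH[OF Ex.prems(1) _ _ Ex.prems(4,5), of "Suc k"] Ex.prems(2,3) obtain R1 M1 where
    1: "runs p (fcomp (Suc k) s f) (R, M) (ftime (range_bits w) f) (R1, M1)" "keeps p s R R1" "layout p m w (R1, M1)"
      "\<forall>i<?B ^ m. R1 i s = of_bool (fval w (env ?B (Suc k) i) f)" by auto
  let ?R2 = "\<lambda>i. (R1 i)(4 := 1)"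
  have 2: "runs p (block [Const 4 1]) (R1, M1) 1 (?R2, M1)"
    by (rule runs_block) simp_all
  have Z: "R1 i ?z = length w + zero_digit ?B k i" "R1 i 2 = 0" if "i < p" for i
    using 1(3) that k by (auto simp: layout_def)
  \<comment> \<open>The cells are cleared first, because an earlier quantifier may have left values
    at the same addresses.\<close>
  define M2 where "M2 = (\<lambda>a. if \<exists>i<p. True \<and> ?R2 i ?z = a then 0 else M1 a)"
  have "runs p (op (Store ?z 2)) (?R2, M1) 1 (vexec p (\<lambda>_. True) (Store ?z 2) (?R2, M1))"
    by (rule runs_op) simp
  also have "vexec p (\<lambda>_. True) (Store ?z 2) (?R2, M1) = (?R2, M2)"
    unfolding M2_def by (rule vexec_Store_uniform) (use Z in auto)
  finally have 3: "runs p (op (Store ?z 2)) (?R2, M1) 1 (?R2, M2)" .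
  \<comment> \<open>All writers store \<open>1\<close>, so a cell receives the disjunction of the
    results of its class, which the whole class reads back in the next step.\<close>
  define M3 where "M3 = (\<lambda>a. if \<exists>i<p. ?R2 i s \<noteq> 0 \<and> ?R2 i ?z = a then 1 else M2 a)"
  have "runs p (cond s (Store ?z 4)) (?R2, M2) 3 (vexec p (\<lambda>i. fst (?R2, M2) i s \<noteq> 0) (Store ?z 4) (?R2, M2))"
    by (rule runs_cond) (use Z in auto)
  also have "vexec p (\<lambda>i. fst (?R2, M2) i s \<noteq> 0) (Store ?z 4) (?R2, M2) = (?R2, M3)"
    unfolding M3_def fst_conv by (rule vexec_Store_uniform) auto
  finally have 4: "runs p (cond s (Store ?z 4)) (?R2, M2) 3 (?R2, M3)" .
  define R5 where "R5 = (\<lambda>i. (?R2 i)(s := M3 (R1 i ?z)))"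
  have 5: "runs p (block [Load s ?z]) (?R2, M3) 1 (R5, M3)"
    by (rule runs_block) (simp_all add: R5_def)
  have M3: "\<forall>a<length w. M3 a = M1 a"
    using Z by (auto simp: M3_def M2_def)
  have K: "keeps p s R1 R5"
    by (auto simp: keeps_def R5_def)
  have val: "R5 i s = of_bool (\<exists>x<?B. fval w (case_nat x (env ?B k i)) f)" if i: "i < ?B ^ m" for i
  proof -
    have ip: "i < p" using i Ex.prems(5) by simp
    have s: "s \<noteq> 4" using Ex.prems by simp
    have "(\<exists>i'<p. R1 i' s \<noteq> 0 \<and> R1 i' ?z = R1 i ?z) \<longleftrightarrow> (\<exists>x<?B. fval w (case_nat x (env ?B k i)) f)"
    proof
      assume "\<exists>i'<p. R1 i' s \<noteq> 0 \<and> R1 i' ?z = R1 i ?z"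
      then obtain i' where i': "i' < p" "R1 i' s \<noteq> 0" "R1 i' ?z = R1 i ?z" by auto
      then have "zero_digit ?B k i = zero_digit ?B k i'" using Z ip by auto
      note z = zero_digit_eqD[OF this i k B]
      have "fval w (env ?B (Suc k) i') f" using 1(4) i'(2) z(1) by auto
      moreover have "env ?B (Suc k) i' = case_nat (digit ?B k i') (env ?B k i)"
        by (rule env_Suc) (use z(2) in auto)
      ultimately show "\<exists>x<?B. fval w (case_nat x (env ?B k i)) f"
        using z(3) by auto
    next
      assume "\<exists>x<?B. fval w (case_nat x (env ?B k i)) f"
      then obtain x where x: "x < ?B" "fval w (case_nat x (env ?B k i)) f" by auto
      from set_digit[OF i k x(1)] obtain i' where i': "i' < ?B ^ m" "digit ?B k i' = x"
        "zero_digit ?B k i' = zero_digit ?B k i" "\<forall>j<k. digit ?B j i' = digit ?B j i" by auto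
      from env_Suc[OF i'(4)] i'(1,2) x(2) 1(4) have "R1 i' s \<noteq> 0" by auto
      moreover have "i' < p" using i'(1) Ex.prems(5) by simp
      ultimately show "\<exists>i'<p. R1 i' s \<noteq> 0 \<and> R1 i' ?z = R1 i ?z"
        using Z ip i'(3) by auto
    qed
    then show ?thesis using ip s by (auto simp: R5_def M3_def M2_def)
  qed
  show ?case
    using runs_seq[OF 1(1) runs_seq[OF 2 runs_seq[OF 3 runs_seq[OF 4 5]]]] val
      keeps_trans[OF 1(2) K] layout_keeps[OF 1(3) K Ex.prems(4) M3]
    by (intro exI[of _ R5] exI[of _ M3]) auto
qed

section \<open>Computing the logarithm, the digits and the final answer\<close>

definition log_code :: code where
  "log_code = block [Half 4 1, Const 9 1] ;; loop 4 (block [Add 3 3 9, Half 4 4])"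

text \<open>Register \<open>4\<close> starts with \<open>n div 2\<close> and is halved in each
  round, so it vanishes after exactly \<open>floor_log n\<close> rounds; for \<open>n = 0\<close>
  this is \<open>0\<close> by the convention of \<open>floor_log\<close>.\<close>

lemma runs_log_code:
  assumes "\<And>i. i < p \<Longrightarrow> R i 1 = n \<and> R i 2 = 0 \<and> R i 3 = 0"
  shows "\<exists>R'. runs p log_code (R, M) (floor_log n * 4 + 3) (R', M) \<and>
    same_regs p (insert 3 scratch) R R' \<and> (\<forall>i<p. R' i 3 = floor_log n)"
proof -
  let ?I = "\<lambda>k S. snd S = M \<and> same_regs p (insert 3 scratch) R (fst S) \<and>
    (\<forall>i<p. fst S i 3 = k \<and> fst S i 4 = n div 2 ^ Suc k \<and> fst S i 9 = 1)"
  have zero: "n div 2 ^ Suc k = 0 \<longleftrightarrow> k = floor_log n" if "k \<le> floor_log n" for k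
  proof (cases "n = 0")
    case False
    have "n < 2 ^ Suc (floor_log n)" using floor_log_exp2_gt[of n] by simp
    moreover have "2 ^ Suc k \<le> n" if "k < floor_log n"
    proof -
      have "(2::nat) ^ Suc k \<le> 2 ^ floor_log n" using that by (intro power_increasing) auto
      also have "\<dots> \<le> n" using floor_log_exp2_le False by simp
      finally show ?thesis .
    qed
    ultimately show ?thesis using that
      by (metis div_eq_0_iff le_neq_implies_less not_le power_eq_0_iff zero_neq_numeral)
  qed (use that in simp)
  define R0 where "R0 = (\<lambda>i. (R i)(4 := R i 1 div 2, 9 := 1))"
  have 0: "runs p (block [Half 4 1, Const 9 1]) (R, M) 2 (R0, M)"
    by (rule runs_block) (simp_all add: R0_def)
  have "\<exists>S'. runs p (loop 4 (block [Add 3 3 9, Half 4 4])) (R0, M) (floor_log n * (2 + 2) + 1) S' \<and> ?I (floor_log n) S'"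
  proof (rule runs_loop[where I = "?I"])
    fix k S assume I: "?I k S"
    obtain R1 M1 where S: "S = (R1, M1)" by (cases S)
    define R2 where "R2 = (\<lambda>i. (R1 i)(3 := R1 i 3 + R1 i 9, 4 := R1 i 4 div 2))"
    have "runs p (block [Add 3 3 9, Half 4 4]) S 2 (R2, M1)"
      by (rule runs_block) (simp_all add: R2_def S)
    moreover have "?I (Suc k) (R2, M1)"
      using I by (auto simp: S R2_def same_regs_def div_mult2_eq[symmetric] mult.commute)
    ultimately show "\<exists>S'. runs p (block [Add 3 3 9, Half 4 4]) S 2 S' \<and> ?I (Suc k) S'"
      by blast
  next
    fix k S i assume *: "k \<le> floor_log n" "?I k S" "i < p"
    have "fst S i 2 = 0" using * assms[of i] by (auto simp: same_regs_def)
    then show "fst S i 2 = 0 \<and> (fst S i 4 = 0 \<longleftrightarrow> k = floor_log n)"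
      using * zero[OF *(1)] by auto
  next
    show "?I 0 (R0, M)" using assms by (auto simp: same_regs_def R0_def)
  qed
  then obtain R' where R': "runs p (loop 4 (block [Add 3 3 9, Half 4 4])) (R0, M) (floor_log n * 4 + 1) (R', M)"
    "?I (floor_log n) (R', M)" by auto
  have "2 + (floor_log n * 4 + 1) = floor_log n * 4 + 3" by simp
  from runs_seq[OF 0 R'(1), unfolded this] R'(2) show ?thesis
    unfolding log_code_def by auto
qed

fun shifts :: "nat \<Rightarrow> nat \<Rightarrow> code" where
  "shifts 0 r = block []"
| "shifts (Suc j) r = shift_left r ;; shifts j r"

lemma runs_shifts:
  assumes "r \<ge> 10" "\<And>i. i < p \<Longrightarrow> R i 2 = 0 \<and> R i 3 = L"
  shows "\<exists>R'. runs p (shifts j r) (R, M) (j * (L * 5 + 2)) (R', M) \<and>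
    same_regs p (insert r scratch) R R' \<and> (\<forall>i<p. R' i r = R i r * (2 ^ L) ^ j)"
  using assms(2)
proof (induction j arbitrary: R)
  case 0
  have "runs p (block []) (R, M) 0 (R, M)"
    by (rule runs_block) simp_all
  then show ?case using same_regs_refl[of p _ R] by auto
next
  case (Suc j)
  from assms(1) runs_shift_left[of r p R L M] Suc.prems obtain R1 where
    1: "runs p (shift_left r) (R, M) (L * 5 + 2) (R1, M)" "same_regs p (insert r scratch) R R1"
      "\<forall>i<p. R1 i r = R i r * 2 ^ L" by auto
  have "R1 i 2 = 0 \<and> R1 i 3 = L" if "i < p" for i
    using 1(2) assms(1) Suc.prems[OF that] that by (auto simp: same_regs_def)
  from Suc.IH[of R1, OF this] obtain R2 where
    2: "runs p (shifts j r) (R1, M) (j * (L * 5 + 2)) (R2, M)" "same_regs p (insert r scratch) R1 R2"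
      "\<forall>i<p. R2 i r = R1 i r * (2 ^ L) ^ j" by auto
  show ?case using runs_seq[OF 1(1) 2(1)] same_regs_trans[OF 1(2) 2(2) order_refl order_refl] 1(3) 2(3)
    by (intro exI[of _ R2] conjI) (simp_all only: shifts.simps mult_Suc, auto simp: mult.assoc)
qed

text \<open>One step of conversion to base \<open>dom_size w\<close>. The quotient goes to register
  \<open>12 + 2 * j\<close>, where the next step expects it; shifting it back and subtracting leaves
  the digit. The digit, shifted \<open>j\<close> times, is subtracted from the processor number in
  register \<open>0\<close> to obtain the address.\<close>

definition decode :: "nat \<Rightarrow> code" where
  "decode j = block [Add (12 + 2 * j) (10 + 2 * j) 2] ;; shift_right (12 + 2 * j) ;;
     block [Add (11 + 2 * j) (12 + 2 * j) 2] ;; shift_left (11 + 2 * j) ;;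
     block [Sub (10 + 2 * j) (10 + 2 * j) (11 + 2 * j), Add (11 + 2 * j) (10 + 2 * j) 2] ;;
     shifts j (11 + 2 * j) ;;
     block [Sub (11 + 2 * j) 0 (11 + 2 * j), Add (11 + 2 * j) 1 (11 + 2 * j)]"

definition decode_time :: "nat \<Rightarrow> nat \<Rightarrow> nat" where
  "decode_time L j = 1 + ((L * 5 + 2) + (1 + ((L * 5 + 2) + (2 + (j * (L * 5 + 2) + 2)))))"

text \<open>The last conjunct is the part of the processor number that is still to be split.\<close>

definition decoded :: "nat \<Rightarrow> nat \<Rightarrow> bool list \<Rightarrow> (nat \<Rightarrow> nat \<Rightarrow> nat) \<Rightarrow> bool" where
  "decoded p m w R \<longleftrightarrow>
     (\<forall>i<p. R i 0 = i \<and> R i 1 = length w \<and> R i 2 = 0 \<and> R i 3 = range_bits w \<and>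
       (\<forall>j<m. R i (10 + 2 * j) = digit (dom_size w) j i \<and>
              R i (11 + 2 * j) = length w + zero_digit (dom_size w) j i) \<and>
       R i (10 + 2 * m) = i div dom_size w ^ m)"

lemma runs_decode:
  assumes "decoded p j w R"
  shows "\<exists>R'. runs p (decode j) (R, M) (decode_time (range_bits w) j) (R', M) \<and> decoded p (Suc j) w R'"
proof -
  let ?L = "range_bits w" and ?B = "dom_size w"
  let ?d = "10 + 2 * j" and ?z = "11 + 2 * j" and ?n = "12 + 2 * j"
  have static: "R i 0 = i" "R i 1 = length w" "R i 2 = 0" "R i 3 = ?L" "R i ?d = i div ?B ^ j" if "i < p" for i
    using assms that by (auto simp: decoded_def)
  define R1 where "R1 = (\<lambda>i. (R i)(?n := R i ?d + R i 2))"
  have 1: "runs p (block [Add ?n ?d 2]) (R, M) 1 (R1, M)"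
    by (rule runs_block) (simp_all add: R1_def)
  obtain R2 where 2: "runs p (shift_right ?n) (R1, M) (?L * 5 + 2) (R2, M)"
    "same_regs p (insert ?n scratch) R1 R2" "\<forall>i<p. R2 i ?n = R1 i ?n div 2 ^ ?L"
    using runs_shift_right[of ?n p R1 ?L M] static by (auto simp: R1_def)
  define R3 where "R3 = (\<lambda>i. (R2 i)(?z := R2 i ?n + R2 i 2))"
  have 3: "runs p (block [Add ?z ?n 2]) (R2, M) 1 (R3, M)"
    by (rule runs_block) (simp_all add: R3_def)
  have R2: "R2 i r = (if r = ?n then i div ?B ^ j div ?B else R i r)" if "i < p" "r \<notin> scratch" for i r
    using 2(2,3) that static by (auto simp: R1_def same_regs_def dom_size_def)
  obtain R4 where 4: "runs p (shift_left ?z) (R3, M) (?L * 5 + 2) (R4, M)"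
    "same_regs p (insert ?z scratch) R3 R4" "\<forall>i<p. R4 i ?z = R3 i ?z * 2 ^ ?L"
    using runs_shift_left[of ?z p R3 ?L M] static R2 by (auto simp: R3_def)
  have R4: "R4 i r = (if r = ?n then i div ?B ^ j div ?B else
      if r = ?z then i div ?B ^ j div ?B * ?B else R i r)" if "i < p" "r \<notin> scratch" for i r
    using 4(2,3) that static R2 by (auto simp: R3_def same_regs_def dom_size_def)
  define R5 where "R5 = (\<lambda>i. (R4 i)(?d := R4 i ?d - R4 i ?z, ?z := R4 i ?d - R4 i ?z + R4 i 2))"
  have 5: "runs p (block [Sub ?d ?d ?z, Add ?z ?d 2]) (R4, M) 2 (R5, M)"
    by (rule runs_block) (simp_all add: R5_def)
  have R5: "R5 i r = (if r = ?n then i div ?B ^ j div ?B else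
      if r = ?z \<or> r = ?d then digit ?B j i else R i r)" if "i < p" "r \<notin> scratch" for i r
    using that static R4 by (auto simp: R5_def digit_def minus_div_mult_eq_mod)
  obtain R6 where 6: "runs p (shifts j ?z) (R5, M) (j * (?L * 5 + 2)) (R6, M)"
    "same_regs p (insert ?z scratch) R5 R6" "\<forall>i<p. R6 i ?z = R5 i ?z * (2 ^ ?L) ^ j"
    using runs_shifts[of ?z p R5 ?L j M] static R5 by auto
  have R6: "R6 i r = (if r = ?n then i div ?B ^ j div ?B else if r = ?d then digit ?B j i else
      if r = ?z then digit ?B j i * ?B ^ j else R i r)" if "i < p" "r \<notin> scratch" for i r
    using 6(2,3) that static R5 by (auto simp: same_regs_def dom_size_def)
  define R7 where "R7 = (\<lambda>i. (R6 i)(?z := R6 i 1 + (R6 i 0 - R6 i ?z)))"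
  have 7: "runs p (block [Sub ?z 0 ?z, Add ?z 1 ?z]) (R6, M) 2 (R7, M)"
    by (rule runs_block) (simp_all add: R7_def)
  have R7: "R7 i r = (if r = ?n then i div ?B ^ j div ?B else if r = ?d then digit ?B j i else
      if r = ?z then length w + zero_digit ?B j i else R i r)" if "i < p" "r \<notin> scratch" for i r
    using that static R6 by (auto simp: R7_def zero_digit_def)
  have "decoded p (Suc j) w R7"
    unfolding decoded_def
  proof (intro allI impI)
    fix i assume i: "i < p"
    have "i div ?B ^ j div ?B = i div ?B ^ Suc j"
      by (simp only: power_Suc2 div_mult2_eq)
    then show "R7 i 0 = i \<and> R7 i 1 = length w \<and> R7 i 2 = 0 \<and> R7 i 3 = range_bits w \<and>
       (\<forall>k<Suc j. R7 i (10 + 2 * k) = digit ?B k i \<and> R7 i (11 + 2 * k) = length w + zero_digit ?B k i) \<and>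
       R7 i (10 + 2 * Suc j) = i div ?B ^ Suc j"
      using assms i R7[OF i] by (auto simp: decoded_def less_Suc_eq)
  qed
  moreover have "runs p (decode j) (R, M) (decode_time ?L j) (R7, M)"
    unfolding decode_def decode_time_def by (intro runs_seq) (fact 1 2(1) 3 4(1) 5 6(1) 7)+
  ultimately show ?thesis by blast
qed

fun decodes :: "nat \<Rightarrow> code" where
  "decodes 0 = block [Add 10 0 2]"
| "decodes (Suc m) = decodes m ;; decode m"

lemma runs_decodes:
  assumes "\<And>i. i < p \<Longrightarrow> R i 0 = i \<and> R i 1 = length w \<and> R i 2 = 0 \<and> R i 3 = range_bits w"
  shows "\<exists>R'. runs p (decodes m) (R, M) (1 + (\<Sum>j<m. decode_time (range_bits w) j)) (R', M) \<and> decoded p m w R'"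
proof (induction m)
  case 0
  define R1 where "R1 = (\<lambda>i. (R i)(10 := R i 0 + R i 2))"
  have "runs p (decodes 0) (R, M) 1 (R1, M)"
    unfolding decodes.simps by (rule runs_block) (simp_all add: R1_def)
  moreover have "decoded p 0 w R1"
    using assms by (auto simp: decoded_def R1_def)
  ultimately show ?case by auto
next
  case (Suc m)
  then obtain R1 where 1: "runs p (decodes m) (R, M) (1 + (\<Sum>j<m. decode_time (range_bits w) j)) (R1, M)"
    "decoded p m w R1" by blast
  from runs_decode[OF 1(2)] obtain R2 where
    2: "runs p (decode m) (R1, M) (decode_time (range_bits w) m) (R2, M)" "decoded p (Suc m) w R2" by blast
  from runs_seq[OF 1(1) 2(1)] 2(2) show ?case by (auto simp: add.assoc)
qed

text \<open>All processors write to cell \<open>0\<close>, and the priority rule lets processor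
  \<open>0\<close> succeed; its number is below \<open>dom_size w ^ depth f\<close>, so its result
  is correct. The input bit lost there is no longer read.\<close>

definition formula_code :: "fm \<Rightarrow> code" where
  "formula_code f = log_code ;; decodes (depth f) ;; fcomp 0 (10 + 2 * depth f) f ;;
     block [Const 4 0] ;; op (Store 4 (10 + 2 * depth f))"

definition formula_time :: "fm \<Rightarrow> nat \<Rightarrow> nat" where
  "formula_time f L = (L * 4 + 3) + ((1 + (\<Sum>j<depth f. decode_time L j)) + (ftime L f + (1 + 1)))"

lemma runs_formula_code:
  assumes "fclosed 0 f" "dom_size w ^ depth f \<le> p"
  shows "\<exists>S. runs p (formula_code f) (\<lambda>i. (\<lambda>_. 0)(0 := i, 1 := length w), \<lambda>a. if a < length w then of_bool (w ! a) else 0)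
    (formula_time f (range_bits w)) S \<and> snd S 0 = of_bool (fval w (\<lambda>_. 0) f)"
proof -
  let ?m = "depth f"
  let ?s = "10 + 2 * ?m"
  define R where "R = (\<lambda>i::nat. (\<lambda>_::nat. 0::nat)(0 := i, 1 := length w))"
  define M where "M = (\<lambda>a. if a < length w then of_bool (w ! a) else 0 :: nat)"
  obtain R1 where 1: "runs p log_code (R, M) (range_bits w * 4 + 3) (R1, M)"
    "same_regs p (insert 3 scratch) R R1" "\<forall>i<p. R1 i 3 = range_bits w"
    using runs_log_code[of p R "length w" M] by (auto simp: R_def)
  have "R1 i 0 = i \<and> R1 i 1 = length w \<and> R1 i 2 = 0 \<and> R1 i 3 = range_bits w" if "i < p" for i
    using 1(2,3) that by (auto simp: same_regs_def R_def)
  from runs_decodes[OF this] obtain R2 where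
    2: "runs p (decodes ?m) (R1, M) (1 + (\<Sum>j<?m. decode_time (range_bits w) j)) (R2, M)" "decoded p ?m w R2"
    by blast
  have "layout p ?m w (R2, M)"
    using 2(2) by (auto simp: decoded_def layout_def M_def)
  from runs_fcomp[OF this assms(1) _ _ assms(2), of "10 + 2 * ?m"] obtain R3 M3 where
    3: "runs p (fcomp 0 ?s f) (R2, M) (ftime (range_bits w) f) (R3, M3)"
      "\<forall>i<dom_size w ^ ?m. R3 i ?s = of_bool (fval w (env (dom_size w) 0 i) f)" by auto
  let ?R4 = "\<lambda>i. (R3 i)(4 := 0)"
  have 4: "runs p (block [Const 4 0]) (R3, M3) 1 (?R4, M3)"
    by (rule runs_block) simp_all
  let ?S = "vexec p (\<lambda>_. True) (Store 4 ?s) (?R4, M3)"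
  have 5: "runs p (op (Store 4 ?s)) (?R4, M3) 1 ?S"
    by (rule runs_op) simp
  have p: "0 < dom_size w ^ ?m" by (simp add: dom_size_def)
  then have "p > 0" using assms(2) by linarith
  have "{i. i < p \<and> ?R4 i 4 = 0} = {..<p}" by auto
  moreover have "Min {..<p} = 0" using \<open>p > 0\<close> by (intro Min_eqI) auto
  ultimately have "snd ?S 0 = R3 0 ?s"
    using \<open>p > 0\<close> by (auto simp: vexec_Store Let_def)
  also have "\<dots> = of_bool (fval w (\<lambda>_. 0) f)"
    using 3(2) p by (simp add: env_def)
  finally have "snd ?S 0 = of_bool (fval w (\<lambda>_. 0) f)" .
  moreover have "runs p (formula_code f) (R, M) (formula_time f (range_bits w)) ?S"
    unfolding formula_code_def formula_time_def by (intro runs_seq) (fact 1(1) 2(1) 3(1) 4 5)+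
  ultimately show ?thesis unfolding R_def M_def by blast
qed

section \<open>Running time and membership in \<open>NC\<close>\<close>

definition linear_bound :: "(nat \<Rightarrow> nat) \<Rightarrow> bool" where
  "linear_bound g \<longleftrightarrow> (\<exists>c. \<forall>L. g L \<le> c * (L + 1))"

lemma linear_bound_const: "linear_bound (\<lambda>_. c)"
  unfolding linear_bound_def by (rule exI[of _ c]) simp

lemma linear_bound_mult: "linear_bound (\<lambda>L. L * c)"
  unfolding linear_bound_def by (rule exI[of _ c]) simp

lemma linear_bound_add:
  assumes "linear_bound g" "linear_bound h"
  shows "linear_bound (\<lambda>L. g L + h L)"
proof -
  from assms obtain c d where "\<And>L. g L \<le> c * (L + 1)" "\<And>L. h L \<le> d * (L + 1)"
    unfolding linear_bound_def by auto
  then have "g L + h L \<le> (c + d) * (L + 1)" for L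
    by (metis add_mono distrib_right)
  then show ?thesis unfolding linear_bound_def by blast
qed

lemma linear_bound_cmult:
  assumes "linear_bound g"
  shows "linear_bound (\<lambda>L. k * g L)"
proof -
  from assms obtain c where "\<And>L. g L \<le> c * (L + 1)"
    unfolding linear_bound_def by auto
  then have "k * g L \<le> (k * c) * (L + 1)" for L
    by (metis mult.assoc mult_le_mono2)
  then show ?thesis unfolding linear_bound_def by blast
qed

lemma linear_bound_sum:
  fixes m :: nat
  shows
  "(\<And>j. linear_bound (g j)) \<Longrightarrow> linear_bound (\<lambda>L. \<Sum>j<m. g j L)"
  by (induction m) (auto intro: linear_bound_const linear_bound_add)

lemmas linear_bound_intros =
  linear_bound_const linear_bound_mult linear_bound_cmult linear_bound_sum linear_bound_add

lemma linear_bound_ttime: "linear_bound (\<lambda>L. ttime L t)"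
  by (induction t) (simp_all only: ttime.simps linear_bound_intros)

lemma linear_bound_ftime: "linear_bound (\<lambda>L. ftime L f)"
  by (induction f) (simp_all only: ftime.simps linear_bound_intros linear_bound_ttime)

lemma linear_bound_formula_time: "linear_bound (formula_time f)"
  unfolding formula_time_def decode_time_def
  by (intro linear_bound_intros linear_bound_ftime)

text \<open>For \<open>n\<close> at least \<open>2\<close>, both \<open>floor_log n\<close> and
  \<open>1\<close> are at most \<open>ln n / ln 2\<close>, which explains the factor
  \<open>2 / ln 2\<close>.\<close>

lemma floor_log_bigo: "(\<lambda>n. real (c * (floor_log n + 1))) \<in> O(\<lambda>n. ln (real n) ^ 1)"
proof (rule bigoI[of _ "real c * (2 / ln 2)"])
  have "real (c * (floor_log n + 1)) \<le> real c * (2 / ln 2) * ln (real n)" if n: "n \<ge> 2" for n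
  proof -
    have "(2::real) ^ floor_log n \<le> real n"
      using floor_log_exp2_le[of n] n by (metis not_numeral_le_zero of_nat_le_iff of_nat_numeral of_nat_power neq0_conv)
    then have "ln ((2::real) ^ floor_log n) \<le> ln (real n)"
      using n by (subst ln_le_cancel_iff) auto
    then have "real (floor_log n) * ln 2 \<le> ln (real n)"
      by (simp add: ln_realpow)
    moreover have "ln 2 \<le> ln (real n)" using n by simp
    ultimately have "real (floor_log n + 1) * ln 2 \<le> 2 * ln (real n)"
      by (simp add: algebra_simps)
    then have "real (floor_log n + 1) \<le> 2 * ln (real n) / ln 2"
      by (simp add: pos_le_divide_eq)
    from mult_left_mono[OF this, of "real c"] show ?thesis by (simp add: algebra_simps)
  qed
  then show "\<forall>\<^sub>F n in at_top. norm (real (c * (floor_log n + 1))) \<le> real c * (2 / ln 2) * norm (ln (real n) ^ 1)"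
    unfolding eventually_at_top_linorder by (intro exI[of _ 2]) auto
qed

theorem first_order_NC:
  assumes "fclosed 0 f"
  shows "{w. fval w (\<lambda>_. 0) f} \<in> NC"
proof -
  obtain c where c: "\<And>L. formula_time f L \<le> c * (L + 1)"
    using linear_bound_formula_time unfolding linear_bound_def by blast
  let ?prog = "formula_code f 0"
  have "\<exists>t\<le>c * (floor_log (length w) + 1).
     pram_halted ?prog (length w ^ depth f + 1) (pram_run ?prog (length w ^ depth f + 1) w t) \<and>
     (fval w (\<lambda>_. 0) f \<longleftrightarrow> snd (pram_run ?prog (length w ^ depth f + 1) w t) 0 = 1)" for w
  proof -
    let ?p = "length w ^ depth f + 1"
    \<comment> \<open>For the empty word the range has one element although the length is
      \<open>0\<close>; the additional processor accounts for this.\<close>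
    have "dom_size w \<le> length w \<or> dom_size w = 1"
      unfolding dom_size_def using floor_log_exp2_le[of "length w"] by (cases "length w = 0") auto
    then have "dom_size w ^ depth f \<le> ?p"
      by (auto intro: order.trans[OF power_mono])
    from runs_formula_code[OF assms this] obtain S where
      S: "runs ?p (formula_code f) (\<lambda>i. (\<lambda>_. 0)(0 := i, 1 := length w), \<lambda>a. if a < length w then of_bool (w ! a) else 0)
        (formula_time f (range_bits w)) S" and val: "snd S 0 = of_bool (fval w (\<lambda>_. 0) f)" by blast
    have "at_pc ?p (length []) (\<lambda>i. (\<lambda>_. 0)(0 := i, 1 := length w), \<lambda>a. if a < length w then of_bool (w ! a) else 0) (pram_init w)"
      by (simp add: at_pc_def pram_init_def)
    with S have "at_pc ?p (length ([]::program) + length (formula_code f (length ([]::program)))) S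
        ((pram_step ([] @ formula_code f (length ([]::program)) @ []) ?p ^^ formula_time f (range_bits w)) (pram_init w))"
      unfolding runs_def by blast
    then have "at_pc ?p (length ?prog) S (pram_run ?prog ?p w (formula_time f (range_bits w)))"
      by (simp add: pram_run_def)
    then show ?thesis
      using c[of "range_bits w"] val
      by (intro exI[of _ "formula_time f (range_bits w)"]) (auto simp: at_pc_def pram_halted_def proc_halted_def)
  qed
  then have "pram_decides ?prog (\<lambda>n. n ^ depth f + 1) (\<lambda>n. c * (floor_log n + 1)) {w. fval w (\<lambda>_. 0) f}"
    by (simp add: pram_decides_def)
  then show ?thesis
    unfolding NC_def using floor_log_bigo[of c] by blast
qed

section \<open>The first arrival at a cell\<close>

definition count :: "config \<Rightarrow> cell \<Rightarrow> nat" where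
  "count c u = (\<Sum>v\<in>neighbors u. of_bool (c v))"

lemma count_eq:
  "count c (a, b) = of_bool (c (a - 1, b)) + of_bool (c (a + 1, b)) + of_bool (c (a, b - 1)) + of_bool (c (a, b + 1))"
  unfolding count_def neighbors_eq by simp

lemma count_cong:
  "(\<And>v. v \<in> neighbors u \<Longrightarrow> c v = c' v) \<Longrightarrow> count c u = count c' u"
  unfolding count_def by (intro sum.cong) auto

lemma finite_neighbors: "finite (neighbors u)"
  by (cases u) (simp add: neighbors_eq)

lemma count_mono:
  "(\<And>v. c v \<Longrightarrow> c' v) \<Longrightarrow> count c u \<le> count c' u"
  unfolding count_def by (intro sum_mono) auto

abbreviation act :: "nat set \<Rightarrow> config \<Rightarrow> nat \<Rightarrow> config" where
  "act I c t \<equiv> (ftca I ^^ t) c"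

lemma act_Suc: "act I c (Suc t) u \<longleftrightarrow> act I c t u \<or> count (act I c t) u \<in> I"
  by (simp add: ftca_def count_def)

lemma act_mono: "act I c t u \<Longrightarrow> t \<le> t' \<Longrightarrow> act I c t' u"
  by (induction t') (auto simp: le_Suc_eq act_Suc simp del: funpow.simps)

text \<open>Lets the four axes and the four quadrants around a cell be reduced to one of
  each.\<close>

lemma act_isometry:
  assumes "inj \<rho>" "\<And>z. neighbors (\<rho> z) = \<rho> ` neighbors z"
  shows "act I (c \<circ> \<rho>) t z = act I c t (\<rho> z)"
proof (induction t arbitrary: z)
  case (Suc t)
  have "count (act I c t) (\<rho> z) = (\<Sum>v\<in>neighbors z. of_bool (act I c t (\<rho> v)))"
    by (simp add: count_def assms(2) sum.reindex[OF inj_on_subset[OF assms(1) subset_UNIV]])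
  also have "\<dots> = count (act I (c \<circ> \<rho>) t) z"
    by (simp only: count_def Suc.IH)
  finally have "count (act I c t) (\<rho> z) = count (act I (c \<circ> \<rho>) t) z" .
  then show ?case by (simp only: act_Suc Suc.IH)
qed simp

text \<open>Every neighbor of \<open>T\<close> lies in \<open>T\<close> or is active for good, so no
  count on \<open>T\<close> can change while \<open>T\<close> is inactive, and by assumption these
  counts activate nothing.\<close>

lemma deadlock:
  assumes T: "\<And>z. z \<in> T \<Longrightarrow> \<not> act I c t z \<and> count (act I c t) z \<notin> I"
    and nb: "\<And>z y. z \<in> T \<Longrightarrow> y \<in> neighbors z \<Longrightarrow> y \<in> T \<or> act I c t y"
    and "z \<in> T"
  shows "\<not> act I c t' z"
proof (cases "t \<le> t'")
  case True
  then have "\<forall>z\<in>T. \<not> act I c t' z"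
  proof (induction t' rule: dec_induct)
    case (step t')
    have "count (act I c t') z = count (act I c t) z" if "z \<in> T" for z
    proof (rule count_cong)
      fix y assume "y \<in> neighbors z"
      with nb[OF that this] T step act_mono[where u=y and t=t and t'=t'] show "act I c t' y = act I c t y"
        by auto
    qed
    with T step show ?case by (auto simp: act_Suc simp del: funpow.simps)
  qed (use T in blast)
  then show ?thesis using assms(3) by blast
next
  case False
  then show ?thesis using T[OF assms(3)] act_mono[where u=z and t=t' and t'=t] by auto
qed

definition mdist :: "cell \<Rightarrow> cell \<Rightarrow> int" where
  "mdist u v = \<bar>fst v - fst u\<bar> + \<bar>snd v - snd u\<bar>"

definition quiet :: "config \<Rightarrow> cell \<Rightarrow> nat \<Rightarrow> bool" where
  "quiet c v d \<longleftrightarrow> (\<forall>z. mdist v z < int d \<longrightarrow> \<not> c z)"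

definition nearest :: "config \<Rightarrow> cell \<Rightarrow> nat \<Rightarrow> bool" where
  "nearest c v d \<longleftrightarrow> quiet c v d \<and> (\<exists>z. mdist v z = int d \<and> c z)"

text \<open>As \<open>0\<close> is not in the rule, activity advances by at most one unit of
  distance per step.\<close>

lemma quiet_act:
  assumes "0 \<notin> I" "quiet c v d" "mdist v z + int t < int d"
  shows "\<not> act I c t z"
  using assms(3)
proof (induction t arbitrary: z)
  case (Suc t)
  have "\<not> act I c t y" if "y \<in> neighbors z" for y
    using that Suc.prems by (intro Suc.IH) (auto simp: mdist_def neighbors_def)
  then have "count (act I c t) z = 0"
    by (auto simp: count_def)
  then show ?case using Suc assms(1) by (auto simp: act_Suc simp del: funpow.simps)
qed (use assms(2) in \<open>auto simp: quiet_def\<close>)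

text \<open>Away from the axes, only the two outer neighbors of a cell can be active before it, so that
  it becomes active as soon as possible.\<close>

lemma act_quadrant:
  assumes I: "0 \<notin> I" "1 \<in> I" "2 \<in> I" and q: "quiet c (0, 0) d"
    and xy: "1 \<le> x" "1 \<le> y" "x + y + int t = int d"
  shows "act I c t (x, y) \<longleftrightarrow> (\<exists>i\<le>t. c (x + int i, y + int (t - i)))"
  using xy
proof (induction t arbitrary: x y)
  case (Suc t)
  have in0: "\<not> act I c t (x - 1, y)" "\<not> act I c t (x, y - 1)" "\<not> act I c t (x, y)"
    using Suc.prems by (auto intro!: quiet_act[OF I(1) q] simp: mdist_def)
  have "count (act I c t) (x, y) = of_bool (act I c t (x + 1, y)) + of_bool (act I c t (x, y + 1))"
    using in0 by (simp add: count_eq)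
  then have "act I c (Suc t) (x, y) \<longleftrightarrow> act I c t (x + 1, y) \<or> act I c t (x, y + 1)"
    using in0 I by (auto simp: act_Suc numeral_2_eq_2 simp del: funpow.simps)
  also have "act I c t (x + 1, y) \<longleftrightarrow> (\<exists>i\<le>t. c (x + 1 + int i, y + int (t - i)))"
    using Suc.prems by (intro Suc.IH) auto
  also have "act I c t (x, y + 1) \<longleftrightarrow> (\<exists>i\<le>t. c (x + int i, y + 1 + int (t - i)))"
    using Suc.prems by (intro Suc.IH) auto
  also have "(\<exists>i\<le>t. c (x + 1 + int i, y + int (t - i))) \<longleftrightarrow> (\<exists>i\<in>{1..Suc t}. c (x + int i, y + int (Suc t - i)))"
  proof -
    have "{1..Suc t} = Suc ` {..t}" by (simp add: image_Suc_atMost)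
    then show ?thesis by (auto simp: algebra_simps)
  qed
  also have "(\<exists>i\<le>t. c (x + int i, y + 1 + int (t - i))) \<longleftrightarrow> (\<exists>i\<le>t. c (x + int i, y + int (Suc t - i)))"
    by (intro ex_cong1 conj_cong refl) (simp add: algebra_simps of_nat_diff)
  also have "(\<exists>i\<in>{1..Suc t}. c (x + int i, y + int (Suc t - i))) \<or> (\<exists>i\<le>t. c (x + int i, y + int (Suc t - i))) \<longleftrightarrow>
      (\<exists>i\<le>Suc t. c (x + int i, y + int (Suc t - i)))"
  proof -
    have "i \<le> Suc t \<longleftrightarrow> i \<in> {1..Suc t} \<or> i \<le> t" for i by auto
    then show ?thesis by blast
  qed
  finally show ?case .
qed auto

definition sg :: "bool \<Rightarrow> int" where
  "sg s = (if s then 1 else - 1)"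

lemma sg_simps [simp]: "sg True = 1" "sg False = - 1"
  by (simp_all add: sg_def)

text \<open>Coordinates around \<open>v\<close> in which the first axis points to one of the four directions.\<close>

definition frame :: "bool \<Rightarrow> bool \<Rightarrow> cell \<Rightarrow> cell \<Rightarrow> cell" where
  "frame sw s v z = (if sw then (fst v + snd z, snd v + sg s * fst z) else (fst v + sg s * fst z, snd v + snd z))"

definition off :: "bool \<Rightarrow> bool \<Rightarrow> bool \<Rightarrow> cell \<Rightarrow> nat \<Rightarrow> nat \<Rightarrow> cell" where
  "off sw s t v x y = frame sw s v (int x, sg t * int y)"

abbreviation nbr :: "bool \<Rightarrow> bool \<Rightarrow> cell \<Rightarrow> cell" where
  "nbr sw s v \<equiv> off sw s True v 1 0"

text \<open>The active cells that can reach position \<open>(k, 1)\<close> beside the axis, on side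
  \<open>t\<close>, by time \<open>d - k - 1\<close>. By \<open>act_arm\<close> the existence of one
  decides whether the wave hits axis position \<open>k\<close> from that side.\<close>

definition arm :: "config \<Rightarrow> bool \<Rightarrow> bool \<Rightarrow> bool \<Rightarrow> cell \<Rightarrow> nat \<Rightarrow> nat \<Rightarrow> bool" where
  "arm c sw s t v d k \<longleftrightarrow> (\<exists>x y. k \<le> x \<and> 1 \<le> y \<and> x + y = d \<and> c (off sw s t v x y))"

definition arms :: "config \<Rightarrow> bool \<Rightarrow> bool \<Rightarrow> cell \<Rightarrow> nat \<Rightarrow> nat \<Rightarrow> bool" where
  "arms c sw s v d k \<longleftrightarrow> arm c sw s True v d k \<and> arm c sw s False v d k"

text \<open>Besides both sides this admits the tip of the axis at distance \<open>d\<close>; it says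
  that the wave comes towards axis position \<open>k\<close> at all.\<close>

definition cone :: "config \<Rightarrow> bool \<Rightarrow> bool \<Rightarrow> cell \<Rightarrow> nat \<Rightarrow> nat \<Rightarrow> bool" where
  "cone c sw s v d k \<longleftrightarrow> arm c sw s True v d k \<or> arm c sw s False v d k \<or> c (off sw s True v d 0)"

text \<open>\<open>K\<close> is the last position on the axis that the wave reaches from both sides. At \<open>K + 1\<close> the
  state is a disjunction, and from there to the neighbor of \<open>v\<close> it alternates.\<close>

definition sig :: "config \<Rightarrow> bool \<Rightarrow> bool \<Rightarrow> cell \<Rightarrow> nat \<Rightarrow> bool" where
  "sig c sw s v d \<longleftrightarrow> (\<exists>K<d. (K = 0 \<or> arms c sw s v d K) \<and> \<not> arms c sw s v d (Suc K) \<and>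
     cone c sw s v d (Suc K) \<noteq> odd K)"

lemma frame_neighbors: "neighbors (frame sw s v z) = frame sw s v ` neighbors z"
proof -
  have "sg s = 1 \<or> sg s = -1" by (simp add: sg_def)
  then show ?thesis
    by (cases z) (auto simp: frame_def neighbors_eq algebra_simps)
qed

lemma inj_frame: "inj (frame sw s v)"
  by (rule injI) (auto simp: frame_def sg_def prod_eq_iff split: if_splits)

lemma surj_frame: "\<exists>y. z = frame sw s v y"
  by (rule exI[of _ "if sw then (sg s * (snd z - snd v), fst z - fst v)
      else (sg s * (fst z - fst v), snd z - snd v)"]) (auto simp: frame_def sg_def)

lemma mdist_frame: "mdist (frame sw s v y) (frame sw s v z) = mdist y z"
  by (auto simp: mdist_def frame_def sg_def)

lemma frame_0: "frame sw s v (0, 0) = v"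
  by (simp add: frame_def)

lemma quiet_frame: "quiet c v d \<Longrightarrow> quiet (c \<circ> frame sw s v) (0, 0) d"
  unfolding quiet_def by (metis comp_apply frame_0 mdist_frame)

lemma act_frame: "act I (c \<circ> frame sw s v) t z = act I c t (frame sw s v z)"
  by (rule act_isometry[OF inj_frame frame_neighbors])

lemma arm_antimono: "arm c sw s t v d k' \<Longrightarrow> k \<le> k' \<Longrightarrow> arm c sw s t v d k"
  unfolding arm_def using order.trans by blast

lemma act_arm:
  assumes I: "0 \<notin> I" "1 \<in> I" "2 \<in> I" and q: "quiet c v d" and k: "1 \<le> k" "k + 1 + n = d"
  shows "act I c n (off sw s t v k 1) \<longleftrightarrow> arm c sw s t v d k"
proof -
  define r where "r = (\<lambda>z::cell. (fst z, sg t * snd z))"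
  have sgt: "sg t = 1 \<or> sg t = - 1" by (simp add: sg_def)
  have r: "inj r" "\<And>z. neighbors (r z) = r ` neighbors z"
    using sgt by (auto simp: r_def inj_def neighbors_eq split: prod.splits)
  let ?c = "(c \<circ> frame sw s v) \<circ> r"
  have "quiet ?c (0, 0) d"
    using quiet_frame[OF q, of sw s] sgt by (auto simp: quiet_def mdist_def r_def)
  from act_quadrant[OF I this, of "int k" 1 n]
  have "act I ?c n (int k, 1) \<longleftrightarrow> (\<exists>i\<le>n. ?c (int k + int i, 1 + int (n - i)))"
    using k by simp
  also have "act I ?c n (int k, 1) = act I c n (off sw s t v k 1)"
    unfolding act_isometry[OF r] act_frame by (simp add: off_def r_def)
  also have "(\<exists>i\<le>n. ?c (int k + int i, 1 + int (n - i))) \<longleftrightarrow> arm c sw s t v d k"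
    unfolding arm_def
  proof safe
    fix i assume "i \<le> n" "?c (int k + int i, 1 + int (n - i))"
    then show "\<exists>x y. k \<le> x \<and> 1 \<le> y \<and> x + y = d \<and> c (off sw s t v x y)"
      using k by (intro exI[of _ "k + i"] exI[of _ "1 + (n - i)"]) (auto simp: off_def r_def)
  next
    fix x y assume "k \<le> x" "1 \<le> y" "d = x + y" "c (off sw s t v x y)"
    moreover from this have "int k + int (x - k) = int x" "1 + int (n - (x - k)) = int y" "x - k \<le> n"
      using k by auto
    ultimately show "\<exists>i\<le>n. ?c (int k + int i, 1 + int (n - i))"
      by (intro exI[of _ "x - k"]) (simp add: off_def r_def)
  qed
  finally show ?thesis .
qed

text \<open>At time \<open>d - k - 1\<close> the inner neighbor of axis position \<open>k\<close> is
  still too close to \<open>v\<close> to be active. This leaves the two sides, which are known from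
  \<open>act_arm\<close>, and the next position on the axis.\<close>

lemma act_axis:
  assumes I: "0 \<notin> I" "1 \<in> I" "2 \<in> I" and q: "quiet c v d" and k: "1 \<le> k" "k < d"
  shows "act I c (d - k) (off sw s True v k 0) \<longleftrightarrow>
    of_bool (arm c sw s True v d k) + of_bool (arm c sw s False v d k) +
    of_bool (act I c (d - Suc k) (off sw s True v (Suc k) 0)) \<in> I"
proof -
  let ?t = "d - Suc k" and ?c = "c \<circ> frame sw s v"
  have t: "d - k = Suc ?t" "k + 1 + ?t = d" using k by auto
  note q' = quiet_frame[OF q, of sw s]
  have in0: "\<not> act I ?c ?t (int k - 1, 0)" "\<not> act I ?c ?t (int k, 0)"
    using k by (auto intro!: quiet_act[OF I(1) q'] simp: mdist_def)
  have "count (act I ?c ?t) (int k, 0) = of_bool (act I ?c ?t (int k + 1, 0)) + of_bool (act I ?c ?t (int k, -1))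
     + of_bool (act I ?c ?t (int k, 1))"
    using in0 by (simp add: count_eq)
  also have "act I ?c ?t (int k, 1) = arm c sw s True v d k"
    using act_arm[OF I q k(1) t(2), of sw s True] by (simp add: act_frame off_def)
  also have "act I ?c ?t (int k, -1) = arm c sw s False v d k"
    using act_arm[OF I q k(1) t(2), of sw s False] by (simp add: act_frame off_def)
  also have "act I ?c ?t (int k + 1, 0) = act I c ?t (off sw s True v (Suc k) 0)"
    by (simp add: act_frame off_def add.commute)
  finally have cnt: "count (act I ?c ?t) (int k, 0) = of_bool (act I c ?t (off sw s True v (Suc k) 0)) +
     of_bool (arm c sw s False v d k) + of_bool (arm c sw s True v d k)" .
  have "act I c (d - k) (off sw s True v k 0) \<longleftrightarrow> act I ?c (d - k) (int k, 0)"
    by (simp add: act_frame off_def)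
  also have "\<dots> \<longleftrightarrow> count (act I ?c ?t) (int k, 0) \<in> I"
    unfolding t(1) act_Suc using in0(2) by simp
  finally show ?thesis unfolding cnt by (simp add: add_ac)
qed

lemma arm_end: "\<not> arm c sw s t v d d"
  by (auto simp: arm_def)

text \<open>Where both \<open>A\<close> and \<open>B\<close> hold, the sum is \<open>2\<close> or
  \<open>3\<close> and \<open>s k\<close> is the negation of \<open>s (Suc k)\<close>. Elsewhere the
  sum is at most \<open>2\<close> and \<open>s k\<close> is a plain disjunction. As \<open>A\<close>
  and \<open>B\<close> are antitone, the two regimes are separated by a single position
  \<open>K\<close>, and the value at \<open>1\<close> arises from the one at \<open>Suc K\<close> by
  \<open>K\<close> negations.\<close>

lemma alternation:
  fixes A B s :: "nat \<Rightarrow> bool"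
  assumes A: "\<And>k. A (Suc k) \<Longrightarrow> A k" and B: "\<And>k. B (Suc k) \<Longrightarrow> B k" and d: "\<not> A d" "\<not> B d" "d \<ge> 1"
    and s: "\<And>k. 1 \<le> k \<Longrightarrow> k < d \<Longrightarrow>
      s k \<longleftrightarrow> of_bool (A k) + of_bool (B k) + of_bool (s (Suc k)) \<in> {1, 2 :: nat}"
  shows "1 \<le> k \<Longrightarrow> k \<le> d \<Longrightarrow> \<not> (A k \<and> B k) \<Longrightarrow> s k \<longleftrightarrow> A k \<or> B k \<or> s d"
    and "s 1 \<longleftrightarrow> (\<exists>K<d. (K = 0 \<or> A K \<and> B K) \<and> \<not> (A (Suc K) \<and> B (Suc K)) \<and>
      (A (Suc K) \<or> B (Suc K) \<or> s d) \<noteq> odd K)"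
proof -
  show single: "s k \<longleftrightarrow> A k \<or> B k \<or> s d" if "1 \<le> k" "k \<le> d" "\<not> (A k \<and> B k)" for k
    using that(2,1,3)
  proof (induction k rule: inc_induct)
    case (step k)
    from step s[of k] A[of k] B[of k] show ?case by auto
  qed (use d in auto)
  have *: "s 1 \<longleftrightarrow> (A (Suc K) \<or> B (Suc K) \<or> s d) \<noteq> odd K"
    if K: "K < d" "K = 0 \<or> A K \<and> B K" "\<not> (A (Suc K) \<and> B (Suc K))" for K
  proof -
    have AB: "A (K - j) \<and> B (K - j)" if "j < K" for j
      using that
    proof (induction j)
      case 0 then show ?case using K by auto
    next
      case (Suc j)
      then have "Suc (K - Suc j) = K - j" by simp
      then show ?case using Suc A[of "K - Suc j"] B[of "K - Suc j"] by auto
    qed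
    \<comment> \<open>Walking inwards from \<open>Suc K\<close>, each step negates the state;
      \<open>j = K\<close> arrives at position \<open>1\<close>.\<close>
    have "s (Suc K - j) \<longleftrightarrow> (s (Suc K) \<noteq> odd j)" if "j \<le> K" for j
      using that
    proof (induction j)
      case (Suc j)
      have "s (K - j) \<longleftrightarrow> of_bool (A (K - j)) + of_bool (B (K - j)) + of_bool (s (Suc (K - j))) \<in> {1, 2 :: nat}"
        using Suc.prems K(1) by (intro s) auto
      also have "Suc (K - j) = Suc K - j" using Suc.prems by simp
      finally show ?case using Suc AB[of j] by auto
    qed simp
    from this[of K] have "s 1 \<longleftrightarrow> (s (Suc K) \<noteq> odd K)" by simp
    also have "s (Suc K) \<longleftrightarrow> A (Suc K) \<or> B (Suc K) \<or> s d"
      using K by (intro single) auto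
    finally show ?thesis .
  qed
  \<comment> \<open>\<open>K\<close> exists because both arms are empty at \<open>d\<close>; being
    least, it is \<open>0\<close> or still has both arms.\<close>
  define K where "K = (LEAST K. \<not> (A (Suc K) \<and> B (Suc K)))"
  have ex: "\<not> (A (Suc (d - 1)) \<and> B (Suc (d - 1)))" using d by simp
  have K1: "\<not> (A (Suc K) \<and> B (Suc K))"
    unfolding K_def using ex by (rule LeastI)
  have "K \<le> d - 1"
    unfolding K_def using ex by (rule Least_le)
  then have K2: "K < d" using d(3) by simp
  have K3: "K = 0 \<or> A K \<and> B K"
  proof (cases K)
    case (Suc k)
    then have "k < K" by simp
    from not_less_Least[OF this[unfolded K_def]] Suc show ?thesis by simp
  qed simp
  from *[OF K2 K3 K1] * K1 K2 K3 show "s 1 \<longleftrightarrow> (\<exists>K<d. (K = 0 \<or> A K \<and> B K) \<and> \<not> (A (Suc K) \<and> B (Suc K)) \<and>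
      (A (Suc K) \<or> B (Suc K) \<or> s d) \<noteq> odd K)"
    by blast
qed

definition sum4 :: "(bool \<Rightarrow> bool \<Rightarrow> bool) \<Rightarrow> nat" where
  "sum4 f = of_bool (f False True) + of_bool (f False False) + of_bool (f True True) + of_bool (f True False)"

lemma count_nbr: "count c v = sum4 (\<lambda>sw s. c (nbr sw s v))"
  by (cases v) (simp add: count_eq sum4_def off_def frame_def)

lemma neighbors_nbr: "neighbors v = {nbr sw s v | sw s. True}"
proof -
  have "neighbors v = {nbr False True v, nbr False False v, nbr True True v, nbr True False v}"
    by (cases v) (auto simp: neighbors_eq off_def frame_def)
  also have "\<dots> = {nbr sw s v | sw s. True}"
    by (auto; metis (full_types))
  finally show ?thesis .
qed

lemma neighbors_sym: "u \<in> neighbors v \<longleftrightarrow> v \<in> neighbors u"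
  by (auto simp: neighbors_def)

lemma count_card: "count c u = card {y \<in> neighbors u. c y}"
  by (simp add: count_def finite_neighbors sum.If_cases of_bool_def Int_def)

lemma count_le_4: "count c u \<le> 4"
  unfolding count_card card_neighbors[of u, symmetric] by (intro card_mono finite_neighbors) auto

lemma count_eq_4: "count c u = 4 \<longleftrightarrow> (\<forall>y\<in>neighbors u. c y)"
proof -
  have "card {y \<in> neighbors u. c y} = card (neighbors u) \<longleftrightarrow> {y \<in> neighbors u. c y} = neighbors u"
    using card_subset_eq[OF finite_neighbors, of "{y \<in> neighbors u. c y}" u] by auto
  then show ?thesis by (auto simp: count_card card_neighbors)
qed

lemma count_eq_3:
  assumes "v \<in> neighbors u" "\<not> c v"
  shows "count c u = 3 \<longleftrightarrow> (\<forall>y\<in>neighbors u. y \<noteq> v \<longrightarrow> c y)"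
proof -
  have N: "card (neighbors u - {v}) = 3"
    using assms(1) by (simp add: card_neighbors)
  have "{y \<in> neighbors u. c y} \<subseteq> neighbors u - {v}" using assms by auto
  then have "card {y \<in> neighbors u. c y} = card (neighbors u - {v}) \<longleftrightarrow> {y \<in> neighbors u. c y} = neighbors u - {v}"
    using card_subset_eq[of "neighbors u - {v}"] finite_neighbors by auto
  then show ?thesis using assms by (auto simp: count_card N)
qed

lemma count_eq_0: "count c u = 0 \<longleftrightarrow> (\<forall>y\<in>neighbors u. \<not> c y)"
  by (auto simp: count_def finite_neighbors)

text \<open>\<open>alternation\<close> is applied to the states of the axis positions, each taken at
  its own arrival time \<open>d - k\<close>. The neighbor of \<open>v\<close> is position
  \<open>1\<close>.\<close>

lemma act_not_arms:
  assumes I: "0 \<notin> I" "1 \<in> I" "2 \<in> I" "3 \<notin> I" and q: "quiet c v d" "1 \<le> d"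
  shows "\<not> arms c sw s v d 1 \<Longrightarrow> act I c (d - 1) (nbr sw s v) \<longleftrightarrow> cone c sw s v d 1"
    and "act I c (d - 1) (nbr sw s v) \<longleftrightarrow> sig c sw s v d"
proof -
  define a where "a k = act I c (d - k) (off sw s True v k 0)" for k
  have a: "a k \<longleftrightarrow> of_bool (arm c sw s True v d k) + of_bool (arm c sw s False v d k) +
      of_bool (a (Suc k)) \<in> {1, 2 :: nat}" if "1 \<le> k" "k < d" for k
  proof -
    \<comment> \<open>Only three neighbors can contribute, so rule 124 behaves like rule 12
      here.\<close>
    have I3: "n \<in> I \<longleftrightarrow> n \<in> {1, 2}" if "n \<le> 3" for n
    proof -
      have "n = 0 \<or> n = 1 \<or> n = 2 \<or> n = 3" using that by auto
      then show ?thesis using I by auto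
    qed
    have "of_bool p + of_bool q + of_bool r \<le> (3 :: nat)" for p q r
      by (cases p; cases q; cases r) auto
    then show ?thesis
      using act_axis[OF I(1-3) q(1) that, of sw s] I3 unfolding a_def by blast
  qed
  have ad: "a d = c (off sw s True v d 0)" by (simp add: a_def)
  have anti: "arm c sw s t v d (Suc k) \<Longrightarrow> arm c sw s t v d k" for t k
    by (erule arm_antimono) simp
  note alt = alternation[where A="arm c sw s True v d" and B="arm c sw s False v d" and d=d and s=a,
      OF anti anti arm_end arm_end q(2) a]
  show "act I c (d - 1) (nbr sw s v) \<longleftrightarrow> cone c sw s v d 1" if "\<not> arms c sw s v d 1"
    using alt(1)[where k=1] that q(2) ad by (auto simp: a_def cone_def arms_def)
  show "act I c (d - 1) (nbr sw s v) \<longleftrightarrow> sig c sw s v d"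
    using alt(2) ad by (simp add: a_def cone_def arms_def sig_def)
qed

text \<open>With \<open>3\<close> in the rule, any positive number of the three outer neighbors
  activates an axis cell, so nothing stops the wave on the axis either.\<close>

lemma act_cone:
  assumes I: "0 \<notin> I" "1 \<in> I" "2 \<in> I" "3 \<in> I" and q: "quiet c v d" "1 \<le> d"
  shows "act I c (d - 1) (nbr sw s v) \<longleftrightarrow> cone c sw s v d 1"
proof -
  have "act I c (d - k) (off sw s True v k 0) \<longleftrightarrow> cone c sw s v d k" if "1 \<le> k" "k \<le> d" for k
    using that(2,1)
  proof (induction k rule: inc_induct)
    case base
    then show ?case using arm_end by (simp add: cone_def)
  next
    case (step k)
    have or3: "of_bool p + of_bool q + of_bool r \<in> I \<longleftrightarrow> p \<or> q \<or> r" for p q r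
      using I by (cases p; cases q; cases r) (auto simp: numeral_2_eq_2 numeral_3_eq_3)
    have k: "1 \<le> k" "k < d" using step by auto
    have "act I c (d - k) (off sw s True v k 0) \<longleftrightarrow> arm c sw s True v d k \<or> arm c sw s False v d k \<or>
        act I c (d - Suc k) (off sw s True v (Suc k) 0)"
      unfolding act_axis[OF I(1-3) q(1) k] by (rule or3)
    also have "act I c (d - Suc k) (off sw s True v (Suc k) 0) \<longleftrightarrow> cone c sw s v d (Suc k)"
      by (rule step.IH) simp
    finally show ?case
      using arm_antimono[of c sw s _ v d "Suc k" k] by (auto simp: cone_def)
  qed
  from this[of 1] q(2) show ?thesis by simp
qed

text \<open>By \<open>count_arrivals\<close> this is the number of neighbors of \<open>v\<close>
  active at time \<open>d - 1\<close>, expressed through the initial configuration alone.\<close>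

definition arrivals :: "nat set \<Rightarrow> config \<Rightarrow> cell \<Rightarrow> nat \<Rightarrow> nat" where
  "arrivals I c v d = sum4 (\<lambda>sw s. if 3 \<in> I then cone c sw s v d 1 else sig c sw s v d)"

lemma count_arrivals:
  assumes I: "0 \<notin> I" "1 \<in> I" "2 \<in> I" and q: "quiet c v d" "1 \<le> d"
  shows "count (act I c (d - 1)) v = arrivals I c v d"
  using act_cone[OF I _ q] act_not_arms(2)[OF I _ q] by (cases "3 \<in> I") (simp_all add: count_nbr arrivals_def)

lemma act_arrivals:
  assumes I: "0 \<notin> I" "1 \<in> I" "2 \<in> I" and q: "quiet c v d" "1 \<le> d"
  shows "act I c d v \<longleftrightarrow> arrivals I c v d \<in> I"
proof -
  have "\<not> act I c (d - 1) v"
    using q by (intro quiet_act[OF I(1) q(1)]) (auto simp: mdist_def)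
  then show ?thesis
    using act_Suc[where I=I and c=c and t="d - 1" and u=v] count_arrivals[OF assms] q(2) by (simp del: funpow.simps)
qed

lemma nearest_ex:
  assumes "c z"
  shows "\<exists>d. nearest c v d \<and> int d \<le> mdist v z"
proof -
  let ?P = "\<lambda>d. \<exists>z. mdist v z = int d \<and> c z"
  have m: "mdist v z = int (nat (mdist v z))" for z by (simp add: mdist_def)
  then have P: "?P (nat (mdist v z))" using assms by blast
  have "quiet c v (LEAST d. ?P d)"
    unfolding quiet_def
  proof (intro allI impI notI)
    fix y assume y: "mdist v y < int (LEAST d. ?P d)" "c y"
    then have "nat (mdist v y) < (LEAST d. ?P d)" by (simp add: mdist_def)
    from not_less_Least[OF this] y(2) m show False by blast
  qed
  moreover have "?P (LEAST d. ?P d)" using P by (rule LeastI)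
  moreover have "(LEAST d. ?P d) \<le> nat (mdist v z)" using P by (rule Least_le)
  then have "int (LEAST d. ?P d) \<le> mdist v z" using m[of z] by linarith
  ultimately show ?thesis unfolding nearest_def by blast
qed

lemma nearest_pos: "nearest c v d \<Longrightarrow> \<not> c v \<Longrightarrow> 1 \<le> d"
proof (rule ccontr)
  assume n: "nearest c v d" "\<not> c v" and "\<not> 1 \<le> d"
  then have "d = 0" by simp
  with n(1) obtain z where z: "mdist v z = 0" "c z" by (auto simp: nearest_def)
  then have "z = v" by (auto simp: mdist_def prod_eq_iff)
  then show False using z n by blast
qed

lemma nearest_unique: "nearest c v d \<Longrightarrow> nearest c v d' \<Longrightarrow> d = d'"
  unfolding nearest_def quiet_def by (metis linorder_neqE_nat of_nat_less_iff)

lemma off_abs: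
  "z = off False (fst v \<le> fst z) (snd v \<le> snd z) v (nat \<bar>fst z - fst v\<bar>) (nat \<bar>snd z - snd v\<bar>)"
  by (cases z) (auto simp: off_def frame_def sg_def)

lemma cone_ex:
  assumes "nearest c v d" "1 \<le> d"
  shows "\<exists>sw s. cone c sw s v d 1"
proof -
  obtain z where z: "mdist v z = int d" "c z" using assms(1) by (auto simp: nearest_def)
  let ?x = "nat \<bar>fst z - fst v\<bar>" and ?y = "nat \<bar>snd z - snd v\<bar>"
  have xy: "?x + ?y = d" using z(1) by (simp add: mdist_def)
  consider "?y = 0" | "?x = 0" | "1 \<le> ?x" "1 \<le> ?y" by linarith
  then show ?thesis
  proof cases
    case 1
    then have "off False (fst v \<le> fst z) True v d 0 = z"
      using xy off_abs[of z v] by (simp add: off_def)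
    then have "cone c False (fst v \<le> fst z) v d 1" using z(2) by (simp add: cone_def)
    then show ?thesis by blast
  next
    case 2
    then have "off True (snd v \<le> snd z) True v d 0 = z"
      using xy off_abs[of z v] by (simp add: off_def frame_def)
    then have "cone c True (snd v \<le> snd z) v d 1" using z(2) by (simp add: cone_def)
    then show ?thesis by blast
  next
    case 3
    then have "arm c False (fst v \<le> fst z) (snd v \<le> snd z) v d 1"
      unfolding arm_def using xy z(2) off_abs[of z v] by (metis)
    then show ?thesis unfolding cone_def by (metis (full_types))
  qed
qed

text \<open>For \<open>k = 1\<close> an arm is a whole open quadrant, and a quadrant is adjacent to
  two of the four axes.\<close>

lemma arm_swap: "arm c False s t v d 1 \<longleftrightarrow> arm c True t s v d 1"
proof -
  have "off True t s v x y = off False s t v y x" for x y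
    by (simp add: off_def frame_def)
  then show ?thesis unfolding arm_def by (metis add.commute)
qed

section \<open>Cells missed by the first wave\<close>

text \<open>Both side neighbors of \<open>nbr sw s v\<close> are active by time
  \<open>d - 2\<close>. If it nevertheless stays inactive at time \<open>d - 1\<close>, its count
  cannot have been \<open>2\<close>, so the outer neighbor on the axis was active as well.\<close>

lemma blocked:
  assumes I: "0 \<notin> I" "1 \<in> I" "2 \<in> I" "3 \<notin> I" and q: "quiet c v d"
    and arms: "arms c sw s v d 1" and na: "\<not> act I c (d - 1) (nbr sw s v)"
    and y: "y \<in> neighbors (nbr sw s v)" "y \<noteq> v"
  shows "act I c (d - 1) y"
proof -
  have d: "2 \<le> d" using arms by (auto simp: arms_def arm_def)
  have "neighbors (nbr sw s v) = frame sw s v ` {(0, 0), (2, 0), (1, -1), (1, 1)}"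
    unfolding off_def frame_neighbors by (simp add: neighbors_eq)
  also have "\<dots> = {v, off sw s True v 2 0, off sw s False v 1 1, off sw s True v 1 1}"
    by (simp add: off_def frame_0)
  finally consider "y = off sw s True v 2 0" | "y = off sw s False v 1 1" | "y = off sw s True v 1 1"
    using y by auto
  then have "act I c (d - 2) y"
  proof cases
    case 1
    have "\<not> of_bool True + of_bool True + of_bool (act I c (d - 2) (off sw s True v 2 0)) \<in> I"
      using act_axis[OF I(1-3) q, of 1 sw s] d arms na by (simp add: arms_def numeral_2_eq_2)
    then show ?thesis using 1 I(3) by (cases "act I c (d - 2) (off sw s True v 2 0)") (auto simp: numeral_2_eq_2)
  qed (use act_arm[OF I(1-3) q, of 1 "d - 2" sw s] d arms in \<open>auto simp: arms_def\<close>)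
  then show ?thesis by (rule act_mono) simp
qed

text \<open>A direction hit by the wave fails to deliver only if it is hit from both sides. This
  forces all four directions to be hit from both sides, so by \<open>blocked\<close> each neighbor
  of \<open>v\<close> has its three outer neighbors active. The neighbors then wait for
  \<open>v\<close>, and \<open>v\<close> waits for them.\<close>

lemma zero_blocked:
  assumes I: "0 \<notin> I" "1 \<in> I" "2 \<in> I" "3 \<notin> I" and n: "nearest c v d" "1 \<le> d"
    and 0: "count (act I c (d - 1)) v = 0" and z: "z \<in> insert v (neighbors v)"
  shows "\<not> act I c t z"
proof -
  have q: "quiet c v d" using n(1) by (simp add: nearest_def)
  have na: "\<not> act I c (d - 1) (nbr sw s v)" for sw s
    using 0 unfolding count_eq_0 neighbors_nbr by blast
  have nv: "\<not> act I c (d - 1) v"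
    using n(2) by (intro quiet_act[OF I(1) q]) (auto simp: mdist_def)
  have nc: "\<not> cone c sw s v d 1" if "\<not> arms c sw s v d 1" for sw s
    using act_not_arms(1)[OF I q n(2) that] na by blast
  \<comment> \<open>A direction with both arms shares a quadrant with each of the two perpendicular
    directions. These are therefore hit too and, being inactive, must have both arms; a second turn
    gives all four.\<close>
  have all: "arms c sw s v d 1" for sw s
  proof -
    obtain sw' s' where "arms c sw' s' v d 1" using cone_ex[OF n] nc by blast
    moreover have "arms c True t v d 1" if "arms c False r v d 1" for t r
      using that nc[of True t] arm_swap[of c r t v d]
      by (cases t; cases r) (auto simp: arms_def cone_def)
    moreover have "arms c False t v d 1" if "arms c True r v d 1" for t r
      using that nc[of False t] arm_swap[of c t r v d]
      by (cases t; cases r) (auto simp: arms_def cone_def)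
    ultimately show ?thesis by (metis (full_types))
  qed
  have out: "act I c (d - 1) y" if "y \<in> neighbors x" "y \<noteq> v" "x \<in> neighbors v" for x y
  proof -
    obtain sw s where x: "x = nbr sw s v" using \<open>x \<in> neighbors v\<close> unfolding neighbors_nbr by auto
    show ?thesis using blocked[OF I q all na] that(1,2) unfolding x by blast
  qed
  have 3: "count (act I c (d - 1)) x = 3" if "x \<in> neighbors v" for x
    using count_eq_3[where c="act I c (d - 1)" and u=x, of v] that nv out neighbors_sym by blast
  show ?thesis
  proof (rule deadlock[where T="insert v (neighbors v)" and t="d - 1"])
    show "\<not> act I c (d - 1) x \<and> count (act I c (d - 1)) x \<notin> I" if "x \<in> insert v (neighbors v)" for x
      using that nv 0 3[of x] I count_eq_0[of "act I c (d - 1)" v] by (cases "x = v") simp_all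
    show "y \<in> insert v (neighbors v) \<or> act I c (d - 1) y" if "x \<in> insert v (neighbors v)" "y \<in> neighbors x" for x y
      using that out[of y x] by blast
  qed (fact z)
qed

text \<open>The count never decreases, and no count of \<open>3\<close> or more is in the
  rule.\<close>

lemma never_12:
  assumes "count (act {1, 2} c t) v \<ge> 3" "\<not> act {1, 2} c t v"
  shows "\<not> act {1, 2} c t' v"
proof (cases "t \<le> t'")
  case True
  then show ?thesis
  proof (induction t' rule: dec_induct)
    case (step t')
    have "count (act {1, 2} c t) v \<le> count (act {1, 2} c t') v"
      using step(1) act_mono by (intro count_mono) blast
    then show ?case using step assms(1) by (auto simp: act_Suc simp del: funpow.simps)
  qed (fact assms(2))
next
  case False
  then show ?thesis using assms(2) act_mono[where t=t' and t'=t and I="{1, 2}" and c=c and u=v] by auto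
qed

lemma active_12:
  assumes n: "nearest c v d" and v: "\<not> c v"
  shows "(\<exists>t. act {1, 2} c t v) \<longleftrightarrow> arrivals {1, 2} c v d \<in> {1, 2}"
proof -
  have d: "1 \<le> d" and q: "quiet c v d" using nearest_pos[OF assms] n by (auto simp: nearest_def)
  have nv: "\<not> act {1, 2} c (d - 1) v"
    using d by (intro quiet_act[OF _ q]) (auto simp: mdist_def)
  have cnt: "count (act {1, 2} c (d - 1)) v = arrivals {1, 2} c v d"
    by (rule count_arrivals[OF _ _ _ q d]) auto
  have "\<not> act {1, 2} c t v" if "arrivals {1, 2} c v d = 0" for t
    using zero_blocked[OF _ _ _ _ n d, of "{1, 2}" v] cnt that by auto
  moreover have "\<not> act {1, 2} c t v" if "arrivals {1, 2} c v d \<ge> 3" for t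
    by (rule never_12[OF _ nv]) (use cnt that in simp)
  moreover have "act {1, 2} c d v" if "arrivals {1, 2} c v d \<in> {1, 2}"
    using act_arrivals[OF _ _ _ q d, of "{1, 2}"] that by auto
  moreover have "arrivals {1, 2} c v d = 0 \<or> arrivals {1, 2} c v d \<in> {1, 2} \<or> arrivals {1, 2} c v d \<ge> 3" by auto
  ultimately show ?thesis by blast
qed

lemma active_123:
  assumes n: "nearest c v d" and v: "\<not> c v"
  shows "(\<exists>t. act {1, 2, 3} c t v) \<longleftrightarrow> arrivals {1, 2, 3} c v d \<in> {1, 2, 3}"
proof -
  let ?I = "{1, 2, 3} :: nat set"
  have d: "1 \<le> d" and q: "quiet c v d" using nearest_pos[OF assms] n by (auto simp: nearest_def)
  have nv: "\<not> act ?I c (d - 1) v"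
    using d by (intro quiet_act[OF _ q]) (auto simp: mdist_def)
  have cnt: "count (act ?I c (d - 1)) v = arrivals ?I c v d"
    by (rule count_arrivals[OF _ _ _ q d]) auto
  \<comment> \<open>The nearest active cell lies in some cone, and with \<open>3\<close> in the rule
    every nonempty cone delivers; hence at least one neighbor is active.\<close>
  obtain sw s where "cone c sw s v d 1" using cone_ex[OF n d] by blast
  then have pos: "arrivals ?I c v d \<noteq> 0"
    by (cases sw; cases s) (auto simp: arrivals_def sum4_def)
  \<comment> \<open>With four active neighbors, \<open>v\<close> by itself is a deadlock.\<close>
  have "\<not> act ?I c t v" if "arrivals ?I c v d = 4" for t
  proof (rule deadlock[where T="{v}" and t="d - 1"])
    show "y \<in> {v} \<or> act ?I c (d - 1) y" if "x \<in> {v}" "y \<in> neighbors x" for x y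
      using that cnt \<open>arrivals ?I c v d = 4\<close> count_eq_4 by auto
  qed (use nv cnt that in auto)
  moreover have "act ?I c d v" if "arrivals ?I c v d \<in> ?I"
    using act_arrivals[OF _ _ _ q d, of ?I] that by auto
  moreover have "arrivals ?I c v d \<in> ?I \<or> arrivals ?I c v d = 4"
    using pos count_le_4[of "act ?I c (d - 1)" v] cnt by auto
  ultimately show ?thesis by blast
qed

text \<open>An active cell at distance less than \<open>d\<close> from the neighbor has distance
  exactly \<open>d\<close> from \<open>v\<close> and a positive coordinate in the direction of the
  neighbor, so it would lie in the cone. The upper bound \<open>Suc d\<close> is the triangle
  inequality.\<close>

lemma nearest_behind:
  assumes n: "nearest c v d" "1 \<le> d" and nc: "\<not> cone c sw s v d 1"
  shows "\<exists>d'. nearest c (nbr sw s v) d' \<and> (d' = d \<or> d' = Suc d)"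
proof -
  have nd: "mdist (nbr sw s v) (frame sw s v z) = \<bar>fst z - 1\<bar> + \<bar>snd z\<bar>" for z
    unfolding off_def mdist_frame by (simp add: mdist_def)
  have vd: "mdist v (frame sw s v z) = \<bar>fst z\<bar> + \<bar>snd z\<bar>" for z
    using mdist_frame[of sw s v "(0, 0)" z] by (simp add: frame_0 mdist_def)
  obtain z where z: "mdist v (frame sw s v z) = int d" "c (frame sw s v z)"
    using n(1) surj_frame[where sw=sw and s=s and v=v] by (metis nearest_def)
  obtain d' where d': "nearest c (nbr sw s v) d'" "int d' \<le> mdist (nbr sw s v) (frame sw s v z)"
    using nearest_ex[of c "frame sw s v z", OF z(2)] by blast
  have "int d' \<le> int d + 1" using d'(2) z(1) unfolding nd vd by linarith
  moreover have "int d \<le> int d'"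
  proof (rule ccontr)
    assume less: "\<not> int d \<le> int d'"
    obtain y where y: "mdist (nbr sw s v) (frame sw s v y) = int d'" "c (frame sw s v y)"
      using d'(1) surj_frame[where sw=sw and s=s and v=v] by (metis nearest_def)
    have "int d \<le> mdist v (frame sw s v y)"
      using n(1) y(2) by (metis nearest_def quiet_def not_less)
    then have y1: "1 \<le> fst y" "fst y + \<bar>snd y\<bar> = int d"
      using y(1) less unfolding nd vd by linarith+
    let ?x = "nat (fst y)" and ?y = "nat \<bar>snd y\<bar>" and ?t = "0 \<le> snd y"
    have eq: "off sw s ?t v ?x ?y = frame sw s v y"
      using y1 by (cases y) (auto simp: off_def sg_def)
    show False
    proof (cases "snd y = 0")
      case True
      then have "c (off sw s True v d 0)" using eq y(2) y1 by (simp add: off_def)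
      then show False using nc by (simp add: cone_def)
    next
      case False
      then have "arm c sw s ?t v d 1"
        unfolding arm_def using y1 y(2) eq by (intro exI[of _ ?x] exI[of _ ?y]) auto
      then show False using nc unfolding cone_def by (metis (full_types))
    qed
  qed
  ultimately show ?thesis using d'(1) by auto
qed

text \<open>The critical case is three arrivals. Then exactly one neighbor \<open>?F\<close> is
  inactive, and \<open>v\<close> becomes active if and only if \<open>?F\<close> ever does, which
  completes the count \<open>4\<close>. Whether \<open>?F\<close> does is decided by its own first
  arrival, unless \<open>v\<close> and \<open>?F\<close> block each other.\<close>

lemma active_124:
  assumes n: "nearest c v d" and v: "\<not> c v"
  shows "(\<exists>t. act {1, 2, 4} c t v) \<longleftrightarrow> arrivals {1, 2, 4} c v d \<in> {1, 2, 4} \<or>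
    arrivals {1, 2, 4} c v d = 3 \<and> (\<exists>sw s. \<not> sig c sw s v d \<and>
      (\<exists>d'. nearest c (nbr sw s v) d' \<and> arrivals {1, 2, 4} c (nbr sw s v) d' \<in> {1, 2, 4}))"
proof -
  let ?I = "{1, 2, 4} :: nat set"
  have I: "0 \<notin> ?I" "1 \<in> ?I" "2 \<in> ?I" "3 \<notin> ?I" by auto
  have d: "1 \<le> d" and q: "quiet c v d" using nearest_pos[OF assms] n by (auto simp: nearest_def)
  have nv: "\<not> act ?I c (d - 1) v"
    using d by (intro quiet_act[OF I(1) q]) (auto simp: mdist_def)
  have cnt: "count (act ?I c (d - 1)) v = arrivals ?I c v d"
    by (rule count_arrivals[OF I(1-3) q d])
  note sig = act_not_arms(2)[OF I q d]
  have "arrivals ?I c v d \<le> 4" using count_le_4[of "act ?I c (d - 1)" v] cnt by simp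
  then consider "arrivals ?I c v d \<in> ?I" | "arrivals ?I c v d = 0" | "arrivals ?I c v d = 3"
    by fastforce
  then show ?thesis
  proof cases
    case 1
    then have "act ?I c d v" using act_arrivals[OF I(1-3) q d] by auto
    then show ?thesis using 1 by blast
  next
    case 2
    then have "\<not> act ?I c t v" for t
      using zero_blocked[OF I n d, of v] cnt by auto
    then show ?thesis using 2 by auto
  next
    case 3
    obtain sw s where F: "\<not> act ?I c (d - 1) (nbr sw s v)"
      using 3 cnt count_eq_4[of "act ?I c (d - 1)" v] unfolding neighbors_nbr by auto
    let ?F = "nbr sw s v"
    have Fv: "?F \<in> neighbors v" unfolding neighbors_nbr by auto
    then have vF: "v \<in> neighbors ?F" by (simp add: neighbors_sym)
    have rest: "act ?I c (d - 1) y" if "y \<in> neighbors v" "y \<noteq> ?F" for y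
      using count_eq_3[where c="act ?I c (d - 1)" and u=v and v="?F"] Fv F 3 cnt that by auto
    have cF: "\<not> c ?F" using F act_mono[where t=0 and t'="d - 1" and I="?I" and c=c and u="?F"] by auto
    \<comment> \<open>By \<open>sig\<close>, the directions without \<open>sig\<close> are those
      inactive at time \<open>d - 1\<close>. So the existential quantifier over directions in the
      statement selects \<open>?F\<close>.\<close>
    have uniq: "nbr sw' s' v = ?F" if "\<not> sig c sw' s' v d" for sw' s'
      using rest[of "nbr sw' s' v"] sig[of sw' s'] that unfolding neighbors_nbr by auto
    \<comment> \<open>Both cells have three active neighbors and only each other missing, a deadlock
      since \<open>3\<close> is not in the rule.\<close>
    have pair: "\<not> act ?I c t' v"
      if "d - 1 \<le> t" "\<not> act ?I c t v" "\<not> act ?I c t ?F" "count (act ?I c t) ?F = 3" for t t'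
    proof -
      have rest': "act ?I c t y" if "y \<in> neighbors v" "y \<noteq> ?F" for y
        using rest[OF that] \<open>d - 1 \<le> t\<close> by (rule act_mono)
      have "count (act ?I c t) v = 3"
        using count_eq_3[where c="act ?I c t" and u=v and v="?F"] Fv rest' that(3) by auto
      moreover have "act ?I c t y" if "y \<in> neighbors ?F" "y \<noteq> v" for y
        using count_eq_3[where c="act ?I c t" and u="?F" and v=v] vF \<open>\<not> act ?I c t v\<close> \<open>count (act ?I c t) ?F = 3\<close> that
        by auto
      ultimately show ?thesis
        using that rest' by (intro deadlock[where T="{v, ?F}" and t=t]) auto
    qed
    have v_late: "\<not> act ?I c d v" using act_arrivals[OF I(1-3) q d] 3 by auto
    have "(\<exists>t. act ?I c t v) \<longleftrightarrow> (\<exists>d'. nearest c ?F d' \<and> arrivals ?I c ?F d' \<in> ?I)"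
    proof
      assume "\<exists>d'. nearest c ?F d' \<and> arrivals ?I c ?F d' \<in> ?I"
      then obtain d' where d': "nearest c ?F d'" "arrivals ?I c ?F d' \<in> ?I" by blast
      then have "act ?I c d' ?F"
        using act_arrivals[OF I(1-3) _ nearest_pos[OF d'(1) cF]] by (auto simp: nearest_def)
      then have "\<forall>y\<in>neighbors v. act ?I c (max d (d')) y"
        using rest act_mono[where t="d - 1" and t'="max d d'"] act_mono[where t="d'" and t'="max d d'"]
        by (metis max.cobounded1 max.cobounded2 diff_le_self order.trans)
      then have "act ?I c (Suc (max d d')) v"
        unfolding act_Suc count_eq_4[symmetric] by auto
      then show "\<exists>t. act ?I c t v" by blast
    next
      assume t: "\<exists>t. act ?I c t v"
      \<comment> \<open>If \<open>?F\<close> was hit from both sides and stayed inactive, its three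
        outer neighbors are active and the pair is already locked, contrary to the assumed
        activation of \<open>v\<close>.\<close>
      have "\<not> arms c sw s v d 1"
      proof
        assume "arms c sw s v d 1"
        from blocked[OF I q this F] have "count (act ?I c (d - 1)) ?F = 3"
          using count_eq_3[where c="act ?I c (d - 1)" and u="?F" and v=v] vF nv by auto
        from pair[OF order_refl nv F this] t show False by blast
      qed
      then have "\<not> cone c sw s v d 1" using act_not_arms(1)[OF I q d] F by blast
      from nearest_behind[OF n d this] obtain d' where
        d': "nearest c ?F d'" "d' = d \<or> d' = Suc d" by blast
      have pos: "1 \<le> d'" using nearest_pos[OF d'(1) cF] .
      have q': "quiet c ?F d'" using d'(1) by (simp add: nearest_def)
      have cnt': "count (act ?I c (d' - 1)) ?F = arrivals ?I c ?F d'"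
        by (rule count_arrivals[OF I(1-3) q' pos])
      \<comment> \<open>Here the bound on \<open>d'\<close> matters: \<open>d' - 1\<close> is at
        most \<open>d\<close>, and \<open>v\<close> is inactive up to that time.\<close>
      have nv': "\<not> act ?I c (d' - 1) v" using d'(2) nv v_late by auto
      have nF': "\<not> act ?I c (d' - 1) ?F"
        using pos by (intro quiet_act[OF I(1) q']) (auto simp: mdist_def)
      \<comment> \<open>No arrival at \<open>?F\<close> would freeze \<open>?F\<close> with all its
        neighbors, among them \<open>v\<close>. Three arrivals, excluded next, would lock the pair
        at time \<open>d' - 1\<close>.\<close>
      have "arrivals ?I c ?F d' \<noteq> 0"
      proof
        assume "arrivals ?I c ?F d' = 0"
        from zero_blocked[OF I d'(1) pos, unfolded cnt', OF this, of v] vF t show False by blast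
      qed
      moreover have "arrivals ?I c ?F d' \<noteq> 3"
      proof
        assume "arrivals ?I c ?F d' = 3"
        from pair[OF _ nv' nF', unfolded cnt', OF _ this] d'(2) t show False by auto
      qed
      moreover have "arrivals ?I c ?F d' \<le> 4" using count_le_4[of "act ?I c (d' - 1)" ?F] cnt' by simp
      ultimately have "arrivals ?I c ?F d' \<in> ?I" by fastforce
      with d'(1) show "\<exists>d'. nearest c ?F d' \<and> arrivals ?I c ?F d' \<in> ?I" by blast
    qed
    moreover have nsig: "\<not> sig c sw s v d" using F sig by blast
    moreover have "X ?F \<longleftrightarrow> (\<exists>sw s. \<not> sig c sw s v d \<and> X (nbr sw s v))" for X
      using uniq nsig by metis
    note this[of "\<lambda>y. \<exists>d'. nearest c y d' \<and> arrivals ?I c y d' \<in> ?I"]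
    ultimately show ?thesis using 3 by simp
  qed
qed

lemma active_nowhere:
  assumes "0 \<notin> I" "\<forall>z. \<not> c z"
  shows "\<not> act I c t v"
  using assms by (intro quiet_act[of I c v "Suc t"]) (auto simp: quiet_def mdist_def)

text \<open>One criterion for all three rules: the condition \<open>4 \<in> I\<close> switches the
  additional clause on for rule 124 only. If there is no active cell at all, no distance
  \<open>d\<close> exists and both sides are false.\<close>

lemma active_iff:
  assumes I: "I = {1, 2} \<or> I = {1, 2, 3} \<or> I = {1, 2, 4}" and v: "\<not> c v"
  shows "(\<exists>t. act I c t v) \<longleftrightarrow> (\<exists>d. nearest c v d \<and> (arrivals I c v d \<in> I \<or>
    4 \<in> I \<and> arrivals I c v d = 3 \<and> (\<exists>sw s. \<not> sig c sw s v d \<and>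
      (\<exists>d'. nearest c (nbr sw s v) d' \<and> arrivals I c (nbr sw s v) d' \<in> I))))"
proof (cases "\<exists>z. c z")
  case True
  then obtain d where d: "nearest c v d" using nearest_ex by blast
  have ex1: "(\<exists>d'. nearest c v d' \<and> P d') \<longleftrightarrow> P d" for P using d nearest_unique by blast
  have 4: "(4 :: nat) \<notin> {1, 2}" "(4 :: nat) \<notin> {1, 2, 3}" "(4 :: nat) \<in> {1, 2, 4}" by auto
  from I consider (a) "I = {1, 2}" | (b) "I = {1, 2, 3}" | (c) "I = {1, 2, 4}" by blast
  then show ?thesis
  proof cases
    case a
    show ?thesis unfolding ex1 a active_12[OF d v] using 4 by blast
  next
    case b
    show ?thesis unfolding ex1 b active_123[OF d v] using 4 by blast
  next
    case c
    show ?thesis unfolding ex1 c active_124[OF d v] using 4 by blast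
  qed
next
  case False
  then have "\<not> nearest c v d" for d by (auto simp: nearest_def)
  moreover have "\<not> act I c t v" for t
    using I False by (intro active_nowhere) auto
  ultimately show ?thesis by blast
qed

section \<open>Definability\<close>

text \<open>Definability is treated semantically, so that formulas need not be written out: the
  closure rules below follow the syntax of HOL propositions, with \<open>e i\<close> standing for
  variable \<open>i\<close>.\<close>

definition fo :: "(bool list \<Rightarrow> (nat \<Rightarrow> nat) \<Rightarrow> bool) \<Rightarrow> bool" where
  "fo P \<longleftrightarrow> (\<exists>f. \<forall>w e. (\<forall>v. e v < dom_size w) \<longrightarrow> (fval w e f \<longleftrightarrow> P w e))"

definition fot :: "(bool list \<Rightarrow> (nat \<Rightarrow> nat) \<Rightarrow> nat) \<Rightarrow> bool" where
  "fot T \<longleftrightarrow> (\<exists>t. \<forall>w e. tval w e t = T w e)"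

lemma fotI: "(\<And>w e. tval w e t = T w e) \<Longrightarrow> fot T"
  unfolding fot_def by blast

lemma foI: "(\<And>w e. (\<And>v. e v < dom_size w) \<Longrightarrow> fval w e f \<longleftrightarrow> P w e) \<Longrightarrow> fo P"
  unfolding fo_def by blast

lemma foE:
  assumes "fo P"
  obtains f where "\<forall>w e. (\<forall>v. e v < dom_size w) \<longrightarrow> (fval w e f \<longleftrightarrow> P w e)"
  using assms unfolding fo_def by blast

lemma fot_var: "fot (\<lambda>w e. e i)"
  by (rule fotI[of "V i"]) simp

lemma fot_length: "fot (\<lambda>w e. length w)"
  by (rule fotI[of Len]) simp

lemma fot_const: "fot (\<lambda>w e. c)"
  by (rule fotI[of "Num c"]) simp

lemma fot_add:
  assumes "fot T" "fot U"
  shows "fot (\<lambda>w e. T w e + U w e)"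
proof -
  from assms obtain t u where "\<And>w e. tval w e t = T w e" "\<And>w e. tval w e u = U w e"
    unfolding fot_def by blast
  then show ?thesis by (intro fotI[of "Plus t u"]) simp
qed

lemma fot_mult: "fot (\<lambda>w e. e i * e j)"
  by (rule fotI[of "Times i j"]) simp

lemma fo_le:
  assumes "fot T" "fot U"
  shows "fo (\<lambda>w e. T w e \<le> U w e)"
proof -
  from assms obtain t u where "\<And>w e. tval w e t = T w e" "\<And>w e. tval w e u = U w e"
    unfolding fot_def by blast
  then show ?thesis by (intro foI[of "Le t u"]) simp
qed

lemma fo_bit:
  assumes "fot T"
  shows "fo (\<lambda>w e. bit_at w (T w e))"
proof -
  from assms obtain t where "\<And>w e. tval w e t = T w e"
    unfolding fot_def by blast
  then show ?thesis by (intro foI[of "Bit t"]) simp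
qed

lemma fo_not:
  assumes "fo P"
  shows "fo (\<lambda>w e. \<not> P w e)"
proof -
  from assms obtain f where "\<forall>w e. (\<forall>v. e v < dom_size w) \<longrightarrow> (fval w e f \<longleftrightarrow> P w e)"
    by (rule foE)
  then show ?thesis by (intro foI[of "Neg f"]) simp
qed

lemma fo_conj:
  assumes "fo P" "fo Q"
  shows "fo (\<lambda>w e. P w e \<and> Q w e)"
proof -
  from assms(1) obtain f where "\<forall>w e. (\<forall>v. e v < dom_size w) \<longrightarrow> (fval w e f \<longleftrightarrow> P w e)"
    by (rule foE)
  moreover from assms(2) obtain g where "\<forall>w e. (\<forall>v. e v < dom_size w) \<longrightarrow> (fval w e g \<longleftrightarrow> Q w e)"
    by (rule foE)
  ultimately show ?thesis by (intro foI[of "And f g"]) simp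
qed

lemma fo_disj: "fo P \<Longrightarrow> fo Q \<Longrightarrow> fo (\<lambda>w e. P w e \<or> Q w e)"
  using fo_not[OF fo_conj[OF fo_not fo_not], of P Q] by simp

lemma fo_imp: "fo P \<Longrightarrow> fo Q \<Longrightarrow> fo (\<lambda>w e. P w e \<longrightarrow> Q w e)"
  using fo_disj[OF fo_not, of P Q] by simp

lemma fo_iff:
  assumes "fo P" "fo Q"
  shows "fo (\<lambda>w e. P w e \<longleftrightarrow> Q w e)"
proof -
  have "(\<lambda>w e. P w e \<longleftrightarrow> Q w e) = (\<lambda>w e. (P w e \<longrightarrow> Q w e) \<and> (Q w e \<longrightarrow> P w e))"
    by blast
  then show ?thesis using assms by (simp only: fo_conj fo_imp)
qed

lemma fo_less: "fot T \<Longrightarrow> fot U \<Longrightarrow> fo (\<lambda>w e. T w e < U w e)"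
  using fo_not[OF fo_le, of U T] by (simp add: not_le)

lemma fo_eq:
  assumes "fot T" "fot U"
  shows "fo (\<lambda>w e. T w e = U w e)"
proof -
  have "(\<lambda>w e. T w e = U w e) = (\<lambda>w e. T w e \<le> U w e \<and> U w e \<le> T w e)"
    by (intro ext) auto
  then show ?thesis using assms by (simp only: fo_conj fo_le)
qed

lemma fo_const: "fo (\<lambda>w e. b)"
proof (cases b)
  case True
  then show ?thesis by (intro foI[of "Le Len Len"]) simp
next
  case False
  then show ?thesis by (intro foI[of "Neg (Le Len Len)"]) simp
qed

lemma fo_if: "(b \<Longrightarrow> fo P) \<Longrightarrow> (\<not> b \<Longrightarrow> fo Q) \<Longrightarrow> fo (\<lambda>w e. if b then P w e else Q w e)"
  by (cases b) simp_all

text \<open>Flags of type \<open>bool\<close> are not variables of the logic; quantifiers over them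
  are expanded into disjunctions.\<close>

lemma fo_ex_bool: "(\<And>b :: bool. fo (P b)) \<Longrightarrow> fo (\<lambda>w e. \<exists>b. P b w e)"
  using fo_disj[of "P True" "P False"] by (simp add: ex_bool_eq)

text \<open>The premise is the body in de Bruijn form: \<open>e 0\<close> is the bound variable and
  the old environment is shifted by one.\<close>

lemma fo_ex:
  assumes "fo (\<lambda>w e. P w (\<lambda>n. e (Suc n)) (e 0))"
  shows "fo (\<lambda>w e. \<exists>x<dom_size w. P w e x)"
proof -
  from assms obtain f where
    f: "\<forall>w e. (\<forall>v. e v < dom_size w) \<longrightarrow> (fval w e f \<longleftrightarrow> P w (\<lambda>n. e (Suc n)) (e 0))"
    by (rule foE)
  show ?thesis
  proof (rule foI[of "Ex f"])
    fix w and e :: "nat \<Rightarrow> nat"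
    assume e: "\<And>v. e v < dom_size w"
    have "fval w (case_nat x e) f \<longleftrightarrow> P w e x" if "x < dom_size w" for x
      using f[rule_format, of "case_nat x e" w] e that by (simp split: nat.splits)
    then show "fval w e (Ex f) \<longleftrightarrow> (\<exists>x<dom_size w. P w e x)"
      by auto
  qed
qed

lemma fo_all:
  assumes "fo (\<lambda>w e. P w (\<lambda>n. e (Suc n)) (e 0))"
  shows "fo (\<lambda>w e. \<forall>x<dom_size w. P w e x)"
  using fo_not[OF fo_ex[OF fo_not[OF assms]]] by simp

lemmas fo_intros = fot_var fot_length fot_add fot_mult fot_const
  fo_conj fo_disj fo_imp fo_not fo_less fo_le fo_eq fo_iff fo_bit fo_if fo_ex fo_all fo_ex_bool fo_const

lemma tclosed_mono: "tclosed k t \<Longrightarrow> k \<le> k' \<Longrightarrow> tclosed k' t"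
  by (induction t) auto

lemma fclosed_mono: "fclosed k f \<Longrightarrow> k \<le> k' \<Longrightarrow> fclosed k' f"
  by (induction f arbitrary: k k') (auto intro: tclosed_mono)

lemma ex_tclosed: "\<exists>k. tclosed k t"
proof (induction t)
  case (Plus t u)
  then obtain k l where "tclosed k t" "tclosed l u" by blast
  then have "tclosed (max k l) (Plus t u)" by (auto intro: tclosed_mono)
  then show ?case by blast
next
  case (Times u v)
  have "tclosed (Suc (max u v)) (Times u v)" by auto
  then show ?case by blast
qed auto

lemma ex_fclosed: "\<exists>k. fclosed k f"
proof (induction f)
  case (Le t u)
  obtain k l where "tclosed k t" "tclosed l u" using ex_tclosed by blast
  then have "fclosed (max k l) (Le t u)" by (auto intro: tclosed_mono)
  then show ?case by blast
next
  case (And f g)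
  then obtain k l where "fclosed k f" "fclosed l g" by blast
  then have "fclosed (max k l) (And f g)" by (auto intro: fclosed_mono)
  then show ?case by blast
next
  case (Ex f)
  then obtain k where "fclosed k f" by blast
  then have "fclosed k (Ex f)" by (auto intro: fclosed_mono)
  then show ?case by blast
qed (use ex_tclosed in auto)

text \<open>The formula behind \<open>P\<close> may contain free variables. They are bound by
  vacuous existential quantifiers, which preserves the meaning because \<open>P\<close> ignores the
  environment and the range is not empty.\<close>

theorem fo_NC:
  assumes "fo (\<lambda>w e. P w)"
  shows "{w. P w} \<in> NC"
proof -
  obtain f where f: "\<forall>w e. (\<forall>v. e v < dom_size w) \<longrightarrow> (fval w e f \<longleftrightarrow> P w)"
    using assms by (rule foE)
  obtain k where k: "fclosed k f" using ex_fclosed by blast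
  have B: "dom_size w > 0" for w by (simp add: dom_size_def)
  have val: "(\<And>v. e v < dom_size w) \<Longrightarrow> fval w e ((Ex ^^ j) f) \<longleftrightarrow> P w" for j w e
  proof (induction j arbitrary: e)
    case (Suc j)
    have "fval w (case_nat x e) ((Ex ^^ j) f) \<longleftrightarrow> P w" if "x < dom_size w" for x
      using Suc.prems that by (intro Suc.IH) (simp split: nat.splits)
    then show ?case using B[of w] by auto
  qed (use f in simp)
  have closed: "fclosed j g \<Longrightarrow> fclosed 0 ((Ex ^^ j) g)" for j g
    by (induction j arbitrary: g) (auto simp: funpow_swap1)
  have "{w. fval w (\<lambda>_. 0) ((Ex ^^ k) f)} \<in> NC"
    by (rule first_order_NC[OF closed[OF k]])
  then show ?thesis using val B by simp
qed

section \<open>Stability as a first-order property\<close>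

text \<open>In \<open>shifted\<close> and the following definitions cells are given by their coordinates modulo \<open>n\<close>, so that
  only numbers below \<open>dom_size w\<close> occur. All arguments have to be variables; hence the flag
  \<open>strict\<close>, which replaces \<open>k\<close> by \<open>k + 1\<close>.\<close>

definition shifted :: "bool \<Rightarrow> nat \<Rightarrow> nat \<Rightarrow> nat \<Rightarrow> nat \<Rightarrow> bool" where
  "shifted s n a p a' \<longleftrightarrow> a' < n \<and> (if s then a + p = a' \<or> a + p = a' + n else a' + p = a \<or> a' + p = a + n)"

definition wcell :: "bool list \<Rightarrow> nat \<Rightarrow> bool \<Rightarrow> bool \<Rightarrow> nat \<Rightarrow> nat \<Rightarrow> nat \<Rightarrow> nat \<Rightarrow> bool" where
  "wcell w n s t a b p q \<longleftrightarrow> (\<exists>i<dom_size w. \<exists>j<dom_size w. shifted s n a p i \<and> shifted t n b q j \<and> bit_at w (i * n + j))"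

definition woff :: "bool list \<Rightarrow> nat \<Rightarrow> bool \<Rightarrow> bool \<Rightarrow> bool \<Rightarrow> nat \<Rightarrow> nat \<Rightarrow> nat \<Rightarrow> nat \<Rightarrow> bool" where
  "woff w n sw s t a b x y \<longleftrightarrow> (if sw then wcell w n t s a b y x else wcell w n s t a b x y)"

definition warm :: "bool list \<Rightarrow> nat \<Rightarrow> bool \<Rightarrow> bool \<Rightarrow> bool \<Rightarrow> nat \<Rightarrow> nat \<Rightarrow> nat \<Rightarrow> bool \<Rightarrow> nat \<Rightarrow> bool" where
  "warm w n sw s t a b d strict k \<longleftrightarrow> (\<exists>x<dom_size w. \<exists>y<dom_size w.
     (if strict then k < x else k \<le> x) \<and> 1 \<le> y \<and> x + y = d \<and> woff w n sw s t a b x y)"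

text \<open>Corresponds to \<open>cone\<close> at \<open>Suc k\<close>, because the arms are strict;
  the neighbor of the cell is therefore obtained with \<open>k = 0\<close>.\<close>

definition wcone :: "bool list \<Rightarrow> nat \<Rightarrow> bool \<Rightarrow> bool \<Rightarrow> nat \<Rightarrow> nat \<Rightarrow> nat \<Rightarrow> nat \<Rightarrow> bool" where
  "wcone w n sw s a b d k \<longleftrightarrow> warm w n sw s True a b d True k \<or> warm w n sw s False a b d True k \<or>
     (\<exists>z<dom_size w. z = 0 \<and> woff w n sw s True a b d z)"

definition wsig :: "bool list \<Rightarrow> nat \<Rightarrow> bool \<Rightarrow> bool \<Rightarrow> nat \<Rightarrow> nat \<Rightarrow> nat \<Rightarrow> bool" where
  "wsig w n sw s a b d \<longleftrightarrow> (\<exists>K<dom_size w. K < d \<and>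
     (K = 0 \<or> warm w n sw s True a b d False K \<and> warm w n sw s False a b d False K) \<and>
     \<not> (warm w n sw s True a b d True K \<and> warm w n sw s False a b d True K) \<and>
     \<not> (wcone w n sw s a b d K \<longleftrightarrow> (\<exists>h<dom_size w. K = h + h + 1)))"

definition wfires :: "nat set \<Rightarrow> bool list \<Rightarrow> nat \<Rightarrow> bool \<Rightarrow> bool \<Rightarrow> nat \<Rightarrow> nat \<Rightarrow> nat \<Rightarrow> bool" where
  "wfires I w n sw s a b d \<longleftrightarrow>
     (if 3 \<in> I then \<exists>z<dom_size w. z = 0 \<and> wcone w n sw s a b d z else wsig w n sw s a b d)"

definition warrivals :: "nat set \<Rightarrow> nat set \<Rightarrow> bool list \<Rightarrow> nat \<Rightarrow> nat \<Rightarrow> nat \<Rightarrow> nat \<Rightarrow> bool" where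
  "warrivals N I w n a b d \<longleftrightarrow> sum4 (\<lambda>sw s. wfires I w n sw s a b d) \<in> N"

text \<open>The bound \<open>n\<close> keeps all offsets within a single wrap-around, which is all
  that \<open>shifted\<close> provides for. By periodicity it loses nothing, see
  \<open>nearest_le\<close>.\<close>

definition wnearest :: "bool list \<Rightarrow> nat \<Rightarrow> nat \<Rightarrow> nat \<Rightarrow> nat \<Rightarrow> bool" where
  "wnearest w n a b d \<longleftrightarrow> d \<le> n \<and>
     (\<exists>s t. \<exists>x<dom_size w. \<exists>y<dom_size w. x + y = d \<and> woff w n False s t a b x y) \<and>
     \<not> (\<exists>s t. \<exists>x<dom_size w. \<exists>y<dom_size w. x + y < d \<and> woff w n False s t a b x y)"

definition wnbr :: "bool list \<Rightarrow> nat \<Rightarrow> bool \<Rightarrow> bool \<Rightarrow> nat \<Rightarrow> nat \<Rightarrow> nat \<Rightarrow> nat \<Rightarrow> bool" where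
  "wnbr w n sw s a b a' b' \<longleftrightarrow> (\<exists>z<dom_size w. \<exists>u<dom_size w. z = 0 \<and> u = 1 \<and>
     (if sw then shifted True n a z a' \<and> shifted s n b u b' else shifted s n a u a' \<and> shifted True n b z b'))"

definition wactive :: "nat set \<Rightarrow> bool list \<Rightarrow> nat \<Rightarrow> nat \<Rightarrow> nat \<Rightarrow> bool" where
  "wactive I w n a b \<longleftrightarrow> (\<exists>d<dom_size w. wnearest w n a b d \<and> (warrivals I I w n a b d \<or>
     4 \<in> I \<and> warrivals {3} I w n a b d \<and> (\<exists>sw s. \<not> wsig w n sw s a b d \<and>
       (\<exists>a'<dom_size w. \<exists>b'<dom_size w. wnbr w n sw s a b a' b' \<and>
         (\<exists>d'<dom_size w. wnearest w n a' b' d' \<and> warrivals I I w n a' b' d')))))"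

text \<open>Besides stability this checks that the word is an encoding at all: its length must be
  twice a square, and the second table must have exactly one entry set.\<close>

definition wstable :: "nat set \<Rightarrow> bool list \<Rightarrow> bool" where
  "wstable I w \<longleftrightarrow> (\<exists>n<dom_size w. \<exists>a<dom_size w. \<exists>b<dom_size w. a < n \<and> b < n \<and>
     length w = n * n + n * n \<and> bit_at w (n * n + (a * n + b)) \<and>
     (\<forall>i<dom_size w. \<forall>j<dom_size w. i < n \<and> j < n \<and> bit_at w (n * n + (i * n + j)) \<longrightarrow> i = a \<and> j = b) \<and>
     \<not> bit_at w (a * n + b) \<and> \<not> wactive I w n a b)"

lemma fo_wcell: "fo (\<lambda>w e. wcell w (e n) s t (e a) (e b) (e p) (e q))"
  unfolding wcell_def shifted_def by (intro fo_intros)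

lemma fo_woff: "fo (\<lambda>w e. woff w (e n) sw s t (e a) (e b) (e x) (e y))"
  unfolding woff_def by (intro fo_intros fo_wcell)

lemma fo_warm: "fo (\<lambda>w e. warm w (e n) sw s t (e a) (e b) (e d) strict (e k))"
  unfolding warm_def by (intro fo_intros fo_woff)

lemma fo_wcone: "fo (\<lambda>w e. wcone w (e n) sw s (e a) (e b) (e d) (e k))"
  unfolding wcone_def by (intro fo_intros fo_woff fo_warm)

lemma fo_wsig: "fo (\<lambda>w e. wsig w (e n) sw s (e a) (e b) (e d))"
  unfolding wsig_def by (intro fo_intros fo_warm fo_wcone)

lemma fo_wfires: "fo (\<lambda>w e. wfires I w (e n) sw s (e a) (e b) (e d))"
  unfolding wfires_def by (intro fo_intros fo_wcone fo_wsig)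

text \<open>Any Boolean function \<open>F\<close> is a finite disjunction over the sixteen patterns
  of truth values; this covers conditions on the number of active neighbors.\<close>

lemma fo_bool4:
  assumes "fo P" "fo Q" "fo R" "fo S"
  shows "fo (\<lambda>w e. F (P w e) (Q w e) (R w e) (S w e))"
proof -
  have one: "fo (\<lambda>w e. (p \<longleftrightarrow> P w e) \<and> (q \<longleftrightarrow> Q w e) \<and> (r \<longleftrightarrow> R w e) \<and> (s \<longleftrightarrow> S w e) \<and> F p q r s)" for p q r s
    using assms by (intro fo_intros)
  have "fo (\<lambda>w e. \<exists>p q r s. (p \<longleftrightarrow> P w e) \<and> (q \<longleftrightarrow> Q w e) \<and> (r \<longleftrightarrow> R w e) \<and> (s \<longleftrightarrow> S w e) \<and> F p q r s)"
    by (intro fo_ex_bool one)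
  then show ?thesis by simp
qed

lemma fo_warrivals: "fo (\<lambda>w e. warrivals N I w (e n) (e a) (e b) (e d))"
  unfolding warrivals_def sum4_def by (rule fo_bool4) (rule fo_wfires)+

lemma fo_wnearest: "fo (\<lambda>w e. wnearest w (e n) (e a) (e b) (e d))"
  unfolding wnearest_def by (intro fo_intros fo_woff)

lemma fo_wnbr: "fo (\<lambda>w e. wnbr w (e n) sw s (e a) (e b) (e a') (e b'))"
  unfolding wnbr_def shifted_def by (intro fo_intros)

lemma fo_wactive: "fo (\<lambda>w e. wactive I w (e n) (e a) (e b))"
  unfolding wactive_def by (intro fo_intros fo_wnearest fo_warrivals fo_wsig fo_wnbr)

lemma fo_wstable: "fo (\<lambda>w e. wstable I w)"
  unfolding wstable_def by (intro fo_intros fo_wactive)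

text \<open>With the residue below \<open>n\<close> and \<open>p\<close> at most \<open>n\<close>,
  sum and difference lie between \<open>- n\<close> and \<open>2 * n - 1\<close>, so adding or
  subtracting \<open>n\<close> at most once gives the residue.\<close>

lemma shifted_iff:
  assumes "v mod int n = int a" "p \<le> n" "0 < n"
  shows "shifted s n a p a' \<longleftrightarrow> int a' = (v + sg s * int p) mod int n"
proof -
  have "int a < int n"
    unfolding assms(1)[symmetric] using assms(3) by simp
  then have a: "a < n" by simp
  have eq: "(v + sg s * int p) mod int n = (int a + sg s * int p) mod int n"
    unfolding assms(1)[symmetric] by (rule mod_add_left_eq[symmetric])
  show ?thesis
  proof (cases s)
    case True
    have "(int a + int p) mod int n = (if a + p < n then int a + int p else int a + int p - int n)"
    proof (cases "a + p < n")
      case True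
      then show ?thesis by (simp add: mod_pos_pos_trivial)
    next
      case False
      have "(int a + int p) mod int n = (int a + int p - int n) mod int n"
        by (rule minus_mod_self2[symmetric])
      also have "\<dots> = int a + int p - int n"
        using False a assms(2) by (intro mod_pos_pos_trivial) auto
      finally show ?thesis using False by simp
    qed
    then show ?thesis unfolding eq shifted_def using True a assms(2) by auto
  next
    case False
    have "(int a - int p) mod int n = (if p \<le> a then int a - int p else int a - int p + int n)"
    proof (cases "p \<le> a")
      case True
      then show ?thesis using a by (simp add: mod_pos_pos_trivial)
    next
      case False
      have "(int a - int p) mod int n = (int a - int p + int n) mod int n"
        by (rule mod_add_self2[symmetric])
      also have "\<dots> = int a - int p + int n"
        using False a assms(2) by (intro mod_pos_pos_trivial) auto
      finally show ?thesis using False by simp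
    qed
    then show ?thesis unfolding eq shifted_def using False a assms(2) by auto
  qed
qed

section \<open>Correctness of the formulas\<close>

definition wconfig :: "bool list \<Rightarrow> nat \<Rightarrow> config" where
  "wconfig w n = periodic n (\<lambda>(i, j). bit_at w (i * n + j))"

definition represents :: "nat \<Rightarrow> nat \<Rightarrow> nat \<Rightarrow> cell \<Rightarrow> bool" where
  "represents n a b v \<longleftrightarrow> fst v mod int n = int a \<and> snd v mod int n = int b"

context
  fixes w :: "bool list" and n :: nat
  assumes n: "0 < n" "n * n < dom_size w"
begin

lemma less_dom: "x \<le> n \<Longrightarrow> x < dom_size w"
proof -
  have "n \<le> n * n" using n(1) by simp
  then show "x \<le> n \<Longrightarrow> x < dom_size w" using n(2) by linarith
qed

lemma wcell_iff:
  assumes v: "represents n a b v" and "p \<le> n" "q \<le> n"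
  shows "wcell w n s t a b p q \<longleftrightarrow> wconfig w n (fst v + sg s * int p, snd v + sg t * int q)"
proof -
  let ?i = "(fst v + sg s * int p) mod int n" and ?j = "(snd v + sg t * int q) mod int n"
  have ij: "0 \<le> ?i" "?i < int n" "0 \<le> ?j" "?j < int n" using n(1) by auto
  have "shifted s n a p i \<longleftrightarrow> i = nat ?i" "shifted t n b q j \<longleftrightarrow> j = nat ?j" for i j
    using shifted_iff[of "fst v" n a p s i] shifted_iff[of "snd v" n b q t j] v assms(2,3) n(1) ij
    by (auto simp: represents_def)
  moreover have "nat ?i < dom_size w" "nat ?j < dom_size w"
    using less_imp_le[OF ij(2)] less_imp_le[OF ij(4)] by (auto intro!: less_dom simp only: nat_le_iff)
  ultimately show ?thesis
    unfolding wcell_def wconfig_def periodic_def by auto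
qed

lemma woff_iff:
  assumes "represents n a b v" "x \<le> n" "y \<le> n"
  shows "woff w n sw s t a b x y \<longleftrightarrow> wconfig w n (off sw s t v x y)"
  using assms by (auto simp: woff_def wcell_iff off_def frame_def)

lemma warm_iff:
  assumes "represents n a b v" "d \<le> n"
  shows "warm w n sw s t a b d strict k \<longleftrightarrow> arm (wconfig w n) sw s t v d (if strict then Suc k else k)"
proof -
  have "(if strict then k < x else k \<le> x) \<longleftrightarrow> (if strict then Suc k else k) \<le> x" for x by auto
  moreover have "x < dom_size w" "y < dom_size w"
    "woff w n sw s t a b x y \<longleftrightarrow> wconfig w n (off sw s t v x y)" if "x + y = d" for x y
    using that assms(2) woff_iff[OF assms(1), of x y] by (auto intro: less_dom)
  ultimately show ?thesis unfolding warm_def arm_def by blast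
qed

lemma wcone_iff:
  assumes "represents n a b v" "d \<le> n"
  shows "wcone w n sw s a b d k \<longleftrightarrow> cone (wconfig w n) sw s v d (Suc k)"
  using warm_iff[OF assms] woff_iff[OF assms, of 0] less_dom[of 0] by (auto simp: wcone_def cone_def)

lemma wsig_iff:
  assumes "represents n a b v" "d \<le> n"
  shows "wsig w n sw s a b d \<longleftrightarrow> sig (wconfig w n) sw s v d"
proof -
  have odd: "(\<exists>h<dom_size w. K = h + h + 1) \<longleftrightarrow> odd K" if "K < d" for K
  proof
    assume "odd K"
    then obtain h where h: "K = 2 * h + 1" by (rule oddE)
    then have "h < dom_size w" using that assms(2) by (intro less_dom) simp
    then show "\<exists>h<dom_size w. K = h + h + 1" using h by auto
  qed auto
  have even: "(\<forall>h<dom_size w. K \<noteq> h + h + 1) \<longleftrightarrow> even K" if "K < d" for K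
    using odd[OF that] by blast
  have dom: "K < dom_size w" if "K < d" for K using that assms(2) by (intro less_dom) simp
  show ?thesis
    unfolding wsig_def sig_def arms_def warm_iff[OF assms] wcone_iff[OF assms] if_True if_False
    by (rule ex_cong1, rename_tac K, case_tac "K < d") (simp_all add: even[simplified] dom)
qed

lemma wfires_iff:
  assumes "represents n a b v" "d \<le> n"
  shows "wfires I w n sw s a b d \<longleftrightarrow>
    (if 3 \<in> I then cone (wconfig w n) sw s v d 1 else sig (wconfig w n) sw s v d)"
  using wcone_iff[OF assms] wsig_iff[OF assms] less_dom[of 0] by (simp add: wfires_def)

lemma warrivals_iff:
  assumes "represents n a b v" "d \<le> n"
  shows "warrivals N I w n a b d \<longleftrightarrow> arrivals I (wconfig w n) v d \<in> N"
  unfolding warrivals_def arrivals_def wfires_iff[OF assms] ..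

lemma mdist_off: "mdist v (off False s t v x y) = int (x + y)"
  by (auto simp: mdist_def off_def frame_def sg_def)

lemma mdist_ex:
  "(\<exists>z. P (mdist v z) \<and> c z) \<longleftrightarrow> (\<exists>s t x y. P (int (x + y)) \<and> c (off False s t v x y))"
proof
  assume "\<exists>z. P (mdist v z) \<and> c z"
  then obtain z where z: "P (mdist v z)" "c z" by blast
  obtain s t x y where "z = off False s t v x y" using off_abs by blast
  with z have "P (int (x + y)) \<and> c (off False s t v x y)"
    using mdist_off[of v s t x y] by simp
  then show "\<exists>s t x y. P (int (x + y)) \<and> c (off False s t v x y)" by blast
next
  assume "\<exists>s t x y. P (int (x + y)) \<and> c (off False s t v x y)"
  then obtain s t x y where "P (int (x + y))" "c (off False s t v x y)" by blast
  then have "P (mdist v (off False s t v x y)) \<and> c (off False s t v x y)" unfolding mdist_off by blast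
  then show "\<exists>z. P (mdist v z) \<and> c z" by blast
qed

lemma wnearest_iff:
  assumes "represents n a b v"
  shows "wnearest w n a b d \<longleftrightarrow> d \<le> n \<and> nearest (wconfig w n) v d"
proof (cases "d \<le> n")
  case True
  have ex: "(\<exists>s t. \<exists>x<dom_size w. \<exists>y<dom_size w. Q (x + y) \<and> woff w n False s t a b x y) \<longleftrightarrow>
      (\<exists>z. P (mdist v z) \<and> wconfig w n z)" if Q: "\<And>k. Q k \<longleftrightarrow> P (int k)" "\<And>k. Q k \<Longrightarrow> k \<le> d" for P Q
  proof -
    have "x < dom_size w \<and> y < dom_size w \<and> Q (x + y) \<and> woff w n False s t a b x y \<longleftrightarrow>
        P (int (x + y)) \<and> wconfig w n (off False s t v x y)" for s t x y
    proof (cases "Q (x + y)")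
      case Qxy: True
      then have "x \<le> n" "y \<le> n" using Q(2)[OF Qxy] True by auto
      then show ?thesis using Qxy Q(1) less_dom woff_iff[OF assms] by blast
    qed (use Q(1) in blast)
    note eq = this[symmetric]
    show ?thesis unfolding mdist_ex eq by blast
  qed
  have 1: "(\<exists>s t. \<exists>x<dom_size w. \<exists>y<dom_size w. x + y = d \<and> woff w n False s t a b x y) \<longleftrightarrow>
      (\<exists>z. mdist v z = int d \<and> wconfig w n z)"
    by (rule ex[of "\<lambda>k. k = d" "\<lambda>k. k = int d"]) auto
  have 2: "(\<exists>s t. \<exists>x<dom_size w. \<exists>y<dom_size w. x + y < d \<and> woff w n False s t a b x y) \<longleftrightarrow>
      (\<exists>z. mdist v z < int d \<and> wconfig w n z)"
    by (rule ex[of "\<lambda>k. k < d" "\<lambda>k. k < int d"]) auto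
  show ?thesis
    unfolding wnearest_def nearest_def quiet_def 1 2 using True by blast
qed (simp add: wnearest_def)

lemma wconfig_cong:
  "fst z mod int n = fst z' mod int n \<Longrightarrow> snd z mod int n = snd z' mod int n \<Longrightarrow> wconfig w n z = wconfig w n z'"
  by (cases z; cases z') (simp add: wconfig_def periodic_def)

text \<open>Both coordinates of an active cell can be moved by multiples of \<open>n\<close> to
  within \<open>n / 2\<close> of those of \<open>v\<close>; the two halves add up to at most
  \<open>n\<close>.\<close>

lemma nearest_le:
  assumes "nearest (wconfig w n) v d"
  shows "d \<le> n"
proof -
  have close: "\<exists>x. x mod int n = y mod int n \<and> 2 * \<bar>x - r\<bar> \<le> int n" for y r :: int
  proof -
    define m where "m = (y - r) mod int n"
    have m: "0 \<le> m" "m < int n" using n(1) by (auto simp: m_def)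
    have 1: "(r + m) mod int n = y mod int n" by (simp add: m_def mod_add_right_eq)
    have 2: "(r + m - int n) mod int n = y mod int n"
      using 1 by simp
    show ?thesis
    proof (cases "2 * m \<le> int n")
      case True
      then show ?thesis using 1 m by (intro exI[of _ "r + m"]) simp
    next
      case False
      then show ?thesis using 2 m by (intro exI[of _ "r + m - int n"]) simp
    qed
  qed
  obtain z where z: "wconfig w n z" using assms by (auto simp: nearest_def)
  obtain x y where x: "x mod int n = fst z mod int n" "2 * \<bar>x - fst v\<bar> \<le> int n"
    and y: "y mod int n = snd z mod int n" "2 * \<bar>y - snd v\<bar> \<le> int n"
    using close by meson
  have "wconfig w n (x, y)" using wconfig_cong[of "(x, y)" z] x(1) y(1) z by simp
  then have "\<not> mdist v (x, y) < int d" using assms by (auto simp: nearest_def quiet_def)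
  then show ?thesis using x(2) y(2) by (simp add: mdist_def)
qed

lemma wnearest_iff': "represents n a b v \<Longrightarrow> wnearest w n a b d \<longleftrightarrow> nearest (wconfig w n) v d"
  using wnearest_iff nearest_le by blast

lemma wnbr_iff:
  assumes "represents n a b v"
  shows "wnbr w n sw s a b a' b' \<longleftrightarrow> represents n a' b' (nbr sw s v)"
proof -
  have v: "fst v mod int n = int a" "snd v mod int n = int b"
    using assms by (auto simp: represents_def)
  have 1: "0 \<le> n" "1 \<le> n" using n(1) by auto
  have dom: "0 < dom_size w" "1 < dom_size w" using 1 less_dom by auto
  have "wnbr w n sw s a b a' b' \<longleftrightarrow> (if sw then shifted True n a 0 a' \<and> shifted s n b 1 b'
      else shifted s n a 1 a' \<and> shifted True n b 0 b')"
    using dom by (auto simp: wnbr_def)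
  then show ?thesis
    unfolding shifted_iff[OF v(1) 1(1) n(1)] shifted_iff[OF v(2) 1(1) n(1)]
      shifted_iff[OF v(1) 1(2) n(1)] shifted_iff[OF v(2) 1(2) n(1)]
    by (cases sw) (auto simp: represents_def off_def frame_def)
qed

lemma represents_ex: "\<exists>a<dom_size w. \<exists>b<dom_size w. represents n a b v"
proof -
  have "nat (x mod int n) < dom_size w" for x
    using n(1) by (intro less_dom) (simp add: nat_le_iff less_imp_le)
  moreover have "represents n (nat (fst v mod int n)) (nat (snd v mod int n)) v"
    using n(1) by (simp add: represents_def)
  ultimately show ?thesis by blast
qed

lemma ex_wnearest:
  assumes "represents n a b v" "\<And>d. d \<le> n \<Longrightarrow> nearest (wconfig w n) v d \<Longrightarrow> P d \<longleftrightarrow> Q d"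
  shows "(\<exists>d<dom_size w. wnearest w n a b d \<and> P d) \<longleftrightarrow> (\<exists>d. nearest (wconfig w n) v d \<and> Q d)"
  unfolding wnearest_iff'[OF assms(1)] using assms(2) nearest_le less_dom by blast

lemma ex_wnbr:
  assumes "represents n a b v" "\<And>a' b'. represents n a' b' (nbr sw s v) \<Longrightarrow> P a' b' \<longleftrightarrow> Q"
  shows "(\<exists>a'<dom_size w. \<exists>b'<dom_size w. wnbr w n sw s a b a' b' \<and> P a' b') \<longleftrightarrow> Q"
  unfolding wnbr_iff[OF assms(1)] using assms(2) represents_ex[of "nbr sw s v"] by blast

lemma wactive_iff:
  assumes I: "I = {1, 2} \<or> I = {1, 2, 3} \<or> I = {1, 2, 4}" and v: "\<not> wconfig w n v" "represents n a b v"
  shows "wactive I w n a b \<longleftrightarrow> (\<exists>t. (ftca I ^^ t) (wconfig w n) v)"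
  unfolding wactive_def active_iff[where c="wconfig w n", OF I v(1)]
proof (rule ex_wnearest[OF v(2)])
  fix d assume d: "d \<le> n"
  have "(\<exists>a'<dom_size w. \<exists>b'<dom_size w. wnbr w n sw s a b a' b' \<and>
      (\<exists>d'<dom_size w. wnearest w n a' b' d' \<and> warrivals I I w n a' b' d')) \<longleftrightarrow>
    (\<exists>d'. nearest (wconfig w n) (nbr sw s v) d' \<and> arrivals I (wconfig w n) (nbr sw s v) d' \<in> I)" for sw s
    by (intro ex_wnbr[OF v(2)] ex_wnearest warrivals_iff)
  then show "warrivals I I w n a b d \<or> 4 \<in> I \<and> warrivals {3} I w n a b d \<and> (\<exists>sw s. \<not> wsig w n sw s a b d \<and>
       (\<exists>a'<dom_size w. \<exists>b'<dom_size w. wnbr w n sw s a b a' b' \<and>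
         (\<exists>d'<dom_size w. wnearest w n a' b' d' \<and> warrivals I I w n a' b' d'))) \<longleftrightarrow>
    arrivals I (wconfig w n) v d \<in> I \<or> 4 \<in> I \<and> arrivals I (wconfig w n) v d = 3 \<and>
      (\<exists>sw s. \<not> sig (wconfig w n) sw s v d \<and>
        (\<exists>d'. nearest (wconfig w n) (nbr sw s v) d' \<and> arrivals I (wconfig w n) (nbr sw s v) d' \<in> I))"
    unfolding warrivals_iff[OF v(2) d] wsig_iff[OF v(2) d] by simp
qed

end

lemma index_less:
  fixes i j n :: nat
  assumes "i < n" "j < n"
  shows "i * n + j < n * n"
proof -
  have "i * n + j < Suc i * n" using assms by simp
  also have "\<dots> \<le> n * n" using assms by (intro mult_le_mono1) simp
  finally show ?thesis .
qed

lemma index_divmod: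
  fixes i j n :: nat
  assumes "j < n"
  shows "(i * n + j) div n = i" "(i * n + j) mod n = j"
  using assms by simp_all

lemma bit_at_encode:
  assumes "i < n" "j < n"
  shows "bit_at (encode n x u) (i * n + j) \<longleftrightarrow> x (i, j)"
    and "bit_at (encode n x u) (n * n + (i * n + j)) \<longleftrightarrow> (i, j) = u"
proof -
  note less = index_less[OF assms]
  show "bit_at (encode n x u) (i * n + j) \<longleftrightarrow> x (i, j)"
    using less index_divmod[OF assms(2), of i] by (simp add: bit_at_def encode_def nth_append)
  show "bit_at (encode n x u) (n * n + (i * n + j)) \<longleftrightarrow> (i, j) = u"
    using less index_divmod[OF assms(2), of i] by (simp add: bit_at_def encode_def nth_append)
qed

lemma periodic_cong:
  assumes "0 < n" "\<And>i j. i < n \<Longrightarrow> j < n \<Longrightarrow> x (i, j) = y (i, j)"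
  shows "periodic n x = periodic n y"
proof -
  have "nat (z mod int n) < n" for z using assms(1) by (simp add: nat_less_iff)
  then show ?thesis using assms(2) by (auto simp: periodic_def)
qed

lemma square_less_dom:
  assumes "length w = n * n + n * n" "0 < n"
  shows "n * n < dom_size w"
  using floor_log_exp2_gt[of "length w"] assms by (simp add: dom_size_def)

lemma wstable_iff:
  assumes I: "I = {1, 2} \<or> I = {1, 2, 3} \<or> I = {1, 2, 4}"
  shows "wstable I w \<longleftrightarrow> w \<in> stability I"
proof -
  have active: "wactive I w n a b \<longleftrightarrow> (\<exists>t. (ftca I ^^ t) (wconfig w n) (int a, int b))"
    if "length w = n * n + n * n" "a < n" "b < n" "\<not> bit_at w (a * n + b)" for n a b
  proof (rule wactive_iff[OF _ _ I])
    show "0 < n" using that by simp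
    with that(1) show "n * n < dom_size w" by (rule square_less_dom)
    show "\<not> wconfig w n (int a, int b)" using that by (simp add: wconfig_def periodic_def)
    show "represents n a b (int a, int b)" using that by (simp add: represents_def)
  qed
  show ?thesis
  proof
    assume "wstable I w"
    then obtain n a b where ab: "a < n" "b < n" and len: "length w = n * n + n * n"
      and u: "bit_at w (n * n + (a * n + b))"
      and uniq: "\<And>i j. i < dom_size w \<Longrightarrow> j < dom_size w \<Longrightarrow> i < n \<Longrightarrow> j < n \<Longrightarrow>
        bit_at w (n * n + (i * n + j)) \<Longrightarrow> i = a \<and> j = b"
      and x: "\<not> bit_at w (a * n + b)" and na: "\<not> wactive I w n a b"
      unfolding wstable_def by blast
    have n: "0 < n" using ab by simp
    have dom: "i < dom_size w" if "i < n" for i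
      using that square_less_dom[OF len n] by (metis less_trans le_square less_le_trans)
    \<comment> \<open>The configuration is read off the first half of the word; the marked cell is
      the unique entry of the second half.\<close>
    let ?x = "\<lambda>(i, j). bit_at w (i * n + j)"
    have "w = encode n ?x (a, b)"
    proof (rule nth_equalityI)
      show "length w = length (encode n ?x (a, b))" by (simp add: len encode_def)
      fix k assume k: "k < length w"
      show "w ! k = encode n ?x (a, b) ! k"
      proof (cases "k < n * n")
        case True
        then show ?thesis using k by (simp add: encode_def nth_append bit_at_def)
      next
        case False
        let ?i = "(k - n * n) div n" and ?j = "(k - n * n) mod n"
        have k': "k - n * n < n * n" "k = n * n + (?i * n + ?j)" using False k len by auto
        have ij: "?i < n" "?j < n"
          using k'(1) n by (auto simp: less_mult_imp_div_less)
        have "w ! k \<longleftrightarrow> bit_at w (n * n + (?i * n + ?j))"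
          using k k'(2) by (simp add: bit_at_def)
        also have "\<dots> \<longleftrightarrow> (?i, ?j) = (a, b)"
          using uniq[OF dom dom, of ?i ?j] ij u by auto
        also have "\<dots> \<longleftrightarrow> encode n ?x (a, b) ! k"
          using False k'(1) by (simp add: encode_def nth_append)
        finally show ?thesis .
      qed
    qed
    moreover have "stable I (periodic n ?x) (int a, int b)"
      using active[OF len ab x] na x ab by (auto simp: stable_def wconfig_def periodic_def)
    ultimately show "w \<in> stability I"
      unfolding stability_def using ab x by blast
  next
    assume "w \<in> stability I"
    then obtain n x a b where w: "w = encode n x (a, b)" and ab: "a < n" "b < n"
      and st: "stable I (periodic n x) (int a, int b)" and xab: "\<not> x (a, b)"
      unfolding stability_def by blast
    have n: "0 < n" using ab by simp
    have len: "length w = n * n + n * n" by (simp add: w length_encode power2_eq_square)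
    note bits = bit_at_encode[where n=n and x=x and u="(a, b)", folded w]
    have "wconfig w n = periodic n x"
      unfolding wconfig_def using n bits by (intro periodic_cong) auto
    then have na: "\<not> wactive I w n a b"
      using active[OF len ab] bits(1)[OF ab] xab st by (auto simp: stable_def)
    have dom: "n < dom_size w"
      using square_less_dom[OF len n] by (meson le_square le_less_trans)
    show "wstable I w"
      unfolding wstable_def
      using dom ab len bits(1)[OF ab] bits(2)[OF ab] bits(2) xab na
      by (intro exI[of _ n] exI[of _ a] exI[of _ b] conjI) auto
  qed
qed

theorem theorem7:
  shows "stability {1, 2} \<in> NC \<and> stability {1, 2, 3} \<in> NC \<and> stability {1, 2, 4} \<in> NC"
proof -
  have "stability I \<in> NC" if "I = {1, 2} \<or> I = {1, 2, 3} \<or> I = {1, 2, 4}" for I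
  proof -
    have "stability I = {w. wstable I w}" using wstable_iff[OF that] by blast
    then show ?thesis using fo_NC[OF fo_wstable] by simp
  qed
  then show ?thesis by blast
qed

end
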